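(* Let $n\ge1$, $\gamma\in[1,2)$, let $u_0\in H^1(\mathbb{R}^n)\cap L^\gamma(\mathbb{R}^n)$ with $u_0\ge0$ a.e. in $\mathbb{R}^n$, let $\varepsilon\in(0,1)$, and let $u_\varepsilon\in\mathcal{U}_0$ be the minimizer of $\mathcal{E}_\varepsilon$ in $\mathcal{U}_0$. Then $$\varepsilon\int_Q\partial_t u_\varepsilon\,\partial_t\eta\,dx\,dt+\int_Q(\partial_t u_\varepsilon\,\eta+\nabla u_\varepsilon\cdot\nabla\eta+f_\gamma(u_\varepsilon)\eta)\,dx\,dt=0$$ for every $\eta\in C_c^\infty(Q)$, where $Q=\mathbb{R}^n\times(0,\infty)$ and $f_\gamma(u):=\gamma\chi_{\{u>0\}}u^{\gamma-1}$.
   Context: Notation: $Q_r^+:=B_r\times(0,r^2)$, with $B_r\subset\mathbb{R}^n$ the open ball of radius $r$ centered at the origin; $\nabla$ is the gradient in $x$; $w_+=\max\{w,0\}$. $\mathcal{U}:=\bigcap_{r>0}H^1(Q_r^+)$ (first weak derivatives in $x$ and $t$ in $L^2(Q_r^+)$ for every $r>0$) and $\mathcal{U}_0:=\{u\in\mathcal{U}:u|_{t=0}=u_0\}$ in the sense of traces. For $\varepsilon\in(0,1)$ and $w\in\mathcal{U}$, $$\mathcal{E}_\varepsilon(w):=\int_0^\infty\frac{e^{-t/\varepsilon}}{\varepsilon}\left(\int_{\mathbb{R}^n}(\varepsilon|\partial_t w|^2+|\nabla w|^2)\,dx+2\int_{\mathbb{R}^n}w_+^\gamma\,dx\right)dt\in[0,+\infty].$$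 A minimizer in $\mathcal{U}_0$ is an absolute minimizer over $\mathcal{U}_0$; it exists and is unique. For $\gamma=1$, $f_1(u)=\chi_{\{u>0\}}$; for $\gamma>1$, $f_\gamma(u)=\gamma u_+^{\gamma-1}$. *)

theory Defs
  imports "HOL-Analysis.Analysis"
begin

section \<open>Smooth functions and test functions\<close>

definition partial_deriv :: "'b::euclidean_space \<Rightarrow> ('b \<Rightarrow> real) \<Rightarrow> 'b \<Rightarrow> real" where
  "partial_deriv b f z = frechet_derivative f (at z) b"

fun Ck :: "nat \<Rightarrow> ('b::euclidean_space \<Rightarrow> real) \<Rightarrow> bool" where
  "Ck 0 f \<longleftrightarrow> continuous_on UNIV f"
| "Ck (Suc k) f \<longleftrightarrow> (\<forall>z. f differentiable (at z)) \<and> (\<forall>b\<in>Basis. Ck k (partial_deriv b f))"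

definition smooth :: "('b::euclidean_space \<Rightarrow> real) \<Rightarrow> bool" where
  "smooth f \<longleftrightarrow> (\<forall>k. Ck k f)"

text \<open>Elements of \<open>C\<^sub>c\<^sup>\<infinity>(U)\<close> are identified with their extensions by zero to the whole space.\<close>

definition test_functions :: "'b::euclidean_space set \<Rightarrow> ('b \<Rightarrow> real) set" where
  "test_functions U =
     {\<phi>. smooth \<phi> \<and> compact (closure {z. \<phi> z \<noteq> 0}) \<and> closure {z. \<phi> z \<noteq> 0} \<subseteq> U}"


section \<open>Lebesgue and Sobolev spaces\<close>

text \<open>
  Members of these spaces are functions on the whole space type, of which only the values on
  \<open>U\<close> matter, and they stand for their almost-everywhere equivalence classes.
\<close>

definition Lp_on :: "real \<Rightarrow> 'b::euclidean_space set \<Rightarrow> ('b \<Rightarrow> real) set" where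
  "Lp_on p U =
     {f. f \<in> borel_measurable (lebesgue_on U) \<and> integrable (lebesgue_on U) (\<lambda>z. \<bar>f z\<bar> powr p)}"

definition loc_integrable_on :: "'b::euclidean_space set \<Rightarrow> ('b \<Rightarrow> real) \<Rightarrow> bool" where
  "loc_integrable_on U f \<longleftrightarrow> (\<forall>K. compact K \<and> K \<subseteq> U \<longrightarrow> integrable (lebesgue_on K) f)"

definition has_weak_deriv ::
    "'b::euclidean_space set \<Rightarrow> 'b \<Rightarrow> ('b \<Rightarrow> real) \<Rightarrow> ('b \<Rightarrow> real) \<Rightarrow> bool" where
  "has_weak_deriv U b f g \<longleftrightarrow>
     loc_integrable_on U f \<and> loc_integrable_on U g \<and>
     (\<forall>\<phi>\<in>test_functions U.
        (\<integral>z. f z * partial_deriv b \<phi> z \<partial>(lebesgue_on U)) = - (\<integral>z. g z * \<phi> z \<partial>(lebesgue_on U)))"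

text \<open>On an open \<open>U\<close> a weak derivative is unique almost everywhere; this selects a representative.\<close>

definition weak_deriv :: "'b::euclidean_space set \<Rightarrow> 'b \<Rightarrow> ('b \<Rightarrow> real) \<Rightarrow> 'b \<Rightarrow> real" where
  "weak_deriv U b f = (SOME g. has_weak_deriv U b f g)"

definition H1_on :: "'b::euclidean_space set \<Rightarrow> ('b \<Rightarrow> real) set" where
  "H1_on U = {f. f \<in> Lp_on 2 U \<and> (\<forall>b\<in>Basis. \<exists>g\<in>Lp_on 2 U. has_weak_deriv U b f g)}"

definition H1_norm_sq :: "'b::euclidean_space set \<Rightarrow> ('b \<Rightarrow> real) \<Rightarrow> ennreal" where
  "H1_norm_sq U f =
     (\<integral>\<^sup>+z\<in>U. ennreal ((f z)\<^sup>2) \<partial>lebesgue) +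
     (\<Sum>b\<in>Basis. \<integral>\<^sup>+z\<in>U. ennreal ((weak_deriv U b f z)\<^sup>2) \<partial>lebesgue)"


section \<open>The minimization problem\<close>

text \<open>Points of space-time are pairs \<open>(x, t)\<close>.\<close>

definition Q_cyl :: "real \<Rightarrow> ('a::euclidean_space \<times> real) set" where
  "Q_cyl r = ball 0 r \<times> {0<..<r\<^sup>2}"

definition Q_all :: "('a::euclidean_space \<times> real) set" where
  "Q_all = UNIV \<times> {0<..}"

definition \<U> :: "('a::euclidean_space \<times> real \<Rightarrow> real) set" where
  "\<U> = (\<Inter>r\<in>{0<..}. H1_on (Q_cyl r))"

text \<open>
  The trace on \<open>{t = 0}\<close> is the continuous extension of the restriction \<open>\<phi> \<mapsto> \<phi>(\<cdot>, 0)\<close> from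
  functions smooth up to the boundary: \<open>g\<close> is the trace of \<open>u \<in> H\<^sup>1(Q\<^sub>r\<^sup>+)\<close> on \<open>B\<^sub>r\<close> if it is the
  \<open>L\<^sup>2(B\<^sub>r)\<close> limit of the restrictions of smooth functions converging to \<open>u\<close> in \<open>H\<^sup>1(Q\<^sub>r\<^sup>+)\<close>.
\<close>

definition has_initial_trace ::
    "real \<Rightarrow> ('a::euclidean_space \<times> real \<Rightarrow> real) \<Rightarrow> ('a \<Rightarrow> real) \<Rightarrow> bool" where
  "has_initial_trace r u g \<longleftrightarrow>
     u \<in> H1_on (Q_cyl r) \<and>
     (\<exists>\<phi> :: nat \<Rightarrow> 'a \<times> real \<Rightarrow> real.
        (\<forall>k. smooth (\<phi> k)) \<and>
        (\<lambda>k. H1_norm_sq (Q_cyl r) (\<lambda>z. \<phi> k z - u z)) \<longlonglongrightarrow> 0 \<and>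
        (\<lambda>k. \<integral>\<^sup>+x\<in>ball 0 r. ennreal ((\<phi> k (x, 0) - g x)\<^sup>2) \<partial>lebesgue) \<longlonglongrightarrow> 0)"

definition \<U>\<^sub>0 :: "('a::euclidean_space \<Rightarrow> real) \<Rightarrow> ('a \<times> real \<Rightarrow> real) set" where
  "\<U>\<^sub>0 u0 = {u \<in> \<U>. \<forall>r>0. has_initial_trace r u u0}"

definition dt :: "('a::euclidean_space \<times> real \<Rightarrow> real) \<Rightarrow> 'a \<times> real \<Rightarrow> real" where
  "dt w = weak_deriv Q_all (0, 1) w"

definition grad_x :: "('a::euclidean_space \<times> real \<Rightarrow> real) \<Rightarrow> 'a \<times> real \<Rightarrow> 'a" where
  "grad_x w z = (\<Sum>i\<in>Basis. weak_deriv Q_all (i, 0) w z *\<^sub>R i)"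

definition energy ::
    "real \<Rightarrow> real \<Rightarrow> ('a::euclidean_space \<times> real \<Rightarrow> real) \<Rightarrow> ennreal" where
  "energy \<epsilon> \<gamma> w =
     (\<integral>\<^sup>+t\<in>{0<..}. ennreal (exp (- t / \<epsilon>) / \<epsilon>) *
        ((\<integral>\<^sup>+x. ennreal (\<epsilon> * \<bar>dt w (x, t)\<bar>\<^sup>2 + (norm (grad_x w (x, t)))\<^sup>2) \<partial>lebesgue) +
         2 * (\<integral>\<^sup>+x. ennreal (max (w (x, t)) 0 powr \<gamma>) \<partial>lebesgue)) \<partial>lebesgue)"

definition f_reac :: "real \<Rightarrow> real \<Rightarrow> real" where
  "f_reac \<gamma> s = \<gamma> * indicator {0<..} s * s powr (\<gamma> - 1)"

text \<open>Classical derivatives, for test functions.\<close>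

definition dt_cl :: "('a::euclidean_space \<times> real \<Rightarrow> real) \<Rightarrow> 'a \<times> real \<Rightarrow> real" where
  "dt_cl \<eta> = partial_deriv (0, 1) \<eta>"

definition grad_x_cl :: "('a::euclidean_space \<times> real \<Rightarrow> real) \<Rightarrow> 'a \<times> real \<Rightarrow> 'a" where
  "grad_x_cl \<eta> z = (\<Sum>i\<in>Basis. partial_deriv (i, 0) \<eta> z *\<^sub>R i)"

end

(*
  Since the stationary extension of u0 has finite energy, so has the minimizer u. Comparing u with
  u + delta e^(t/epsilon) eta, where the factor e^(t/epsilon) cancels the weight, and letting
  delta -> 0+ gives Lambda(eta) >= 0 for the left-hand side Lambda of the equation, up to the term
  int_{u = 0} eta_+ that comes from the jump of f_1 when gamma = 1. For gamma > 1 the equation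
  follows by replacing eta with -eta.

  For gamma = 1 one is left with |Lambda(eta)| <= int_{u = 0} |eta|, so (epsilon d_tt + Laplace) u is
  locally square integrable. For smooth compactly supported v the identity
  int v_aa v_bb = int (v_ab)^2 >= 0 bounds every pure second derivative of v in L^2 by the elliptic
  operator, uniformly for the mollifications of a cutoff of u. Second derivatives bounded in L^2 have
  no mass, in the limit, on the set where u and hence its gradient vanish. So the residual, which
  lives on {u = 0}, vanishes.
*)

theory Submission
  imports Defs
begin

section \<open>Smooth and compactly supported functions\<close>

text \<open>For \<open>\<gamma> = 1\<close> the reaction term jumps at 0, so the energy has only
  one-sided derivatives in directions that do not vanish on {u = 0}, and minimality gives an
  inequality there. The equation survives because on {u = 0} its terms vanish one by one: the time
  derivative and \<open>f_reac 1 u\<close> because u = 0, the second order part because the gradient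
  is 0. As u is not known to have second derivatives, the last claim is made for mollifications with
  an L2 bound that does not depend on the radius; no weak second derivative is ever constructed. The
  bound rests on the operator being diagonal with constant positive coefficients, so that all mixed
  products in its square have nonnegative integral. Restricting the residual to {u = 0} multiplies a
  test function by an indicator, which destroys smoothness; hence the test function is mollified as
  well, and the kernel is passed back to u.

  A second obstacle is measurability: Sobolev functions are only Lebesgue measurable and
  \<open>weak_deriv\<close> is an arbitrary choice, so all computations use Borel representatives
  over \<open>lborel\<close>.\<close>

lemma partial_deriv_eq:
  "(f has_derivative f') (at z) \<Longrightarrow> partial_deriv b f z = f' b"
  unfolding partial_deriv_def by (metis frechet_derivative_at)

lemma has_derivative_partial:
  "f differentiable (at z) \<Longrightarrow> (f has_derivative frechet_derivative f (at z)) (at z)"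
  by (simp add: frechet_derivative_works)

lemma partial_deriv_cong_open:
  assumes "open S" "z \<in> S" "\<And>y. y \<in> S \<Longrightarrow> f y = g y"
  shows "partial_deriv b f z = partial_deriv b g z"
proof -
  have "(f has_derivative D) (at z) \<longleftrightarrow> (g has_derivative D) (at z)" for D
    using assms by (metis has_derivative_transform_within_open)
  then show ?thesis
    by (simp add: partial_deriv_def frechet_derivative_def)
qed

lemma Ck_imp_continuous: "Ck k f \<Longrightarrow> continuous_on UNIV f"
proof (induction k)
  case (Suc k)
  then have "f differentiable_on UNIV"
    by (simp add: differentiable_on_def)
  then show ?case by (rule differentiable_imp_continuous_on)
qed simp

lemma Ck_Suc_imp: "Ck (Suc k) f \<Longrightarrow> Ck k f"
proof (induction k arbitrary: f)
  case 0
  then show ?case using Ck_imp_continuous by (metis Ck.simps(1))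
next
  case (Suc k)
  then show ?case by (metis Ck.simps(2))
qed

text \<open>Replaces induction on the order of differentiability by closure of a class
  \<open>P\<close> under partial derivatives. Reflections, linear substitutions, exponentials and
  convolutions each form such a class.\<close>

lemma smooth_coinduct:
  assumes "P f"
    and "\<And>f. P f \<Longrightarrow> (\<forall>z. f differentiable (at z)) \<and> (\<forall>b\<in>Basis. P (partial_deriv b f))"
  shows "smooth f"
proof -
  have "\<forall>f. P f \<longrightarrow> Ck k f" for k
  proof (induction k)
    case 0
    show ?case
    proof (intro allI impI)
      fix f assume "P f"
      then have "\<forall>z. f differentiable (at z)" using assms(2) by blast
      then show "Ck 0 f"
        by (simp add: differentiable_imp_continuous_on differentiable_on_def
            differentiable_at_withinI)
    qed
  next
    case (Suc k)
    then show ?case using assms(2) by auto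
  qed
  then show ?thesis using assms(1) by (auto simp: smooth_def)
qed

lemma smooth_differentiable: "smooth f \<Longrightarrow> f differentiable (at z)"
  unfolding smooth_def by (metis Ck.simps(2))

lemma smooth_has_derivative:
  "smooth f \<Longrightarrow> (f has_derivative frechet_derivative f (at z)) (at z)"
  using smooth_differentiable has_derivative_partial by blast

lemma smooth_partial: "smooth f \<Longrightarrow> b \<in> Basis \<Longrightarrow> smooth (partial_deriv b f)"
  unfolding smooth_def by (metis Ck.simps(2))

lemma smooth_continuous: "smooth f \<Longrightarrow> continuous_on UNIV f"
  unfolding smooth_def by (metis Ck.simps(1))

lemma smooth_borel [measurable]: "smooth f \<Longrightarrow> f \<in> borel_measurable borel"
  using smooth_continuous borel_measurable_continuous_onI by blast

lemma partial_deriv_const [simp]: "partial_deriv b (\<lambda>z. c) = (\<lambda>z. 0)"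
  by (rule ext, rule partial_deriv_eq[OF has_derivative_const])

lemma partial_deriv_add:
  assumes "f differentiable (at z)" "g differentiable (at z)"
  shows "partial_deriv b (\<lambda>z. f z + g z) z = partial_deriv b f z + partial_deriv b g z"
  using partial_deriv_eq[OF has_derivative_add[OF has_derivative_partial[OF assms(1)]
      has_derivative_partial[OF assms(2)]]] by (simp add: partial_deriv_def)

lemma partial_deriv_mult:
  assumes "f differentiable (at z)" "g differentiable (at z)"
  shows "partial_deriv b (\<lambda>z. f z * g z) z = partial_deriv b f z * g z + f z * partial_deriv b g z"
  using partial_deriv_eq[OF has_derivative_mult[OF has_derivative_partial[OF assms(1)]
      has_derivative_partial[OF assms(2)]]] by (simp add: partial_deriv_def algebra_simps)

lemma partial_deriv_cmult:
  assumes "f differentiable (at z)"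
  shows "partial_deriv b (\<lambda>z. c * f z) z = c * partial_deriv b f z"
  using partial_deriv_mult[OF differentiable_const assms] by simp

lemma partial_deriv_scaled_direction:
  assumes "f differentiable (at z)"
  shows "frechet_derivative f (at z) (c *\<^sub>R b) = c * partial_deriv b f z"
  using linear_scale[OF linear_frechet_derivative[OF assms]] by (simp add: partial_deriv_def)

lemma partial_deriv_chain:
  assumes "q differentiable (at z)" "(F has_real_derivative d) (at (q z))"
  shows "partial_deriv b (\<lambda>z. F (q z)) z = d * partial_deriv b q z"
proof -
  have "((\<lambda>z. F (q z)) has_derivative (\<lambda>h. d * frechet_derivative q (at z) h)) (at z)"
    using has_derivative_compose[OF has_derivative_partial[OF assms(1)]
        assms(2)[unfolded has_field_derivative_def]] by (simp add: mult.commute)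
  from partial_deriv_eq[OF this] show ?thesis by (simp add: partial_deriv_def)
qed

section \<open>Algebra of smooth functions\<close>

lemma Ck_const: "Ck k (\<lambda>z. c)"
  by (induction k arbitrary: c) auto

lemma Ck_add: "Ck k f \<Longrightarrow> Ck k g \<Longrightarrow> Ck k (\<lambda>z. f z + g z)"
proof (induction k arbitrary: f g)
  case 0
  then show ?case by (auto intro: continuous_on_add)
next
  case (Suc k)
  have "partial_deriv b (\<lambda>z. f z + g z) = (\<lambda>z. partial_deriv b f z + partial_deriv b g z)" for b
    using Suc.prems by (intro ext partial_deriv_add) auto
  with Suc show ?case by (auto intro: differentiable_add)
qed

lemma Ck_mult: "Ck k f \<Longrightarrow> Ck k g \<Longrightarrow> Ck k (\<lambda>z. f z * g z)"
proof (induction k arbitrary: f g)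
  case 0
  then show ?case by (auto intro: continuous_on_mult)
next
  case (Suc k)
  have "partial_deriv b (\<lambda>z. f z * g z) = (\<lambda>z. partial_deriv b f z * g z + f z * partial_deriv b g z)" for b
    using Suc.prems by (intro ext partial_deriv_mult) auto
  moreover have "Ck k f" "Ck k g" using Suc.prems Ck_Suc_imp by blast+
  ultimately show ?case using Suc by (auto intro: differentiable_mult Ck_add)
qed

lemma smooth_const [simp, intro]: "smooth (\<lambda>z. c)"
  by (simp add: smooth_def Ck_const)

lemma smooth_add: "smooth f \<Longrightarrow> smooth g \<Longrightarrow> smooth (\<lambda>z. f z + g z)"
  by (simp add: smooth_def Ck_add)

lemma smooth_mult: "smooth f \<Longrightarrow> smooth g \<Longrightarrow> smooth (\<lambda>z. f z * g z)"
  by (simp add: smooth_def Ck_mult)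

lemma smooth_cmult: "smooth f \<Longrightarrow> smooth (\<lambda>z. c * f z)"
  using smooth_mult[OF smooth_const] by blast

lemma smooth_uminus: "smooth f \<Longrightarrow> smooth (\<lambda>z. - f z)"
  using smooth_cmult[of f "-1"] by simp

lemma smooth_diff: "smooth f \<Longrightarrow> smooth g \<Longrightarrow> smooth (\<lambda>z. f z - g z)"
  using smooth_add[OF _ smooth_uminus] by simp

lemma smooth_inner_left: "smooth (\<lambda>z. z \<bullet> w)"
proof -
  have d: "((\<lambda>z. z \<bullet> w) has_derivative (\<lambda>h. h \<bullet> w)) (at z)" for z
    by (intro derivative_eq_intros) auto
  then have "partial_deriv b (\<lambda>z. z \<bullet> w) = (\<lambda>z. b \<bullet> w)" for b
    by (intro ext partial_deriv_eq[OF d])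
  moreover have "(\<lambda>z. z \<bullet> w) differentiable at z" for z using d differentiable_def by blast
  ultimately show ?thesis
    by (intro smooth_coinduct[where P="\<lambda>f. f = (\<lambda>z. z \<bullet> w) \<or> (\<exists>c. f = (\<lambda>z. c))"]) auto
qed

lemma smooth_sum: "finite A \<Longrightarrow> (\<And>i. i \<in> A \<Longrightarrow> smooth (f i)) \<Longrightarrow> smooth (\<lambda>z. \<Sum>i\<in>A. f i z)"
  by (induction A rule: finite_induct) (auto intro: smooth_add)

lemma smooth_norm_sq: "smooth (\<lambda>z::'b::euclidean_space. z \<bullet> z)"
proof -
  have "smooth (\<lambda>z::'b. \<Sum>b\<in>Basis. (z \<bullet> b) * (z \<bullet> b))"
    by (intro smooth_sum smooth_mult smooth_inner_left) auto
  then show ?thesis by (subst euclidean_inner) simp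
qed

text \<open>The functions \<open>x\<^sup>-\<^sup>k e\<^sup>-\<^sup>1\<^sup>/\<^sup>x\<close> for \<open>x > 0\<close> span a space that is closed under differentiation.\<close>

definition flat_exp :: "nat \<Rightarrow> real \<Rightarrow> real" where
  "flat_exp k x = (if x > 0 then (1/x)^k * exp (- (1/x)) else 0)"

lemma flat_exp_tendsto_0: "((\<lambda>x. flat_exp k x) \<longlongrightarrow> 0) (at_right 0)"
proof -
  have "(((\<lambda>x. x ^ k / exp x) \<circ> inverse) \<longlongrightarrow> (0::real)) (at_right 0)"
    unfolding comp_def
    by (rule filterlim_compose[OF tendsto_power_div_exp_0 filterlim_inverse_at_top_right])
  then show ?thesis
  proof (rule Lim_transform_eventually)
    show "\<forall>\<^sub>F x in at_right 0. ((\<lambda>x. x ^ k / exp x) \<circ> inverse) x = flat_exp k x"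
      by (auto simp: eventually_at_filter flat_exp_def exp_minus field_simps)
  qed
qed

lemma flat_exp_deriv:
  "(flat_exp k has_real_derivative (flat_exp (k+2) x - real k * flat_exp (k+1) x)) (at x)"
proof -
  consider "x > 0" | "x < 0" | "x = 0" by linarith
  then show ?thesis
  proof cases
    case 1
    have "((\<lambda>x. (1/x)^k * exp (- (1/x))) has_real_derivative
        (real k * (1/x)^(k-1) * (- (1/x^2)) * exp (- (1/x)) + (1/x)^k * (exp (- (1/x)) * (1/x^2)))) (at x)"
      using 1 by (auto intro!: derivative_eq_intros simp: power2_eq_square)
    also have "(real k * (1/x)^(k-1) * (- (1/x^2)) * exp (- (1/x)) + (1/x)^k * (exp (- (1/x)) * (1/x^2)))
       = flat_exp (k+2) x - real k * flat_exp (k+1) x"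
      \<comment> \<open>\<open>k - 1\<close> is truncated at \<open>k = 0\<close>; there the factor
        \<open>real k\<close> removes the term.\<close>
      using 1 by (cases k) (auto simp: flat_exp_def power2_eq_square field_simps)
    finally show ?thesis
      by (rule has_field_derivative_transform_within_open[where S="{0<..}"]) (use 1 in \<open>auto simp: flat_exp_def\<close>)
  next
    case 2
    have "((\<lambda>x. 0) has_real_derivative 0) (at x)" by simp
    then have "(flat_exp k has_real_derivative 0) (at x)"
      by (rule has_field_derivative_transform_within_open[where S="{..<0}"]) (use 2 in \<open>auto simp: flat_exp_def\<close>)
    then show ?thesis using 2 by (simp add: flat_exp_def)
  next
    case 3
    have "((\<lambda>h. (flat_exp k (0 + h) - flat_exp k 0) / h) \<longlongrightarrow> 0) (at 0)"
    proof (rule filterlim_split_at)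
      have "eventually (\<lambda>h. (flat_exp k (0 + h) - flat_exp k 0) / h = 0) (at_left (0::real))"
        by (auto simp: eventually_at_filter flat_exp_def)
      then show "((\<lambda>h. (flat_exp k (0 + h) - flat_exp k 0) / h) \<longlongrightarrow> 0) (at_left 0)"
        by (simp add: tendsto_eventually)
      \<comment> \<open>Dividing by \<open>h\<close> raises the power of \<open>1 / h\<close> by
        one, so the right difference quotient at 0 is \<open>flat_exp (Suc k)\<close>.\<close>
      show "((\<lambda>h. (flat_exp k (0 + h) - flat_exp k 0) / h) \<longlongrightarrow> 0) (at_right 0)"
        by (rule Lim_transform_eventually[OF flat_exp_tendsto_0[of "Suc k"]])
           (auto simp: eventually_at_filter flat_exp_def)
    qed
    then show ?thesis using 3 by (simp add: DERIV_def flat_exp_def)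
  qed
qed

text \<open>The induction runs over all \<open>k\<close> at once: the chain rule trades
  \<open>flat_exp k\<close> for \<open>flat_exp (k+1)\<close> and \<open>flat_exp (k+2)\<close> at
  one order less.\<close>

lemma Ck_flat_exp_comp: "smooth q \<Longrightarrow> Ck n (\<lambda>z. flat_exp k (q z))"
proof (induction n arbitrary: k)
  case 0
  have "continuous_on UNIV (flat_exp k)"
    using flat_exp_deriv DERIV_isCont continuous_at_imp_continuous_on by blast
  then show ?case using smooth_continuous[OF 0] continuous_on_compose2
    by (metis Ck.simps(1) subset_UNIV)
next
  case (Suc n)
  note q = smooth_differentiable[OF Suc.prems]
  have pd: "partial_deriv b (\<lambda>z. flat_exp k (q z)) =
    (\<lambda>z. (flat_exp (k+2) (q z) + (- real k) * flat_exp (k+1) (q z)) * partial_deriv b q z)" for b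
    by (rule ext) (simp add: partial_deriv_chain[OF q flat_exp_deriv])
  have pq: "Ck n (partial_deriv b q)" if "b \<in> Basis" for b
    using smooth_partial[OF Suc.prems that] by (simp add: smooth_def)
  have "(\<lambda>z. flat_exp k (q z)) differentiable (at z)" for z
    using has_derivative_compose[OF has_derivative_partial[OF q] flat_exp_deriv[unfolded has_field_derivative_def]]
      differentiable_def by blast
  moreover have c: "Ck n (\<lambda>z. flat_exp (k+2) (q z) + (- real k) * flat_exp (k+1) (q z))"
    by (intro Ck_add Ck_mult Ck_const Suc)
  moreover have "Ck n (partial_deriv b (\<lambda>z. flat_exp k (q z)))" if "b \<in> Basis" for b
    unfolding pd by (rule Ck_mult[OF c pq[OF that]])
  ultimately show ?case by simp
qed

lemma smooth_flat_exp_comp: "smooth q \<Longrightarrow> smooth (\<lambda>z. flat_exp k (q z))"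
  by (simp add: smooth_def Ck_flat_exp_comp)

section \<open>Smoothness under reflections and linear substitutions\<close>

lemma smooth_reflect:
  assumes "smooth f"
  shows "smooth (\<lambda>y. f (x - y))"
    and partial_deriv_reflect: "partial_deriv b (\<lambda>y. f (x - y)) y = - partial_deriv b f (x - y)"
proof -
  have d: "((\<lambda>y. f (x - y)) has_derivative (\<lambda>h. frechet_derivative f (at (x - y)) (-h))) (at y)"
    if "smooth f" for f y
    by (rule has_derivative_compose[where f="\<lambda>y. x - y", OF _ smooth_has_derivative[OF that]])
       (auto intro!: derivative_eq_intros)
  have p: "partial_deriv b (\<lambda>y. f (x - y)) y = - partial_deriv b f (x - y)" if "smooth f" for f b y
    using partial_deriv_eq[OF d[OF that]] linear_neg[OF linear_frechet_derivative[OF smooth_differentiable[OF that]]]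
    by (simp add: partial_deriv_def)
  show "partial_deriv b (\<lambda>y. f (x - y)) y = - partial_deriv b f (x - y)" by (rule p[OF assms])
  show "smooth (\<lambda>y. f (x - y))"
  proof (rule smooth_coinduct[where P="\<lambda>g. \<exists>f. smooth f \<and> g = (\<lambda>y. f (x - y))"])
    fix g assume "\<exists>f. smooth f \<and> g = (\<lambda>y. f (x - y))"
    then obtain f where f: "smooth f" "g = (\<lambda>y. f (x - y))" by blast
    have "partial_deriv b g = (\<lambda>y. (\<lambda>y. - partial_deriv b f y) (x - y))" for b
      using p[OF f(1)] f(2) by auto
    then show "(\<forall>z. g differentiable (at z)) \<and> (\<forall>b\<in>Basis. \<exists>f. smooth f \<and> partial_deriv b g = (\<lambda>y. f (x - y)))"
      using f smooth_uminus[OF smooth_partial[OF f(1)]] d[OF f(1)] differentiable_def by blast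
  qed (use assms in auto)
qed

text \<open>\<open>smooth\<close> speaks of derivatives along basis vectors only, so
  \<open>L\<close> has to send each basis vector to a basis vector or to 0. The value 0 is reached
  by \<open>fst\<close>, which kills the time direction; freezing one of the two variables gives the
  other instances.\<close>

lemma smooth_linear_comp:
  fixes L :: "'a::euclidean_space \<Rightarrow> 'b::euclidean_space"
  assumes f: "smooth f" and L: "\<And>y. (A has_derivative L) (at y)"
    and B: "\<And>b. b \<in> Basis \<Longrightarrow> L b \<in> insert 0 Basis"
  shows "smooth (\<lambda>y. f (A y))"
    and partial_deriv_linear_comp: "partial_deriv b (\<lambda>y. f (A y)) y = partial_deriv (L b) f (A y)"
proof -
  have d: "((\<lambda>y. f (A y)) has_derivative (\<lambda>h. frechet_derivative f (at (A y)) (L h))) (at y)"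
    if "smooth f" for f y
    by (rule has_derivative_compose[OF L smooth_has_derivative[OF that]])
  have p: "partial_deriv b (\<lambda>y. f (A y)) y = partial_deriv (L b) f (A y)" if "smooth f" for f b y
    using partial_deriv_eq[OF d[OF that]] by (simp add: partial_deriv_def)
  have z: "smooth (partial_deriv 0 f)" if "smooth f" for f :: "'b \<Rightarrow> real"
  proof -
    have "partial_deriv 0 f = (\<lambda>z. 0)"
      using linear_0[OF linear_frechet_derivative[OF smooth_differentiable[OF that]]]
      by (auto simp: partial_deriv_def)
    then show ?thesis by simp
  qed
  show "partial_deriv b (\<lambda>y. f (A y)) y = partial_deriv (L b) f (A y)" by (rule p[OF f])
  show "smooth (\<lambda>y. f (A y))"
  proof (rule smooth_coinduct[where P="\<lambda>g. \<exists>f. smooth f \<and> g = (\<lambda>y. f (A y))"])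
    fix g assume "\<exists>f. smooth f \<and> g = (\<lambda>y. f (A y))"
    then obtain f where f: "smooth f" "g = (\<lambda>y. f (A y))" by blast
    have "\<exists>f. smooth f \<and> partial_deriv b g = (\<lambda>y. f (A y))" if "b \<in> Basis" for b
    proof (intro exI conjI)
      show "smooth (partial_deriv (L b) f)" using B[OF that] z[OF f(1)] smooth_partial[OF f(1)] by auto
      show "partial_deriv b g = (\<lambda>y. partial_deriv (L b) f (A y))" using p[OF f(1)] f(2) by auto
    qed
    then show "(\<forall>z. g differentiable (at z)) \<and> (\<forall>b\<in>Basis. \<exists>f. smooth f \<and> partial_deriv b g = (\<lambda>y. f (A y)))"
      using f(2) d[OF f(1)] differentiable_def by blast
  qed (use f in auto)
qed

lemma smooth_exp_snd:
  "smooth (\<lambda>z::'a::euclidean_space \<times> real. exp (snd z / \<epsilon>))"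
  and partial_deriv_exp_snd:
  "partial_deriv b (\<lambda>z::'a \<times> real. exp (snd z / \<epsilon>)) z = exp (snd z / \<epsilon>) * (snd b / \<epsilon>)"
proof -
  have d: "((\<lambda>z::'a \<times> real. exp (snd z / \<epsilon>)) has_derivative (\<lambda>h. exp (snd z / \<epsilon>) * (snd h / \<epsilon>))) (at z)" for z
    by (auto intro!: derivative_eq_intros simp: divide_inverse)
  show p: "partial_deriv b (\<lambda>z::'a \<times> real. exp (snd z / \<epsilon>)) z = exp (snd z / \<epsilon>) * (snd b / \<epsilon>)" for b z
    by (rule partial_deriv_eq[OF d])
  have df: "(\<lambda>z::'a \<times> real. exp (snd z / \<epsilon>)) differentiable (at z)" for z
    using d differentiable_def by blast
  show "smooth (\<lambda>z::'a \<times> real. exp (snd z / \<epsilon>))"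
  proof (rule smooth_coinduct[where P="\<lambda>f. \<exists>c. f = (\<lambda>z::'a \<times> real. c * exp (snd z / \<epsilon>))"])
    fix f assume "\<exists>c. f = (\<lambda>z::'a \<times> real. c * exp (snd z / \<epsilon>))"
    then obtain c where f: "f = (\<lambda>z. c * exp (snd z / \<epsilon>))" by blast
    have "partial_deriv b f = (\<lambda>z. (c * (snd b / \<epsilon>)) * exp (snd z / \<epsilon>))" for b
      unfolding f by (rule ext) (simp add: partial_deriv_cmult[OF df] p)
    then show "(\<forall>z. f differentiable (at z)) \<and> (\<forall>b\<in>Basis. \<exists>c. partial_deriv b f = (\<lambda>z. c * exp (snd z / \<epsilon>)))"
      using differentiable_mult[OF differentiable_const df, of c] f by blast
  qed (rule exI[of _ 1], simp)
qed

section \<open>Test functions\<close>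

abbreviation supp :: "('b::euclidean_space \<Rightarrow> real) \<Rightarrow> 'b set" where
  "supp f \<equiv> closure {z. f z \<noteq> 0}"

lemma test_functionsD:
  assumes "\<phi> \<in> test_functions U"
  shows "smooth \<phi>" "compact (supp \<phi>)" "supp \<phi> \<subseteq> U"
  using assms by (auto simp: test_functions_def)

lemma test_functions_mono: "U \<subseteq> V \<Longrightarrow> \<phi> \<in> test_functions U \<Longrightarrow> \<phi> \<in> test_functions V"
  by (auto simp: test_functions_def)

lemma test_functionsI:
  assumes "smooth \<phi>" "compact K" "K \<subseteq> U" "\<And>z. z \<notin> K \<Longrightarrow> \<phi> z = 0"
  shows "\<phi> \<in> test_functions U"
proof -
  have "{z. \<phi> z \<noteq> 0} \<subseteq> K" using assms(4) by blast
  then have *: "supp \<phi> \<subseteq> K" using assms(2) closure_minimal compact_imp_closed by blast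
  then have "compact (supp \<phi>)" using assms(2)
    by (meson bounded_subset closed_closure compact_eq_bounded_closed)
  with * assms show ?thesis by (auto simp: test_functions_def)
qed

lemma not_in_supp: "z \<notin> supp \<phi> \<Longrightarrow> \<phi> z = 0"
  using closure_subset[of "{z. \<phi> z \<noteq> 0}"] by blast

lemma partial_deriv_not_in_supp:
  assumes "z \<notin> supp \<phi>"
  shows "partial_deriv b \<phi> z = 0"
proof -
  have "partial_deriv b \<phi> z = partial_deriv b (\<lambda>z. 0) z"
  proof (rule partial_deriv_cong_open[of "- supp \<phi>"])
    show "\<phi> y = 0" if "y \<in> - supp \<phi>" for y using that not_in_supp[of y \<phi>] by blast
  qed (use assms in auto)
  then show ?thesis by simp
qed

lemma test_functions_partial:
  assumes "\<phi> \<in> test_functions U" "b \<in> Basis"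
  shows "partial_deriv b \<phi> \<in> test_functions U"
  by (rule test_functionsI[OF smooth_partial[OF test_functionsD(1)[OF assms(1)] assms(2)]
      test_functionsD(2,3)[OF assms(1)] partial_deriv_not_in_supp])

lemma test_functions_mult:
  assumes "\<phi> \<in> test_functions U" "smooth f"
  shows "(\<lambda>z. f z * \<phi> z) \<in> test_functions U"
proof (rule test_functionsI[OF smooth_mult[OF assms(2) test_functionsD(1)[OF assms(1)]]
      test_functionsD(2,3)[OF assms(1)]])
  show "f z * \<phi> z = 0" if "z \<notin> supp \<phi>" for z
    using not_in_supp[OF that] by simp
qed

lemma test_functions_cmult:
  "\<phi> \<in> test_functions U \<Longrightarrow> (\<lambda>z. c * \<phi> z) \<in> test_functions U"
  using test_functions_mult[OF _ smooth_const] by blast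

lemma test_functions_uminus:
  "\<phi> \<in> test_functions U \<Longrightarrow> (\<lambda>z. - \<phi> z) \<in> test_functions U"
  using test_functions_cmult[of \<phi> U "-1"] by simp

lemma continuous_zero_outside_ball_bounded:
  fixes f :: "'b::euclidean_space \<Rightarrow> real"
  assumes "continuous_on UNIV f" "\<And>z. norm z > R \<Longrightarrow> f z = 0"
  shows "\<exists>B>0. \<forall>z. \<bar>f z\<bar> \<le> B"
proof -
  have "compact (f ` cball 0 R)"
    by (intro compact_continuous_image) (auto intro: continuous_on_subset[OF assms(1)])
  then obtain B where B: "B > 0" "\<forall>x\<in>f ` cball 0 R. norm x \<le> B"
    using compact_imp_bounded bounded_pos by blast
  have "\<bar>f z\<bar> \<le> B" for z
  proof (cases "norm z \<le> R")
    case True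
    then have "f z \<in> f ` cball 0 R" by simp
    with B(2) show ?thesis by (metis real_norm_def)
  next
    case False
    then have "f z = 0" by (intro assms(2)) simp
    with B(1) show ?thesis by simp
  qed
  with B(1) show ?thesis by blast
qed

lemma test_functions_ball:
  assumes "\<phi> \<in> test_functions U"
  shows "\<exists>R>0. \<forall>z. norm z > R \<longrightarrow> \<phi> z = 0 \<and> (\<forall>b. partial_deriv b \<phi> z = 0)"
proof -
  obtain R where R: "R > 0" "\<forall>x\<in>supp \<phi>. norm x \<le> R"
    using compact_imp_bounded[OF test_functionsD(2)[OF assms]] bounded_pos by blast
  have "\<phi> z = 0 \<and> (\<forall>b. partial_deriv b \<phi> z = 0)" if "norm z > R" for z
  proof -
    have "z \<notin> supp \<phi>" using that R(2) by fastforce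
    then show ?thesis using not_in_supp[of z \<phi>] partial_deriv_not_in_supp[of z \<phi>] by blast
  qed
  with R(1) show ?thesis by blast
qed

lemma test_functions_bounded:
  assumes "\<phi> \<in> test_functions U"
  shows "\<exists>B>0. \<forall>z. \<bar>\<phi> z\<bar> \<le> B"
proof -
  obtain R where R: "\<forall>z. norm z > R \<longrightarrow> \<phi> z = 0" using test_functions_ball[OF assms] by meson
  show ?thesis
    by (rule continuous_zero_outside_ball_bounded[OF smooth_continuous[OF test_functionsD(1)[OF assms]]
          R[rule_format]])
qed

lemma test_functions_UNIV_ballI:
  assumes "smooth \<phi>" "\<And>z. norm z > R \<Longrightarrow> \<phi> z = 0"
  shows "\<phi> \<in> test_functions UNIV"
  using assms by (intro test_functionsI[where K="cball 0 R"]) auto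

lemma test_functions_reflect:
  assumes "\<phi> \<in> test_functions UNIV"
  shows "(\<lambda>y. \<phi> (x - y)) \<in> test_functions UNIV"
proof -
  obtain R where R: "\<forall>z. norm z > R \<longrightarrow> \<phi> z = 0" using test_functions_ball[OF assms] by meson
  have "\<phi> (x - y) = 0" if "norm y > R + norm x" for y
  proof (rule R[rule_format])
    have "norm y \<le> norm x + norm (x - y)" by norm
    with that show "R < norm (x - y)" by linarith
  qed
  then show ?thesis
    by (rule test_functions_UNIV_ballI[OF smooth_reflect(1)[OF test_functionsD(1)[OF assms]]])
qed

lemma integrable_zero_outside_ball:
  fixes f :: "'b::euclidean_space \<Rightarrow> real"
  assumes "f \<in> borel_measurable borel" "\<And>z. norm z > R \<Longrightarrow> f z = 0" "\<And>z. \<bar>f z\<bar> \<le> B"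
  shows "integrable lborel f"
proof (rule integrableI_bounded_set[where A="cball 0 R" and B=B])
  show "emeasure lborel (cball 0 R) < \<infinity>" using emeasure_bounded_finite[OF bounded_cball] by simp
  show "AE x\<in>cball 0 R in lborel. norm (f x) \<le> B" using assms(3) by simp
  have "f x = 0" if "x \<notin> cball 0 R" for x using assms(2)[of x] that by simp
  then show "AE x in lborel. x \<notin> cball 0 R \<longrightarrow> f x = 0" by simp
qed (use assms(1) in simp_all)

lemma test_functions_integrable [simp, intro]:
  assumes "\<phi> \<in> test_functions U"
  shows "integrable lborel \<phi>"
proof -
  obtain R where R: "\<forall>z. norm z > R \<longrightarrow> \<phi> z = 0" using test_functions_ball[OF assms] by meson
  obtain B where B: "\<forall>z. \<bar>\<phi> z\<bar> \<le> B" using test_functions_bounded[OF assms] by meson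
  show ?thesis
    by (rule integrable_zero_outside_ball[OF smooth_borel[OF test_functionsD(1)[OF assms]] R[rule_format] B[rule_format]])
qed

text \<open>The standard bump exp(-1/(d^2 - |z|^2)) on the ball of radius \<open>d\<close>, extended
  by 0 and scaled to mass one. Each radius has its own normalising integral, which avoids rescaling
  a fixed profile by a change of variables.\<close>

definition mollifier :: "real \<Rightarrow> 'b::euclidean_space \<Rightarrow> real" where
  "mollifier d z = flat_exp 0 (d\<^sup>2 - z \<bullet> z) / (\<integral>y. flat_exp 0 (d\<^sup>2 - y \<bullet> y) \<partial>(lborel :: 'b measure))"

lemma mollifier_props:
  fixes z :: "'a::euclidean_space"
  assumes "d > 0"
  shows "smooth (mollifier d :: 'a \<Rightarrow> real)" "0 \<le> mollifier d z" "norm z \<ge> d \<Longrightarrow> mollifier d z = 0"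
    "mollifier d (- z) = mollifier d z" "(\<integral>z. mollifier d z \<partial>(lborel :: 'a measure)) = 1"
proof -
  let ?F = "\<lambda>z::'a. flat_exp 0 (d\<^sup>2 - z \<bullet> z)"
  have sF: "smooth ?F" by (intro smooth_flat_exp_comp smooth_diff smooth_norm_sq smooth_const)
  have z: "?F z = 0" if "norm z \<ge> d" for z
  proof -
    have "d\<^sup>2 \<le> (norm z)\<^sup>2" using that assms by (intro power_mono) auto
    then show ?thesis by (simp add: flat_exp_def power2_norm_eq_inner)
  qed
  have nn: "?F z \<ge> 0" for z by (simp add: flat_exp_def)
  have tF: "?F \<in> test_functions UNIV"
    by (rule test_functions_UNIV_ballI[OF sF, of d], rule z) simp
  \<comment> \<open>A zero integral would make the nonnegative \<open>?F\<close> vanish almost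
    everywhere, while it is positive on an open ball, which is not a null set.\<close>
  have c: "(\<integral>y. ?F y \<partial>lborel) > 0"
  proof (rule ccontr)
    assume "\<not> ?thesis"
    then have "(\<integral>y. ?F y \<partial>lborel) = 0" using Bochner_Integration.integral_nonneg[of lborel ?F, OF nn] by simp
    then have "AE y in lborel. ?F y = 0"
      using integral_nonneg_eq_0_iff_AE[OF test_functions_integrable[OF tF]] nn by auto
    moreover have "?F y \<noteq> 0" if "y \<in> ball 0 d" for y
    proof -
      have "(norm y)\<^sup>2 < d\<^sup>2" using that assms by (intro power_strict_mono) auto
      then show ?thesis by (simp add: flat_exp_def power2_norm_eq_inner)
    qed
    ultimately have "AE y in lborel. y \<notin> ball (0::'a) d" by (auto elim!: eventually_mono)
    then have "emeasure lborel (ball (0::'a) d) = 0"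
      by (subst (asm) AE_iff_measurable[OF _ refl]) (auto simp: ball_def)
    then have "ball (0::'a) d \<in> null_sets lborel" by (auto intro: null_setsI)
    then have "negligible (ball (0::'a) d)"
      by (simp add: negligible_iff_null_sets null_sets_completionI)
    then show False using open_not_negligible[OF open_ball, of "0::'a" d] assms by simp
  qed
  have e: "mollifier d = (\<lambda>z::'a. (1 / (\<integral>y. ?F y \<partial>lborel)) * ?F z)" by (simp add: mollifier_def fun_eq_iff)
  show "smooth (mollifier d :: 'a \<Rightarrow> real)" unfolding e by (rule smooth_cmult[OF sF])
  show "0 \<le> mollifier d z" using nn c by (simp add: mollifier_def)
  show "norm z \<ge> d \<Longrightarrow> mollifier d z = 0" using z by (simp add: mollifier_def)
  show "mollifier d (- z) = mollifier d z" by (simp add: mollifier_def)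
  show "(\<integral>z. mollifier d z \<partial>(lborel :: 'a measure)) = 1" unfolding e using c by simp
qed

lemma mollifier_test: "d > 0 \<Longrightarrow> mollifier d \<in> test_functions UNIV"
  by (rule test_functions_UNIV_ballI[OF mollifier_props(1), of d d]) (simp_all add: mollifier_props(3))

section \<open>Convolution with a test function\<close>

lemma lborel_distr_reflect: "distr lborel borel (\<lambda>y::'b::euclidean_space. x - y) = lborel"
  using lborel_affine[of "-1" x] by (simp add: density_1)

lemma integral_reflect:
  fixes f :: "'b::euclidean_space \<Rightarrow> real"
  assumes [measurable]: "f \<in> borel_measurable borel"
  shows "(\<integral>y. f (x - y) \<partial>lborel) = (\<integral>y. f y \<partial>lborel)"
  by (subst (2) lborel_distr_reflect[of x, symmetric]) (simp add: integral_distr)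

lemma integral_translate:
  fixes f :: "'b::euclidean_space \<Rightarrow> real"
  assumes [measurable]: "f \<in> borel_measurable borel"
  shows "(\<integral>y. f (x + y) \<partial>lborel) = (\<integral>y. f y \<partial>lborel)"
  by (subst (2) lborel_distr_plus[of x, symmetric]) (simp add: integral_distr)

lemma integrable_translate:
  fixes f :: "'b::euclidean_space \<Rightarrow> real"
  assumes "integrable lborel f"
  shows "integrable lborel (\<lambda>y. f (x + y))"
proof -
  have "integrable (distr lborel borel ((+) x)) f" using assms by (simp add: lborel_distr_plus)
  then show ?thesis
    using borel_measurable_integrable[OF assms] by (subst (asm) integrable_distr_eq) auto
qed

lemma integrable_bounded_mult:
  fixes f g :: "'a \<Rightarrow> real"
  assumes "integrable M f" "g \<in> borel_measurable M" "\<And>z. \<bar>g z\<bar> \<le> B"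
  shows "integrable M (\<lambda>z. g z * f z)"
proof (rule Bochner_Integration.integrable_bound)
  show "integrable M (\<lambda>z. B * \<bar>f z\<bar>)" using assms(1) by simp
  show "(\<lambda>z. g z * f z) \<in> borel_measurable M" using assms(1,2) by measurable
  have "norm (g z * f z) \<le> norm (B * \<bar>f z\<bar>)" for z
    using order_trans[OF mult_right_mono[OF assms(3)[of z] abs_ge_zero[of "f z"]], of "\<bar>B\<bar> * \<bar>f z\<bar>"]
    by (simp add: abs_mult mult_right_mono)
  then show "AE z in M. norm (g z * f z) \<le> norm (B * \<bar>f z\<bar>)" by simp
qed

lemma frechet_derivative_eq_sum:
  assumes "f differentiable (at z)"
  shows "frechet_derivative f (at z) h = (\<Sum>b\<in>Basis. (h \<bullet> b) * partial_deriv b f z)"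
proof -
  interpret linear "frechet_derivative f (at z)" by (rule linear_frechet_derivative[OF assms])
  have "frechet_derivative f (at z) h = frechet_derivative f (at z) (\<Sum>b\<in>Basis. (h \<bullet> b) *\<^sub>R b)"
    by (simp add: euclidean_representation)
  also have "\<dots> = (\<Sum>b\<in>Basis. (h \<bullet> b) * partial_deriv b f z)"
    by (simp add: sum scale partial_deriv_def)
  finally show ?thesis .
qed

lemma differentiable_real_derivative_along:
  assumes "f differentiable (at (z + t *\<^sub>R b))"
  shows "((\<lambda>t. f (z + t *\<^sub>R b)) has_real_derivative partial_deriv b f (z + t *\<^sub>R b)) (at t)"
proof -
  have "((\<lambda>t. f (z + t *\<^sub>R b)) has_derivative
      (\<lambda>h. frechet_derivative f (at (z + t *\<^sub>R b)) (h *\<^sub>R b))) (at t)"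
    by (rule has_derivative_compose[where f="\<lambda>t. z + t *\<^sub>R b", OF _ has_derivative_partial[OF assms]])
       (auto intro!: derivative_eq_intros)
  then show ?thesis
    by (simp add: has_field_derivative_def partial_deriv_scaled_direction[OF assms] mult.commute[of _ "partial_deriv _ _ _"])
qed

lemma integral_partial_deriv_eq_0:
  fixes f :: "'b::euclidean_space \<Rightarrow> real"
  assumes diff: "\<And>z. f differentiable (at z)" and cont: "continuous_on UNIV (partial_deriv b f)"
    and out: "\<And>z. norm z > R \<Longrightarrow> f z = 0"
  shows "integrable lborel (partial_deriv b f)" "(\<integral>z. partial_deriv b f z \<partial>lborel) = 0"
proof -
  have cf: "continuous_on UNIV f"
    by (rule differentiable_imp_continuous_on) (simp add: differentiable_on_def diff)
  have [measurable]: "f \<in> borel_measurable borel" "partial_deriv b f \<in> borel_measurable borel"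
    using cf cont borel_measurable_continuous_onI by blast+
  have out': "partial_deriv b f z = 0" if "norm z > R" for z
  proof -
    have "open {z. norm z > R}" by (intro open_Collect_less continuous_intros)
    then have "partial_deriv b f z = partial_deriv b (\<lambda>z. 0) z"
      using that out by (intro partial_deriv_cong_open) auto
    then show ?thesis by simp
  qed
  obtain B where B: "B > 0" "\<forall>z. \<bar>partial_deriv b f z\<bar> \<le> B"
    using continuous_zero_outside_ball_bounded[OF cont out'] by meson
  obtain B0 where B0: "\<forall>z. \<bar>f z\<bar> \<le> B0"
    using continuous_zero_outside_ball_bounded[OF cf out] by meson
  show int: "integrable lborel (partial_deriv b f)"
    by (rule integrable_zero_outside_ball[where R=R and B=B]) (use B out' in auto)
  have intf: "integrable lborel f"
    by (rule integrable_zero_outside_ball[where R=R and B=B0, OF _ out B0[rule_format]]) simp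
  define X where "X = (\<lambda>n. inverse (real (Suc n)))"
  have X: "X n > 0" "X n \<le> 1" for n by (auto simp: X_def inverse_le_1_iff)
  define s where "s = (\<lambda>n z. (f (X n *\<^sub>R b + z) - f z) / X n)"
  have "(\<lambda>n. \<integral>z. s n z \<partial>lborel) \<longlonglongrightarrow> (\<integral>z. partial_deriv b f z \<partial>lborel)"
  \<comment> \<open>The steps \<open>X n\<close> are at most 1, so every difference quotient
    vanishes outside the ball of radius \<open>R + norm b\<close>.\<close>
  proof (rule integral_dominated_convergence[where w="\<lambda>z. B * indicator (cball 0 (R + norm b)) z"])
    show "integrable lborel (\<lambda>z. B * indicator (cball 0 (R + norm b)) z)"
      using emeasure_lborel_cball_finite[of 0 "R + norm b"] by (intro integrable_mult_right integrable_real_indicator) auto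
    show "s n \<in> borel_measurable lborel" for n unfolding s_def by measurable
    have "(\<lambda>n. s n z) \<longlonglongrightarrow> partial_deriv b f z" for z
    proof -
      have "((\<lambda>t. f (z + t *\<^sub>R b)) has_real_derivative partial_deriv b f z) (at 0)"
        using differentiable_real_derivative_along[where z=z and t=0 and b=b, OF diff] by simp
      then have "((\<lambda>h. (f (z + h *\<^sub>R b) - f z) / h) \<longlongrightarrow> partial_deriv b f z) (at 0)"
        by (simp add: DERIV_def)
      moreover have "filterlim X (at 0) sequentially"
        unfolding filterlim_at using X(1) LIMSEQ_inverse_real_of_nat
        by (auto simp: X_def simp del: of_nat_Suc)
      ultimately have "(\<lambda>n. (f (z + X n *\<^sub>R b) - f z) / X n) \<longlonglongrightarrow> partial_deriv b f z"
        by (rule filterlim_compose)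
      then show ?thesis by (simp add: s_def add.commute)
    qed
    then show "AE z in lborel. (\<lambda>n. s n z) \<longlonglongrightarrow> partial_deriv b f z" by simp
    have "norm (s n z) \<le> B * indicator (cball 0 (R + norm b)) z" for n z
    proof (cases "norm z \<le> R + norm b")
      case True
      obtain t where "f (z + X n *\<^sub>R b) - f (z + 0 *\<^sub>R b) = (X n - 0) * partial_deriv b f (z + t *\<^sub>R b)"
        using MVT2[of 0 "X n" "\<lambda>t. f (z + t *\<^sub>R b)" "\<lambda>t. partial_deriv b f (z + t *\<^sub>R b)"]
          differentiable_real_derivative_along[OF diff] X(1) by blast
      then have "s n z = partial_deriv b f (z + t *\<^sub>R b)"
        using X(1)[of n] by (simp add: s_def add.commute)
      then show ?thesis using B(2) True by (simp add: indicator_def)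
    next
      case False
      have "norm z \<le> norm (X n *\<^sub>R b + z) + norm (X n *\<^sub>R b)"
        using norm_triangle_ineq4[of "X n *\<^sub>R b + z" "X n *\<^sub>R b"] by simp
      also have "norm (X n *\<^sub>R b) \<le> norm b" using X[of n] by (simp add: mult_left_le_one_le)
      finally have "norm (X n *\<^sub>R b + z) > R" using False by simp
      moreover have "norm z > R" using False norm_ge_zero[of b] by linarith
      ultimately have "s n z = 0" using out by (simp add: s_def)
      then show ?thesis using False by simp
    qed
    then show "AE z in lborel. norm (s n z) \<le> B * indicator (cball 0 (R + norm b)) z" for n by simp
  qed simp
  moreover have "(\<integral>z. s n z \<partial>lborel) = 0" for n
    using integrable_translate[OF intf, of "X n *\<^sub>R b"] intf
    by (simp add: s_def integral_translate)
  ultimately show "(\<integral>z. partial_deriv b f z \<partial>lborel) = 0"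
    by (simp add: LIMSEQ_const_iff)
qed

text \<open>The product \<open>f * \<phi>\<close> is again a test function, so its partial
  derivative integrates to 0.\<close>

lemma integral_by_parts:
  assumes "smooth f" "\<phi> \<in> test_functions U" "b \<in> Basis"
  shows "(\<integral>z. f z * partial_deriv b \<phi> z \<partial>lborel) = - (\<integral>z. partial_deriv b f z * \<phi> z \<partial>lborel)"
proof -
  note s\<phi> = test_functionsD(1)[OF assms(2)]
  have t: "(\<lambda>z. f z * \<phi> z) \<in> test_functions U" by (rule test_functions_mult[OF assms(2,1)])
  obtain R where R: "\<forall>z. norm z > R \<longrightarrow> f z * \<phi> z = 0" using test_functions_ball[OF t] by meson
  have eq: "partial_deriv b (\<lambda>z. f z * \<phi> z) = (\<lambda>z. partial_deriv b f z * \<phi> z + f z * partial_deriv b \<phi> z)"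
    by (intro ext partial_deriv_mult smooth_differentiable assms(1) s\<phi>)
  have "integrable lborel (\<lambda>z. partial_deriv b f z * \<phi> z)" "integrable lborel (\<lambda>z. f z * partial_deriv b \<phi> z)"
    by (rule test_functions_integrable[OF test_functions_mult] assms smooth_partial test_functions_partial)+
  moreover have "(\<integral>z. partial_deriv b (\<lambda>z. f z * \<phi> z) z \<partial>lborel) = 0"
    by (rule integral_partial_deriv_eq_0(2)[where R=R])
      (use R smooth_differentiable[OF test_functionsD(1)[OF t]]
        smooth_continuous[OF smooth_partial[OF test_functionsD(1)[OF t] assms(3)]] in auto)
  ultimately show ?thesis unfolding eq by simp
qed

text \<open>One constant for increments and for linear parts: both enter the remainder of a first
  order expansion, which is thereby bounded by \<open>2 * L * norm (x - y)\<close>.\<close>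

lemma test_functions_lipschitz:
  assumes "\<phi> \<in> test_functions U"
  shows "\<exists>L>0. \<forall>x y. \<bar>\<phi> x - \<phi> y\<bar> \<le> L * norm (x - y) \<and>
    \<bar>\<Sum>b\<in>Basis. ((x - y) \<bullet> b) * partial_deriv b \<phi> x\<bar> \<le> L * norm (x - y)"
proof -
  note s = test_functionsD(1)[OF assms]
  have "\<forall>b\<in>Basis. \<exists>B>0. \<forall>z. \<bar>partial_deriv b \<phi> z\<bar> \<le> B"
    using test_functions_bounded[OF test_functions_partial[OF assms]] by blast
  then obtain B where B: "\<forall>b\<in>Basis. B b > 0 \<and> (\<forall>z. \<bar>partial_deriv b \<phi> z\<bar> \<le> B b)" by metis
  define L where "L = (\<Sum>b\<in>Basis. B b)"
  have L: "L > 0" unfolding L_def using B by (intro sum_pos) auto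
  have bd: "\<bar>\<Sum>b\<in>Basis. (h \<bullet> b) * partial_deriv b \<phi> z\<bar> \<le> L * norm h" for h z
  proof -
    have "\<bar>\<Sum>b\<in>Basis. (h \<bullet> b) * partial_deriv b \<phi> z\<bar> \<le> (\<Sum>b\<in>Basis. \<bar>(h \<bullet> b) * partial_deriv b \<phi> z\<bar>)"
      by (rule sum_abs)
    also have "\<dots> \<le> (\<Sum>b\<in>Basis. norm h * B b)"
      unfolding abs_mult using B by (intro sum_mono mult_mono) (auto intro: Basis_le_norm)
    finally show ?thesis by (simp add: L_def sum_distrib_left mult.commute)
  qed
  have "norm (\<phi> x - \<phi> y) \<le> L * norm (x - y)" for x y
  proof (rule differentiable_bound[where S=UNIV and f'="\<lambda>z. frechet_derivative \<phi> (at z)"])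
    show "(\<phi> has_derivative frechet_derivative \<phi> (at z)) (at z within UNIV)" for z
      using smooth_has_derivative[OF s] by simp
    show "onorm (frechet_derivative \<phi> (at z)) \<le> L" for z
      by (rule onorm_bound) (use bd L in \<open>auto simp: frechet_derivative_eq_sum[OF smooth_differentiable[OF s]]\<close>)
  qed auto
  with bd L show ?thesis by (intro exI[of _ L]) auto
qed

section \<open>Differentiation of convolutions\<close>

definition conv :: "('b::euclidean_space \<Rightarrow> real) \<Rightarrow> ('b \<Rightarrow> real) \<Rightarrow> 'b \<Rightarrow> real" where
  "conv \<rho> f x = (\<integral>y. \<rho> (x - y) * f y \<partial>lborel)"

lemma conv_integrable:
  assumes "\<rho> \<in> test_functions UNIV" "integrable lborel f"
  shows "integrable lborel (\<lambda>y. \<rho> (x - y) * f y)"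
proof -
  obtain B where "\<forall>z. \<bar>\<rho> z\<bar> \<le> B" using test_functions_bounded[OF assms(1)] by meson
  moreover have "(\<lambda>y. \<rho> (x - y)) \<in> borel_measurable lborel"
    using smooth_borel[OF smooth_reflect(1)[OF test_functionsD(1)[OF assms(1)]]] by simp
  ultimately show ?thesis using assms(2) by (intro integrable_bounded_mult) auto
qed

text \<open>Differentiation under the integral. Along any sequence \<open>X\<close> tending to
  \<open>x\<close>, the remainder quotient of the kernel tends to 0 pointwise and is bounded by
  twice its Lipschitz constant, so \<open>2 * L * \<bar>f y\<bar>\<close> is an integrable
  majorant.\<close>

lemma conv_has_derivative:
  assumes \<rho>: "\<rho> \<in> test_functions UNIV" and f: "integrable lborel f"
  shows "(conv \<rho> f has_derivative (\<lambda>h. \<Sum>b\<in>Basis. (h \<bullet> b) * conv (partial_deriv b \<rho>) f x)) (at x)"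
  unfolding has_derivative_iff_norm
proof (intro conjI)
  let ?D = "\<lambda>h. \<Sum>b\<in>Basis. (h \<bullet> b) * conv (partial_deriv b \<rho>) f x"
  show "bounded_linear ?D"
    by (intro bounded_linear_sum bounded_linear_mult_left bounded_linear_compose[OF bounded_linear_mult_left]
        bounded_linear_inner_left)
  note s = test_functionsD(1)[OF \<rho>]
  note [measurable] = smooth_borel[OF s] borel_measurable_integrable[OF f, unfolded measurable_lborel1]
  have pm[measurable]: "partial_deriv b \<rho> \<in> borel_measurable borel" if "b \<in> Basis" for b
    by (rule smooth_borel[OF smooth_partial[OF s that]])
  obtain L where L: "L > 0" "\<forall>x y. \<bar>\<rho> x - \<rho> y\<bar> \<le> L * norm (x - y) \<and>
    \<bar>\<Sum>b\<in>Basis. ((x - y) \<bullet> b) * partial_deriv b \<rho> x\<bar> \<le> L * norm (x - y)"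
    using test_functions_lipschitz[OF \<rho>] by meson
  show "((\<lambda>y. norm (conv \<rho> f y - conv \<rho> f x - ?D (y - x)) / norm (y - x)) \<longlongrightarrow> 0) (at x)"
    unfolding tendsto_at_iff_sequentially comp_def
  proof (intro allI impI)
    fix X assume X: "\<forall>i. X i \<in> UNIV - {x}" "X \<longlonglongrightarrow> x"
    have Xn: "norm (X i - x) > 0" for i using X(1) by auto
    define F where "F = (\<lambda>i y. (\<rho> (X i - y) - \<rho> (x - y)
        - (\<Sum>b\<in>Basis. ((X i - x) \<bullet> b) * partial_deriv b \<rho> (x - y))) / norm (X i - x) * f y)"
    have F_int: "(\<integral>y. F i y \<partial>lborel) = (conv \<rho> f (X i) - conv \<rho> f x - ?D (X i - x)) / norm (X i - x)" for i
    proof -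
      have "F i = (\<lambda>y. (\<rho> (X i - y) * f y - \<rho> (x - y) * f y
        - (\<Sum>b\<in>Basis. ((X i - x) \<bullet> b) * (partial_deriv b \<rho> (x - y) * f y))) / norm (X i - x))"
        by (simp add: F_def fun_eq_iff algebra_simps sum_distrib_left sum_distrib_right)
      moreover have "integrable lborel (\<lambda>y. partial_deriv b \<rho> (x - y) * f y)" if "b \<in> Basis" for b
        by (rule conv_integrable[OF test_functions_partial[OF \<rho> that] f])
      ultimately show ?thesis
        using conv_integrable[OF \<rho> f] by (simp add: conv_def integral_sum)
    qed
    have "(\<lambda>i. \<integral>y. F i y \<partial>lborel) \<longlonglongrightarrow> (\<integral>y. 0 \<partial>(lborel :: 'a measure))"
    proof (rule integral_dominated_convergence[where w="\<lambda>y. (2 * L) * \<bar>f y\<bar>"])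
      show "F i \<in> borel_measurable lborel" for i unfolding F_def by measurable
      show "integrable lborel (\<lambda>y. (2 * L) * \<bar>f y\<bar>)" using f by simp
      have "(\<lambda>i. F i y) \<longlonglongrightarrow> 0" for y
      proof -
        have hd: "((\<lambda>z. norm (\<rho> z - \<rho> (x - y) - frechet_derivative \<rho> (at (x - y)) (z - (x - y))) / norm (z - (x - y))) \<longlongrightarrow> 0) (at (x - y))"
          using smooth_has_derivative[OF s, of "x - y"] unfolding has_derivative_iff_norm by blast
        have "filterlim (\<lambda>i. X i - y) (at (x - y)) sequentially"
          unfolding filterlim_at using X by (auto intro!: tendsto_intros)
        from filterlim_compose[OF hd this]
        have "(\<lambda>i. norm (\<rho> (X i - y) - \<rho> (x - y) - (\<Sum>b\<in>Basis. ((X i - x) \<bullet> b) * partial_deriv b \<rho> (x - y))) / norm (X i - x)) \<longlonglongrightarrow> 0"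
          by (simp add: frechet_derivative_eq_sum[OF smooth_differentiable[OF s]])
        then have "(\<lambda>i. \<bar>f y\<bar> * (norm (\<rho> (X i - y) - \<rho> (x - y) - (\<Sum>b\<in>Basis. ((X i - x) \<bullet> b) * partial_deriv b \<rho> (x - y))) / norm (X i - x))) \<longlonglongrightarrow> \<bar>f y\<bar> * 0"
          by (intro tendsto_mult tendsto_const)
        then have "(\<lambda>i. norm (F i y)) \<longlonglongrightarrow> 0"
          by (simp add: F_def abs_mult mult.commute)
        then show ?thesis by (rule tendsto_norm_zero_cancel)
      qed
      then show "AE y in lborel. (\<lambda>i. F i y) \<longlonglongrightarrow> 0" by simp
      have "norm (F i y) \<le> (2 * L) * \<bar>f y\<bar>" for i y
      proof -
        have "\<bar>\<rho> (X i - y) - \<rho> (x - y)\<bar> \<le> L * norm (X i - x)"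
          using L(2)[rule_format, of "X i - y" "x - y"] by simp
        moreover have "\<bar>\<Sum>b\<in>Basis. ((X i - x) \<bullet> b) * partial_deriv b \<rho> (x - y)\<bar> \<le> L * norm (X i - x)"
          using L(2)[rule_format, of "x - y" "x - y - (X i - x)"] by simp
        ultimately have "\<bar>\<rho> (X i - y) - \<rho> (x - y) - (\<Sum>b\<in>Basis. ((X i - x) \<bullet> b) * partial_deriv b \<rho> (x - y))\<bar>
            \<le> (2 * L) * norm (X i - x)" by linarith
        then have "\<bar>\<rho> (X i - y) - \<rho> (x - y) - (\<Sum>b\<in>Basis. ((X i - x) \<bullet> b) * partial_deriv b \<rho> (x - y))\<bar>
            / norm (X i - x) \<le> 2 * L" using Xn[of i] by (simp add: pos_divide_le_eq)
        from mult_right_mono[OF this abs_ge_zero[of "f y"]] show ?thesis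
          unfolding F_def by (simp add: abs_mult)
      qed
      then show "AE y in lborel. norm (F i y) \<le> (2 * L) * \<bar>f y\<bar>" for i by simp
    qed simp
    then have "(\<lambda>i. norm ((conv \<rho> f (X i) - conv \<rho> f x - ?D (X i - x)) / norm (X i - x))) \<longlonglongrightarrow> 0"
      unfolding F_int by (intro tendsto_norm_zero) simp
    then show "(\<lambda>i. norm (conv \<rho> f (X i) - conv \<rho> f x - ?D (X i - x)) / norm (X i - x)) \<longlonglongrightarrow> 0"
      by simp
  qed
qed

lemma partial_deriv_conv:
  assumes "\<rho> \<in> test_functions UNIV" "integrable lborel f" "b \<in> Basis"
  shows "partial_deriv b (conv \<rho> f) = conv (partial_deriv b \<rho>) f"
proof
  fix x
  have "partial_deriv b (conv \<rho> f) x = (\<Sum>b'\<in>Basis. (b \<bullet> b') * conv (partial_deriv b' \<rho>) f x)"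
    by (rule partial_deriv_eq[OF conv_has_derivative[OF assms(1,2)]])
  also have "\<dots> = (\<Sum>b'\<in>Basis. if b' = b then conv (partial_deriv b' \<rho>) f x else 0)"
    by (intro sum.cong refl) (use assms(3) in \<open>auto simp: inner_Basis\<close>)
  also have "\<dots> = conv (partial_deriv b \<rho>) f x" using assms(3) by simp
  finally show "partial_deriv b (conv \<rho> f) x = conv (partial_deriv b \<rho>) f x" .
qed

lemma smooth_conv:
  assumes "\<rho> \<in> test_functions UNIV" "integrable lborel f"
  shows "smooth (conv \<rho> f)"
proof (rule smooth_coinduct[where P="\<lambda>g. \<exists>\<rho>\<in>test_functions UNIV. g = conv \<rho> f"])
  show "\<exists>\<rho>'\<in>test_functions UNIV. conv \<rho> f = conv \<rho>' f" using assms(1) by blast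
  fix g assume "\<exists>\<rho>\<in>test_functions UNIV. g = conv \<rho> f"
  then obtain \<rho> where r: "\<rho> \<in> test_functions UNIV" "g = conv \<rho> f" by blast
  have "\<exists>\<rho>\<in>test_functions UNIV. partial_deriv b g = conv \<rho> f" if "b \<in> Basis" for b
    using partial_deriv_conv[OF r(1) assms(2) that] r test_functions_partial[OF r(1) that] by blast
  moreover have "g differentiable (at z)" for z
    using conv_has_derivative[OF r(1) assms(2)] r(2) differentiable_def by blast
  ultimately show "(\<forall>z. g differentiable (at z)) \<and> (\<forall>b\<in>Basis. \<exists>\<rho>\<in>test_functions UNIV. partial_deriv b g = conv \<rho> f)"
    by blast
qed

lemma conv_eq_0:
  assumes "\<And>z. norm z > d \<Longrightarrow> \<rho> z = 0" "\<And>y. f y \<noteq> 0 \<Longrightarrow> d < norm (x - y)"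
  shows "conv \<rho> f x = 0"
proof -
  have "\<rho> (x - y) * f y = 0" for y
  proof (cases "f y = 0")
    case False
    then have "\<rho> (x - y) = 0" by (intro assms)
    then show ?thesis by simp
  qed simp
  then have "(\<lambda>y. \<rho> (x - y) * f y) = (\<lambda>y. 0)" by (rule ext)
  then show ?thesis by (simp add: conv_def)
qed

lemma conv_outside_ball:
  assumes "\<And>z. norm z > d \<Longrightarrow> \<rho> z = 0" "\<And>y. norm y > R \<Longrightarrow> f y = 0" "norm x > R + d"
  shows "conv \<rho> f x = 0"
proof (rule conv_eq_0[OF assms(1)])
  fix y assume "f y \<noteq> 0"
  then have "norm y \<le> R" using assms(2)[of y] by linarith
  moreover have "norm x \<le> norm y + norm (x - y)" by norm
  ultimately show "d < norm (x - y)" using assms(3) by linarith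
qed

lemma conv_test:
  assumes "\<rho> \<in> test_functions UNIV" "integrable lborel f" "\<And>y. norm y > R \<Longrightarrow> f y = 0"
  shows "conv \<rho> f \<in> test_functions UNIV"
proof -
  obtain d where d: "\<forall>z. norm z > d \<longrightarrow> \<rho> z = 0" using test_functions_ball[OF assms(1)] by meson
  show ?thesis
    by (rule test_functions_UNIV_ballI[OF smooth_conv[OF assms(1,2)] conv_outside_ball[OF d[rule_format] assms(3)]])
qed

text \<open>The weak derivative is tested with \<open>\<lambda>y. \<rho> (x - y)\<close>; the minus
  sign of the reflection cancels the one of the integration by parts. Combined with
  \<open>partial_deriv_conv\<close>, differentiating a mollified function amounts to mollifying its
  weak derivative.\<close>

lemma conv_weak_deriv:
  assumes \<rho>: "\<rho> \<in> test_functions UNIV" and b: "b \<in> Basis"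
    and w: "\<And>\<phi>. \<phi> \<in> test_functions UNIV \<Longrightarrow>
      (\<integral>z. f z * partial_deriv b \<phi> z \<partial>lborel) = - (\<integral>z. g z * \<phi> z \<partial>lborel)"
  shows "conv (partial_deriv b \<rho>) f = conv \<rho> g"
proof
  fix x
  have "partial_deriv b (\<lambda>y. \<rho> (x - y)) y = - partial_deriv b \<rho> (x - y)" for y
    by (rule partial_deriv_reflect[OF test_functionsD(1)[OF \<rho>]])
  then have "(\<integral>z. f z * - partial_deriv b \<rho> (x - z) \<partial>lborel) = - (\<integral>z. g z * \<rho> (x - z) \<partial>lborel)"
    using w[OF test_functions_reflect[OF \<rho>, of x]] by simp
  then show "conv (partial_deriv b \<rho>) f x = conv \<rho> g x"
    by (simp add: conv_def mult.commute)
qed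

section \<open>Mollification in L2\<close>

text \<open>The space L2 over \<open>lborel\<close> with Borel measurable members, for which
  products and Fubini's theorem cause no trouble. Lebesgue measurable data enter through
  \<open>borel_version\<close> below.\<close>

definition sq_integrable :: "('b::euclidean_space \<Rightarrow> real) \<Rightarrow> bool" where
  "sq_integrable f \<longleftrightarrow> f \<in> borel_measurable borel \<and> integrable lborel (\<lambda>x. (f x)\<^sup>2)"

lemma sq_integrableD:
  assumes "sq_integrable f"
  shows "f \<in> borel_measurable borel" "integrable lborel (\<lambda>x. (f x)\<^sup>2)"
  using assms by (auto simp: sq_integrable_def)

lemma sq_integrable_mult:
  assumes f: "sq_integrable f" and g: "sq_integrable g"
  shows "integrable lborel (\<lambda>x. f x * g x)"
proof (rule Bochner_Integration.integrable_bound)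
  note [measurable] = sq_integrableD(1)[OF f] sq_integrableD(1)[OF g]
  show "integrable lborel (\<lambda>x. (f x)\<^sup>2 + (g x)\<^sup>2)"
    using sq_integrableD(2)[OF f] sq_integrableD(2)[OF g] by simp
  show "(\<lambda>x. f x * g x) \<in> borel_measurable lborel" by measurable
  have "\<bar>f x * g x\<bar> \<le> (f x)\<^sup>2 + (g x)\<^sup>2" for x
  proof -
    have "2 * (\<bar>f x\<bar> * \<bar>g x\<bar>) \<le> (f x)\<^sup>2 + (g x)\<^sup>2"
      using sum_squares_bound[of "\<bar>f x\<bar>" "\<bar>g x\<bar>"] by simp
    moreover have "0 \<le> \<bar>f x\<bar> * \<bar>g x\<bar>" by simp
    ultimately show ?thesis unfolding abs_mult by linarith
  qed
  then show "AE x in lborel. norm (f x * g x) \<le> norm ((f x)\<^sup>2 + (g x)\<^sup>2)" by simp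
qed

lemma sq_integrable_cmult:
  assumes "sq_integrable f"
  shows "sq_integrable (\<lambda>x. c * f x)"
proof -
  note [measurable] = sq_integrableD(1)[OF assms]
  have "integrable lborel (\<lambda>x. c\<^sup>2 * (f x)\<^sup>2)"
    by (rule integrable_mult_right[OF sq_integrableD(2)[OF assms]])
  moreover have "(\<lambda>x. c * f x) \<in> borel_measurable borel" by measurable
  ultimately show ?thesis unfolding sq_integrable_def power_mult_distrib by blast
qed

lemma sq_integrable_uminus: "sq_integrable f \<Longrightarrow> sq_integrable (\<lambda>x. - f x)"
  using sq_integrable_cmult[of f "-1"] by simp

lemma sq_integrable_add:
  assumes f: "sq_integrable f" and g: "sq_integrable g"
  shows "sq_integrable (\<lambda>x. f x + g x)"
  using sq_integrable_mult[OF f g] f g by (auto simp: sq_integrable_def power2_sum mult.assoc)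

lemma sq_integrable_diff:
  assumes f: "sq_integrable f" and g: "sq_integrable g"
  shows "sq_integrable (\<lambda>x. f x - g x)"
  using sq_integrable_add[OF f sq_integrable_uminus[OF g]] by simp

lemma sq_integrable_sum:
  "finite A \<Longrightarrow> (\<And>i. i \<in> A \<Longrightarrow> sq_integrable (f i)) \<Longrightarrow> sq_integrable (\<lambda>x. \<Sum>i\<in>A. f i x)"
proof (induction A rule: finite_induct)
  case empty
  show ?case by (simp add: sq_integrable_def)
next
  case (insert i A)
  then show ?case by (simp add: sq_integrable_add)
qed

lemma sq_integrable_bounded_mult:
  assumes f: "sq_integrable f" and [measurable]: "g \<in> borel_measurable borel" and g: "\<And>x. \<bar>g x\<bar> \<le> B"
  shows "sq_integrable (\<lambda>x. g x * f x)"
proof -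
  note [measurable] = sq_integrableD(1)[OF f]
  have "\<bar>(g x)\<^sup>2\<bar> \<le> B\<^sup>2" for x using g[of x] by (simp add: power2_le_iff_abs_le abs_le_square_iff power_mono flip: abs_le_square_iff)
  then have "integrable lborel (\<lambda>x. (g x)\<^sup>2 * (f x)\<^sup>2)"
    by (intro integrable_bounded_mult[OF sq_integrableD(2)[OF f]]) auto
  then show ?thesis by (simp add: sq_integrable_def power_mult_distrib)
qed

lemma sq_integrable_ball:
  assumes [measurable]: "f \<in> borel_measurable borel" and "\<And>z. norm z > R \<Longrightarrow> f z = 0" "\<And>z. \<bar>f z\<bar> \<le> B"
  shows "sq_integrable f"
proof -
  have "integrable lborel (\<lambda>x. f x * f x)"
    by (rule integrable_bounded_mult[OF integrable_zero_outside_ball[OF assms]]) (use assms in auto)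
  then show ?thesis by (simp add: sq_integrable_def power2_eq_square)
qed

lemma sq_integrable_indicator:
  assumes "A \<in> sets borel" "A \<subseteq> cball 0 R"
  shows "sq_integrable (indicator A)"
  by (rule sq_integrable_ball[where R=R and B=1]) (use assms in \<open>auto simp: indicator_def\<close>)

lemma test_functions_sq_integrable:
  assumes "\<phi> \<in> test_functions U"
  shows "sq_integrable \<phi>"
  using test_functions_integrable[OF test_functions_mult[OF assms test_functionsD(1)[OF assms]]]
    smooth_borel[OF test_functionsD(1)[OF assms]]
  by (simp add: sq_integrable_def power2_eq_square)

lemma sq_integrable_imp_integrable:
  assumes f: "sq_integrable f" and "\<And>z. norm z > R \<Longrightarrow> f z = 0"
  shows "integrable lborel f"
proof -
  have "integrable lborel (\<lambda>x. f x * indicator (cball 0 R) x)"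
    by (rule sq_integrable_mult[OF f sq_integrable_indicator[where R=R]]) auto
  moreover have "f x * indicator (cball 0 R) x = f x" for x
    using assms(2)[of x] by (cases "norm x \<le> R") auto
  ultimately show ?thesis by simp
qed

lemma Cauchy_Schwarz_integral:
  assumes f: "sq_integrable f" and g: "sq_integrable g"
  shows "(\<integral>x. f x * g x \<partial>lborel)\<^sup>2 \<le> (\<integral>x. (f x)\<^sup>2 \<partial>lborel) * (\<integral>x. (g x)\<^sup>2 \<partial>lborel)"
proof -
  define A B C where "A = (\<integral>x. (f x)\<^sup>2 \<partial>lborel)" and "B = (\<integral>x. (g x)\<^sup>2 \<partial>lborel)"
    and "C = (\<integral>x. f x * g x \<partial>lborel)"
  have q: "0 \<le> s\<^sup>2 * A + 2 * s * C + B" for s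
  proof -
    have "0 \<le> (\<integral>x. (s * f x + g x)\<^sup>2 \<partial>lborel)" by simp
    also have "(\<lambda>x. (s * f x + g x)\<^sup>2) = (\<lambda>x. s\<^sup>2 * (f x)\<^sup>2 + (2 * s) * (f x * g x) + (g x)\<^sup>2)"
      by (simp add: fun_eq_iff power2_eq_square algebra_simps)
    also have "(\<integral>x. s\<^sup>2 * (f x)\<^sup>2 + (2 * s) * (f x * g x) + (g x)\<^sup>2 \<partial>lborel) = s\<^sup>2 * A + 2 * s * C + B"
      using sq_integrableD(2)[OF f] sq_integrableD(2)[OF g] sq_integrable_mult[OF f g]
      by (simp add: A_def B_def C_def)
    finally show ?thesis .
  qed
  have A: "A \<ge> 0" by (simp add: A_def)
  show ?thesis
  proof (cases "A = 0")
    case True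
    have "C = 0"
    proof (rule ccontr)
      assume "C \<noteq> 0"
      \<comment> \<open>For \<open>A = 0\<close> the quadratic is affine in \<open>s\<close>, and
        this \<open>s\<close> gives it the value -1.\<close>
      with q[of "- (B + 1) / (2 * C)"] True show False by (simp add: field_simps)
    qed
    with True show ?thesis by (simp add: A_def C_def)
  next
    case False
    \<comment> \<open>The minimum point of the quadratic.\<close>
    with q[of "- C / A"] A have "C\<^sup>2 \<le> A * B"
      by (simp add: field_simps power2_eq_square)
    then show ?thesis by (simp add: A_def B_def C_def)
  qed
qed

lemma tendsto_0_of_square_le:
  fixes a b :: "nat \<Rightarrow> real"
  assumes "\<And>k. (a k)\<^sup>2 \<le> b k" "b \<longlonglongrightarrow> 0"
  shows "a \<longlonglongrightarrow> 0"
proof -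
  have "(\<lambda>k. (a k)\<^sup>2) \<longlonglongrightarrow> 0"
    by (rule real_tendsto_sandwich[OF _ _ tendsto_const assms(2)]) (use assms(1) in auto)
  then show ?thesis by simp
qed

lemma L2_tendsto_integral_mult:
  assumes "\<And>k. sq_integrable (f k)" "sq_integrable F" "sq_integrable g"
    and "(\<lambda>k. \<integral>x. (f k x - F x)\<^sup>2 \<partial>lborel) \<longlonglongrightarrow> 0"
  shows "(\<lambda>k. \<integral>x. f k x * g x \<partial>lborel) \<longlonglongrightarrow> (\<integral>x. F x * g x \<partial>lborel)"
proof -
  have "(\<lambda>k. (\<integral>x. f k x * g x \<partial>lborel) - (\<integral>x. F x * g x \<partial>lborel)) \<longlonglongrightarrow> 0"
  proof (rule tendsto_0_of_square_le)
    fix k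
    have "(\<integral>x. f k x * g x \<partial>lborel) - (\<integral>x. F x * g x \<partial>lborel) = (\<integral>x. (f k x - F x) * g x \<partial>lborel)"
      using sq_integrable_mult[OF assms(1,3)] sq_integrable_mult[OF assms(2,3)] by (simp add: left_diff_distrib)
    then show "((\<integral>x. f k x * g x \<partial>lborel) - (\<integral>x. F x * g x \<partial>lborel))\<^sup>2 \<le>
      (\<integral>x. (f k x - F x)\<^sup>2 \<partial>lborel) * (\<integral>x. (g x)\<^sup>2 \<partial>lborel)"
      using Cauchy_Schwarz_integral[OF sq_integrable_diff[OF assms(1,2)] assms(3)] by simp
  next
    show "(\<lambda>k. (\<integral>x. (f k x - F x)\<^sup>2 \<partial>lborel) * (\<integral>x. (g x)\<^sup>2 \<partial>lborel)) \<longlonglongrightarrow> 0"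
      using tendsto_mult_right[OF assms(4)] by simp
  qed
  then show ?thesis by (simp add: LIM_zero_iff)
qed

lemma integral_square_add_le:
  assumes f: "sq_integrable f" and g: "sq_integrable g"
  shows "(\<integral>x. (f x + g x)\<^sup>2 \<partial>lborel) \<le> 2 * (\<integral>x. (f x)\<^sup>2 \<partial>lborel) + 2 * (\<integral>x. (g x)\<^sup>2 \<partial>lborel)"
proof -
  have "(\<integral>x. (f x + g x)\<^sup>2 \<partial>lborel) \<le> (\<integral>x. 2 * (f x)\<^sup>2 + 2 * (g x)\<^sup>2 \<partial>lborel)"
  proof (rule integral_mono)
    show "integrable lborel (\<lambda>x. (f x + g x)\<^sup>2)" by (rule sq_integrableD(2)[OF sq_integrable_add[OF f g]])
    show "integrable lborel (\<lambda>x. 2 * (f x)\<^sup>2 + 2 * (g x)\<^sup>2)"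
      using sq_integrableD(2)[OF f] sq_integrableD(2)[OF g] by simp
    show "(f x + g x)\<^sup>2 \<le> 2 * (f x)\<^sup>2 + 2 * (g x)\<^sup>2" for x
      using sum_squares_bound[of "f x" "g x"] by (simp add: power2_sum)
  qed
  then show ?thesis using sq_integrableD(2)[OF f] sq_integrableD(2)[OF g] by simp
qed

section \<open>Contraction property and convergence of mollifications\<close>

abbreviation moll :: "nat \<Rightarrow> 'b::euclidean_space \<Rightarrow> real" where
  "moll k \<equiv> mollifier (inverse (real (Suc k)))"

lemma moll_test: "moll k \<in> test_functions UNIV"
  by (rule mollifier_test) simp

lemma mollifier_reflect_integral:
  fixes x :: "'b::euclidean_space"
  assumes "d > 0"
  shows "(\<integral>y. mollifier d (x - y) \<partial>lborel) = 1" "integrable lborel (\<lambda>y. mollifier d (x - y))"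
  using integral_reflect[OF smooth_borel[OF mollifier_props(1)[OF assms]], of x] mollifier_props(5)[OF assms]
    test_functions_integrable[OF test_functions_reflect[OF mollifier_test[OF assms]]] by auto

text \<open>Jensen's inequality: the variance of \<open>f\<close> under the probability density
  \<open>\<lambda>y. mollifier d (x - y)\<close> is nonnegative.\<close>

lemma conv_mollifier_square_le:
  assumes d: "d > 0" and f: "integrable lborel f" "integrable lborel (\<lambda>y. (f y)\<^sup>2)"
  shows "(conv (mollifier d) f x)\<^sup>2 \<le> conv (mollifier d) (\<lambda>y. (f y)\<^sup>2) x"
proof -
  let ?r = "mollifier d" and ?c = "conv (mollifier d) f x"
  have i: "integrable lborel (\<lambda>y. ?r (x - y) * f y)" "integrable lborel (\<lambda>y. ?r (x - y) * (f y)\<^sup>2)"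
    by (rule conv_integrable[OF mollifier_test[OF d]] f)+
  have "0 \<le> (\<integral>y. ?r (x - y) * (f y - ?c)\<^sup>2 \<partial>lborel)"
    by (intro Bochner_Integration.integral_nonneg mult_nonneg_nonneg mollifier_props(2)[OF d]) auto
  also have "\<dots> = (\<integral>y. ?r (x - y) * (f y)\<^sup>2 - (2 * ?c) * (?r (x - y) * f y) + ?c\<^sup>2 * ?r (x - y) \<partial>lborel)"
    by (rule arg_cong[where f="integral\<^sup>L lborel"]) (simp add: fun_eq_iff power2_eq_square algebra_simps)
  also have "\<dots> = conv ?r (\<lambda>y. (f y)\<^sup>2) x - (2 * ?c) * ?c + ?c\<^sup>2"
    using i mollifier_reflect_integral[OF d, of x] by (simp add: conv_def)
  finally show ?thesis by (simp add: power2_eq_square)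
qed

text \<open>Tonelli's theorem; the kernel is even and has mass one in either variable.\<close>

lemma nn_integral_conv:
  fixes f :: "'b::euclidean_space \<Rightarrow> real"
  assumes d: "d > 0" and f: "integrable lborel f" "\<And>y. 0 \<le> f y"
  shows "(\<integral>\<^sup>+x. ennreal (conv (mollifier d) f x) \<partial>lborel) = (\<integral>\<^sup>+y. ennreal (f y) \<partial>lborel)"
proof -
  let ?r = "mollifier d :: 'b \<Rightarrow> real"
  note [measurable] = smooth_borel[OF mollifier_props(1)[OF d]] borel_measurable_integrable[OF f(1), unfolded measurable_lborel1]
  have "(\<integral>\<^sup>+x. ennreal (conv ?r f x) \<partial>lborel) = (\<integral>\<^sup>+x. \<integral>\<^sup>+y. ennreal (?r (x - y) * f y) \<partial>lborel \<partial>lborel)"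
    unfolding conv_def
    by (intro nn_integral_cong nn_integral_eq_integral[symmetric] conv_integrable[OF mollifier_test[OF d] f(1)]
        AE_I2 mult_nonneg_nonneg f(2) mollifier_props(2)[OF d])
  also have "\<dots> = (\<integral>\<^sup>+y. \<integral>\<^sup>+x. ennreal (?r (x - y) * f y) \<partial>lborel \<partial>lborel)"
    by (rule lborel_pair.Fubini') measurable
  also have "\<dots> = (\<integral>\<^sup>+y. ennreal (f y) \<partial>lborel)"
  proof (rule nn_integral_cong)
    fix y
    have "(\<integral>\<^sup>+x. ennreal (?r (x - y) * f y) \<partial>lborel) = (\<integral>\<^sup>+x. ennreal (?r (y - x)) * ennreal (f y) \<partial>lborel)"
      using mollifier_props(4)[OF d, of "y - x" for x]
      by (intro nn_integral_cong) (simp add: ennreal_mult' mollifier_props(2)[OF d])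
    also have "\<dots> = (\<integral>\<^sup>+x. ennreal (?r (y - x)) \<partial>lborel) * ennreal (f y)"
      by (rule nn_integral_multc) measurable
    also have "(\<integral>\<^sup>+x. ennreal (?r (y - x)) \<partial>lborel) = 1"
      using mollifier_reflect_integral[OF d, of y] mollifier_props(2)[OF d]
      by (subst nn_integral_eq_integral) auto
    finally show "(\<integral>\<^sup>+x. ennreal (?r (x - y) * f y) \<partial>lborel) = ennreal (f y)" by simp
  qed
  finally show ?thesis .
qed

lemma conv_borel: "\<rho> \<in> test_functions UNIV \<Longrightarrow> integrable lborel f \<Longrightarrow> conv \<rho> f \<in> borel_measurable borel"
  by (intro smooth_borel smooth_conv)

lemma conv_contraction:
  fixes f :: "'b::euclidean_space \<Rightarrow> real"
  assumes d: "d > 0" and f: "integrable lborel f" "sq_integrable f"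
  shows "sq_integrable (conv (mollifier d) f)"
    and "(\<integral>x. (conv (mollifier d) f x)\<^sup>2 \<partial>lborel) \<le> (\<integral>x. (f x)\<^sup>2 \<partial>lborel)"
proof -
  note f2 = sq_integrableD(2)[OF f(2)]
  note [measurable] = conv_borel[OF mollifier_test[OF d] f(1)]
  have "(\<integral>\<^sup>+x. ennreal ((conv (mollifier d) f x)\<^sup>2) \<partial>lborel) \<le> (\<integral>\<^sup>+x. ennreal (conv (mollifier d) (\<lambda>y. (f y)\<^sup>2) x) \<partial>lborel)"
    by (intro nn_integral_mono ennreal_leI conv_mollifier_square_le d f(1) f2)
  also have "\<dots> = (\<integral>\<^sup>+y. ennreal ((f y)\<^sup>2) \<partial>lborel)" by (rule nn_integral_conv[OF d f2]) simp
  also have "\<dots> = ennreal (\<integral>y. (f y)\<^sup>2 \<partial>lborel)" by (rule nn_integral_eq_integral[OF f2]) simp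
  finally have le: "(\<integral>\<^sup>+x. ennreal ((conv (mollifier d) f x)\<^sup>2) \<partial>lborel) \<le> ennreal (\<integral>y. (f y)\<^sup>2 \<partial>lborel)" .
  then have int: "integrable lborel (\<lambda>x. (conv (mollifier d) f x)\<^sup>2)"
    by (intro integrableI_nonneg) (auto intro: le_less_trans)
  then show "sq_integrable (conv (mollifier d) f)" by (simp add: sq_integrable_def)
  from le show "(\<integral>x. (conv (mollifier d) f x)\<^sup>2 \<partial>lborel) \<le> (\<integral>x. (f x)\<^sup>2 \<partial>lborel)"
    by (subst (asm) nn_integral_eq_integral[OF int]) auto
qed

lemma conv_diff:
  assumes "\<rho> \<in> test_functions UNIV" "integrable lborel f" "integrable lborel g"
  shows "conv \<rho> (\<lambda>y. f y - g y) x = conv \<rho> f x - conv \<rho> g x"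
  using conv_integrable[OF assms(1,2)] conv_integrable[OF assms(1,3)] by (simp add: conv_def right_diff_distrib)

text \<open>A mollified value is an average over the ball of radius \<open>d\<close>. With
  \<open>c = g x\<close> this yields uniform convergence, with \<open>c = e = 1/2\<close> it keeps a
  cutoff between 0 and 1, and with \<open>c = 1\<close>, \<open>e = 0\<close> it shows where a
  cutoff equals 1.\<close>

lemma conv_const_bound:
  assumes d: "d > 0" and f: "integrable lborel f" and b: "\<And>y. norm (x - y) < d \<Longrightarrow> \<bar>f y - c\<bar> \<le> e"
  shows "\<bar>conv (mollifier d) f x - c\<bar> \<le> e"
proof -
  let ?r = "mollifier d"
  have i: "integrable lborel (\<lambda>y. ?r (x - y) * f y)" by (rule conv_integrable[OF mollifier_test[OF d] f])
  note m = mollifier_reflect_integral[OF d, of x]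
  have p: "?r (x - y) * \<bar>f y - c\<bar> \<le> ?r (x - y) * e" for y
  proof (cases "norm (x - y) < d")
    case True
    then show ?thesis using b[OF True] mollifier_props(2)[OF d, of "x - y"] by (intro mult_left_mono) auto
  next
    case False
    then have "?r (x - y) = 0" by (intro mollifier_props(3)[OF d]) simp
    then show ?thesis by simp
  qed
  have "conv ?r f x - c = (\<integral>y. ?r (x - y) * (f y - c) \<partial>lborel)"
    using i m by (simp add: conv_def right_diff_distrib)
  also have "\<bar>\<dots>\<bar> \<le> (\<integral>y. \<bar>?r (x - y) * (f y - c)\<bar> \<partial>lborel)"
    by (rule integral_abs_bound)
  also have "\<dots> \<le> (\<integral>y. ?r (x - y) * e \<partial>lborel)"
  proof (rule integral_mono)
    show "integrable lborel (\<lambda>y. \<bar>?r (x - y) * (f y - c)\<bar>)"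
      using i m by (intro integrable_abs) (simp add: right_diff_distrib)
    show "integrable lborel (\<lambda>y. ?r (x - y) * e)" using m by simp
    show "\<bar>?r (x - y) * (f y - c)\<bar> \<le> ?r (x - y) * e" for y
      using p[of y] mollifier_props(2)[OF d, of "x - y"] by (simp add: abs_mult)
  qed
  finally show ?thesis using m by simp
qed

lemma conv_moll_uniform:
  assumes g: "continuous_on UNIV g" "\<And>x. norm x > R \<Longrightarrow> g x = 0" and e: "e > 0"
  shows "\<exists>k0. \<forall>k\<ge>k0. \<forall>x. \<bar>conv (moll k) g x - g x\<bar> \<le> e"
proof -
  obtain B where B: "\<forall>z. \<bar>g z\<bar> \<le> B" using continuous_zero_outside_ball_bounded[OF g] by meson
  have int: "integrable lborel g"
    by (rule integrable_zero_outside_ball[OF borel_measurable_continuous_onI[OF g(1)] g(2) B[rule_format]])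
  \<comment> \<open>Radii are at most 1: if \<open>norm x\<close> is at most \<open>R + 1\<close>,
    the whole averaging ball lies in this larger ball; otherwise \<open>g\<close> vanishes on the
    averaging ball.\<close>
  have "uniformly_continuous_on (cball 0 (R + 2)) g"
    by (intro compact_uniformly_continuous continuous_on_subset[OF g(1)]) auto
  then obtain \<delta> where \<delta>: "\<delta> > 0" "\<forall>x\<in>cball 0 (R+2). \<forall>y\<in>cball 0 (R+2). dist y x < \<delta> \<longrightarrow> dist (g y) (g x) < e"
    using e unfolding uniformly_continuous_on_def by meson
  obtain k0 where k0: "inverse (real (Suc k0)) < min \<delta> 1" using reals_Archimedean[of "min \<delta> 1"] \<delta>(1) by auto
  have "\<bar>conv (moll k) g x - g x\<bar> \<le> e" if "k \<ge> k0" for k x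
  proof (rule conv_const_bound[OF _ int])
    fix y assume y: "norm (x - y) < inverse (real (Suc k))"
    have "inverse (real (Suc k)) \<le> inverse (real (Suc k0))" using that by simp
    with y k0 have y1: "norm (x - y) < \<delta>" "norm (x - y) < 1" by linarith+
    have n: "norm x \<le> norm y + norm (x - y)" "norm y \<le> norm x + norm (x - y)" by norm+
    show "\<bar>g y - g x\<bar> \<le> e"
    proof (cases "norm x \<le> R + 1")
      case True
      then have "x \<in> cball 0 (R+2)" "y \<in> cball 0 (R+2)" using n y1 by auto
      then have "dist (g y) (g x) < e" using \<delta>(2) y1 by (simp add: dist_norm norm_minus_commute)
      then show ?thesis by (simp add: dist_real_def)
    next
      case False
      then have "norm x > R" "norm y > R" using n y1 by linarith+
      then have "g x = 0" "g y = 0" using g(2) by blast+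
      then show ?thesis using e by simp
    qed
  qed simp
  then show ?thesis by blast
qed

text \<open>\<open>measurable_on\<close> already supplies continuous functions that converge almost
  everywhere. Clamping them to the interval from \<open>- M\<close> to \<open>M\<close> and
  multiplying by a cutoff that grows with \<open>n\<close> adds the bound and the compact support
  without changing the limit.\<close>

lemma bounded_continuous_approx:
  fixes f :: "'b::euclidean_space \<Rightarrow> real"
  assumes f: "f \<in> borel_measurable borel" "\<And>x. \<bar>f x\<bar> \<le> M"
  shows "\<exists>h. (\<forall>n. continuous_on UNIV (h n)) \<and> (\<forall>n x. \<bar>h n x\<bar> \<le> M) \<and>
    (\<forall>n x. norm x > real n + 1 \<longrightarrow> h n x = 0) \<and> (AE x in lborel. (\<lambda>n. h n x) \<longlonglongrightarrow> f x)"
proof -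
  have "f measurable_on UNIV"
    using f(1) by (intro lebesgue_measurable_imp_measurable_on_real) (auto intro: measurable_completion)
  then obtain N g where N: "negligible N" and g: "\<forall>n. continuous_on UNIV (g n)"
    "\<forall>x. x \<notin> N \<longrightarrow> (\<lambda>n. g n x) \<longlonglongrightarrow> f x"
    unfolding measurable_on_def by auto
  have M: "M \<ge> 0" using f(2)[of 0] by linarith
  define c where "c = (\<lambda>n x::'b. max 0 (min 1 (real n + 1 - norm x)))"
  define h where "h = (\<lambda>n x. max (- M) (min M (g n x)) * c n x)"
  have c01: "0 \<le> c n x" "c n x \<le> 1" for n x by (auto simp: c_def)
  have "continuous_on UNIV (h n)" for n
    unfolding h_def c_def using g(1) by (intro continuous_intros) auto
  moreover have "\<bar>h n x\<bar> \<le> M" for n x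
  proof -
    have "\<bar>max (- M) (min M (g n x))\<bar> \<le> M" using M by linarith
    then have "\<bar>max (- M) (min M (g n x))\<bar> * \<bar>c n x\<bar> \<le> M * 1"
      using c01[of n x] M by (intro mult_mono) auto
    then show ?thesis by (simp add: h_def abs_mult)
  qed
  moreover have "h n x = 0" if "norm x > real n + 1" for n x
    using that by (simp add: h_def c_def)
  moreover have "AE x in lborel. (\<lambda>n. h n x) \<longlonglongrightarrow> f x"
  proof -
    have "AE x in lebesgue. x \<notin> N"
      using N negligible_iff_null_sets AE_not_in by blast
    then have "AE x in lborel. x \<notin> N" by (simp add: AE_completion_iff)
    then show ?thesis
    proof eventually_elim
      case (elim x)
      have "(\<lambda>n. c n x) \<longlonglongrightarrow> 1"
      proof (rule tendsto_eventually)
        have "c n x = 1" if "n \<ge> nat \<lceil>norm x\<rceil>" for n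
        proof -
          have "norm x \<le> real n" using that by linarith
          then show ?thesis by (simp add: c_def)
        qed
        then show "\<forall>\<^sub>F n in sequentially. c n x = 1" by (rule eventually_sequentiallyI)
      qed
      moreover have "(\<lambda>n. g n x) \<longlonglongrightarrow> f x" using g(2) elim by blast
      ultimately have "(\<lambda>n. h n x) \<longlonglongrightarrow> max (- M) (min M (f x)) * 1"
        unfolding h_def by (intro tendsto_intros)
      moreover have "max (- M) (min M (f x)) = f x" using f(2)[of x] by linarith
      ultimately show ?case by simp
    qed
  qed
  ultimately show ?thesis by blast
qed

lemma integral_square_tendsto_0:
  fixes f :: "'b::euclidean_space \<Rightarrow> real"
  assumes [measurable]: "\<And>n. h n \<in> borel_measurable borel" "f \<in> borel_measurable borel"
    and w: "integrable lborel w" "\<And>n x. (h n x - f x)\<^sup>2 \<le> w x"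
    and lim: "AE x in lborel. (\<lambda>n. h n x) \<longlonglongrightarrow> f x"
  shows "(\<lambda>n. \<integral>x. (h n x - f x)\<^sup>2 \<partial>lborel) \<longlonglongrightarrow> 0"
proof -
  have "(\<lambda>n. \<integral>x. (h n x - f x)\<^sup>2 \<partial>lborel) \<longlonglongrightarrow> (\<integral>x. 0 \<partial>(lborel :: 'b measure))"
  proof (rule integral_dominated_convergence[where w=w])
    show "AE x in lborel. (\<lambda>n. (h n x - f x)\<^sup>2) \<longlonglongrightarrow> 0"
      using lim
    proof eventually_elim
      case (elim x)
      then have "(\<lambda>n. (h n x - f x)\<^sup>2) \<longlonglongrightarrow> (f x - f x)\<^sup>2" by (intro tendsto_intros)
      then show ?case by simp
    qed
  qed (use w in auto)
  then show ?thesis by simp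
qed

text \<open>Density of compactly supported continuous functions in L2: truncation in height, then
  bounded approximation, each by dominated convergence. Since (a + b)^2 is at most 2 a^2 + 2 b^2,
  two errors below \<open>e / 4\<close> suffice.\<close>

lemma sq_integrable_continuous_approx:
  fixes f :: "'b::euclidean_space \<Rightarrow> real"
  assumes f: "sq_integrable f" "\<And>x. norm x > R \<Longrightarrow> f x = 0" and e: "e > 0"
  shows "\<exists>g. continuous_on UNIV g \<and> (\<forall>x. norm x > R + 1 \<longrightarrow> g x = 0) \<and> (\<integral>x. (g x - f x)\<^sup>2 \<partial>lborel) < e"
proof -
  note [measurable] = sq_integrableD(1)[OF f(1)]
  define F where "F = (\<lambda>m x. max (- real m) (min (real m) (f x)))"
  have [measurable]: "F m \<in> borel_measurable borel" for m unfolding F_def by measurable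
  have "(\<lambda>m. \<integral>x. (F m x - f x)\<^sup>2 \<partial>lborel) \<longlonglongrightarrow> 0"
  proof (rule integral_square_tendsto_0[where w="\<lambda>x. (f x)\<^sup>2"])
    show "(F m x - f x)\<^sup>2 \<le> (f x)\<^sup>2" for m x
    proof -
      have "\<bar>F m x - f x\<bar> \<le> \<bar>f x\<bar>" by (auto simp: F_def)
      then show ?thesis by (simp add: abs_le_square_iff)
    qed
    have "(\<lambda>m. F m x) \<longlonglongrightarrow> f x" for x
    proof (rule tendsto_eventually)
      have "F m x = f x" if "m \<ge> nat \<lceil>\<bar>f x\<bar>\<rceil>" for m
      proof -
        have "\<bar>f x\<bar> \<le> real m" using that by linarith
        then show ?thesis by (auto simp: F_def)
      qed
      then show "\<forall>\<^sub>F m in sequentially. F m x = f x" by (rule eventually_sequentiallyI)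
    qed
    then show "AE x in lborel. (\<lambda>m. F m x) \<longlonglongrightarrow> f x" by simp
  qed (use sq_integrableD[OF f(1)] in auto)
  then have "\<forall>\<^sub>F m in sequentially. (\<integral>x. (F m x - f x)\<^sup>2 \<partial>lborel) < e / 4"
    by (rule order_tendstoD) (use e in auto)
  then obtain m where m: "(\<integral>x. (F m x - f x)\<^sup>2 \<partial>lborel) < e / 4"
    using eventually_happens' sequentially_bot by blast
  have Fm: "\<bar>F m x\<bar> \<le> real m" for x by (auto simp: F_def)
  have F0: "F m x = 0" if "norm x > R" for x using f(2)[OF that] by (simp add: F_def)
  obtain h where h: "\<forall>n. continuous_on UNIV (h n)" "\<forall>n x. \<bar>h n x\<bar> \<le> real m"
    "AE x in lborel. (\<lambda>n. h n x) \<longlonglongrightarrow> F m x"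
    using bounded_continuous_approx[of "F m" "real m"] Fm by auto
  \<comment> \<open>The supports of \<open>h n\<close> grow with \<open>n\<close>. This fixed
    cutoff, equal to 1 where \<open>F m\<close> lives, confines them to one ball and so provides a
    common majorant.\<close>
  define c where "c = (\<lambda>x::'b. max 0 (min 1 (R + 1 - norm x)))"
  have cc: "continuous_on UNIV c" unfolding c_def by (intro continuous_intros)
  have c01: "0 \<le> c x" "c x \<le> 1" for x by (auto simp: c_def)
  have c0: "c x = 0" if "norm x > R + 1" for x using that by (simp add: c_def)
  have Fc: "c x * F m x = F m x" for x
  proof (cases "norm x \<le> R")
    case True
    then show ?thesis by (simp add: c_def)
  next
    case False
    then have "F m x = 0" by (intro F0) simp
    then show ?thesis by simp
  qed
  define g where "g = (\<lambda>n x. c x * h n x)"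
  have gc: "continuous_on UNIV (g n)" for n unfolding g_def using h(1) cc by (intro continuous_intros) auto
  have g0: "g n x = 0" if "norm x > R + 1" for n x using c0[OF that] by (simp add: g_def)
  have gm: "\<bar>g n x\<bar> \<le> real m" for n x
  proof -
    have "\<bar>c x\<bar> * \<bar>h n x\<bar> \<le> 1 * real m" using c01[of x] h(2) by (intro mult_mono) auto
    then show ?thesis by (simp add: g_def abs_mult)
  qed
  have [measurable]: "g n \<in> borel_measurable borel" for n using gc borel_measurable_continuous_onI by blast
  have "(\<lambda>n. \<integral>x. (g n x - F m x)\<^sup>2 \<partial>lborel) \<longlonglongrightarrow> 0"
  proof (rule integral_square_tendsto_0[where w="\<lambda>x. (2 * real m)\<^sup>2 * indicator (cball 0 (R + 1)) x"])
    show "(g n x - F m x)\<^sup>2 \<le> (2 * real m)\<^sup>2 * indicator (cball 0 (R + 1)) x" for n x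
    proof (cases "norm x \<le> R + 1")
      case True
      have "\<bar>g n x - F m x\<bar> \<le> \<bar>2 * real m\<bar>" using gm[of n x] Fm[of x] by linarith
      then have "(g n x - F m x)\<^sup>2 \<le> (2 * real m)\<^sup>2" by (simp only: abs_le_square_iff)
      with True show ?thesis by simp
    next
      case False
      then have "g n x = 0" "F m x = 0" using g0[of x n] F0[of x] by auto
      then show ?thesis by simp
    qed
    show "AE x in lborel. (\<lambda>n. g n x) \<longlonglongrightarrow> F m x"
      using h(3)
    proof eventually_elim
      case (elim x)
      then have "(\<lambda>n. c x * h n x) \<longlonglongrightarrow> c x * F m x" by (intro tendsto_intros)
      then show ?case unfolding Fc g_def .
    qed
    show "integrable lborel (\<lambda>x. (2 * real m)\<^sup>2 * indicator (cball 0 (R + 1)) x)"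
      using emeasure_lborel_cball_finite[of 0 "R + 1"] by (intro integrable_mult_right integrable_real_indicator) auto
  qed auto
  then have "\<forall>\<^sub>F n in sequentially. (\<integral>x. (g n x - F m x)\<^sup>2 \<partial>lborel) < e / 4"
    by (rule order_tendstoD) (use e in auto)
  then obtain n where n: "(\<integral>x. (g n x - F m x)\<^sup>2 \<partial>lborel) < e / 4"
    using eventually_happens' sequentially_bot by blast
  have sF: "sq_integrable (F m)" by (rule sq_integrable_ball[OF _ F0 Fm]) auto
  have sg: "sq_integrable (g n)" by (rule sq_integrable_ball[OF _ g0 gm]) auto
  have "(\<integral>x. (g n x - f x)\<^sup>2 \<partial>lborel) < e"
    using integral_square_add_le[OF sq_integrable_diff[OF sg sF] sq_integrable_diff[OF sF f(1)]] n m by simp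
  then show ?thesis using gc g0 by blast
qed

text \<open>Three errors: the contraction property handles the mollification of
  \<open>f - g\<close>, uniform convergence handles the continuous \<open>g\<close>, and
  \<open>g - f\<close> is small by density.\<close>

lemma conv_moll_L2:
  fixes f :: "'b::euclidean_space \<Rightarrow> real"
  assumes f: "sq_integrable f" "\<And>x. norm x > R \<Longrightarrow> f x = 0"
  shows "(\<lambda>k. \<integral>x. (conv (moll k) f x - f x)\<^sup>2 \<partial>lborel) \<longlonglongrightarrow> 0"
proof (rule LIMSEQ_I)
  fix e :: real assume e: "e > 0"
  \<comment> \<open>Splitting the square of a sum twice costs factors 4, 4 and 2, and 10/12 of
    \<open>e\<close> is less than \<open>e\<close>.\<close>
  obtain g where g: "continuous_on UNIV g" "\<forall>x. norm x > R + 1 \<longrightarrow> g x = 0"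
    and gf: "(\<integral>x. (g x - f x)\<^sup>2 \<partial>lborel) < e / 12"
    using sq_integrable_continuous_approx[OF f, where e="e / 12"] e by auto
  obtain B where B: "\<forall>z. \<bar>g z\<bar> \<le> B" using continuous_zero_outside_ball_bounded[OF g(1) g(2)[rule_format]] by meson
  have gb[measurable]: "g \<in> borel_measurable borel" by (rule borel_measurable_continuous_onI[OF g(1)])
  have gi: "integrable lborel g" by (rule integrable_zero_outside_ball[OF gb g(2)[rule_format] B[rule_format]])
  have sg: "sq_integrable g" by (rule sq_integrable_ball[OF gb g(2)[rule_format] B[rule_format]])
  have fi: "integrable lborel f" by (rule sq_integrable_imp_integrable[OF f])
  define V where "V = measure lborel (cball (0::'b) (R + 2))"
  have V: "V \<ge> 0" by (simp add: V_def)
  \<comment> \<open>A uniform error \<open>\<eta>\<close> on the ball of volume \<open>V\<close>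
    costs \<open>\<eta>\<^sup>2 * V\<close>, which is below \<open>e / 12\<close>; the added 1 makes
    this strict and covers \<open>V = 0\<close>.\<close>
  define \<eta> where "\<eta> = sqrt (e / (12 * (V + 1)))"
  have \<eta>: "\<eta> > 0" "\<eta>\<^sup>2 * V < e / 12" using e V by (auto simp: \<eta>_def field_simps)
  obtain k0 where k0: "\<forall>k\<ge>k0. \<forall>x. \<bar>conv (moll k) g x - g x\<bar> \<le> \<eta>"
    using conv_moll_uniform[OF g(1) g(2)[rule_format] \<eta>(1)] by blast
  have "norm ((\<integral>x. (conv (moll k) f x - f x)\<^sup>2 \<partial>lborel) - 0) < e" if k: "k \<ge> k0" for k
  proof -
    let ?d = "inverse (real (Suc k))"
    have d: "?d > 0" "?d \<le> 1" by (auto simp: inverse_le_1_iff)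
    define a where "a = conv (moll k) (\<lambda>y. f y - g y)"
    define b where "b = (\<lambda>x. conv (moll k) g x - g x)"
    have fgi: "integrable lborel (\<lambda>y. f y - g y)" using fi gi by simp
    have sa: "sq_integrable a" and ale: "(\<integral>x. (a x)\<^sup>2 \<partial>lborel) \<le> (\<integral>x. (f x - g x)\<^sup>2 \<partial>lborel)"
      unfolding a_def using conv_contraction[OF d(1) fgi sq_integrable_diff[OF f(1) sg]] by auto
    have sb: "sq_integrable b" unfolding b_def
      by (intro sq_integrable_diff conv_contraction(1)[OF d(1) gi sg] sg)
    have b0: "b x = 0" if "norm x > R + 2" for x
    proof -
      have "conv (moll k) g x = 0"
      proof (rule conv_outside_ball[of ?d _ "R + 1"])
        show "moll k z = 0" if "norm z > ?d" for z :: 'b by (rule mollifier_props(3)[OF d(1)]) (use that in simp)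
      qed (use that d g(2) in auto)
      then show ?thesis using g(2) that by (simp add: b_def)
    qed
    have "(\<integral>x. (b x)\<^sup>2 \<partial>lborel) \<le> (\<integral>x. \<eta>\<^sup>2 * indicator (cball (0::'b) (R + 2)) x \<partial>lborel)"
    proof (rule integral_mono[OF sq_integrableD(2)[OF sb]])
      show "integrable lborel (\<lambda>x. \<eta>\<^sup>2 * indicator (cball (0::'b) (R + 2)) x)"
        using emeasure_lborel_cball_finite[of "0::'b" "R + 2"] by (intro integrable_mult_right integrable_real_indicator) auto
      show "(b x)\<^sup>2 \<le> \<eta>\<^sup>2 * indicator (cball 0 (R + 2)) x" for x
      proof (cases "norm x \<le> R + 2")
        case True
        have "\<bar>b x\<bar> \<le> \<bar>\<eta>\<bar>" using k0 k \<eta>(1) by (simp add: b_def)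
        then have "(b x)\<^sup>2 \<le> \<eta>\<^sup>2" by (simp only: abs_le_square_iff)
        with True show ?thesis by simp
      next
        case False
        then have "b x = 0" by (intro b0) simp
        then show ?thesis by simp
      qed
    qed
    also have "\<dots> = \<eta>\<^sup>2 * V" by (simp add: V_def)
    finally have ble: "(\<integral>x. (b x)\<^sup>2 \<partial>lborel) < e / 12" using \<eta>(2) by linarith
    have fg: "(\<integral>x. (f x - g x)\<^sup>2 \<partial>lborel) < e / 12" using gf by (simp add: power2_commute)
    have "(\<integral>x. (conv (moll k) f x - f x)\<^sup>2 \<partial>lborel) = (\<integral>x. ((a x + b x) + (g x - f x))\<^sup>2 \<partial>lborel)"
      unfolding a_def b_def conv_diff[OF moll_test fi gi] by simp
    also have "\<dots> \<le> 2 * (\<integral>x. (a x + b x)\<^sup>2 \<partial>lborel) + 2 * (\<integral>x. (g x - f x)\<^sup>2 \<partial>lborel)"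
      by (rule integral_square_add_le[OF sq_integrable_add[OF sa sb] sq_integrable_diff[OF sg f(1)]])
    finally have 1: "(\<integral>x. (conv (moll k) f x - f x)\<^sup>2 \<partial>lborel) \<le>
      2 * (\<integral>x. (a x + b x)\<^sup>2 \<partial>lborel) + 2 * (\<integral>x. (g x - f x)\<^sup>2 \<partial>lborel)" .
    have "(\<integral>x. (a x + b x)\<^sup>2 \<partial>lborel) \<le> 2 * (\<integral>x. (a x)\<^sup>2 \<partial>lborel) + 2 * (\<integral>x. (b x)\<^sup>2 \<partial>lborel)"
      by (rule integral_square_add_le[OF sa sb])
    with 1 have "(\<integral>x. (conv (moll k) f x - f x)\<^sup>2 \<partial>lborel) < e"
      using ale ble fg gf e by linarith
    then show ?thesis by simp
  qed
  then show "\<exists>k0. \<forall>k\<ge>k0. norm ((\<integral>x. (conv (moll k) f x - f x)\<^sup>2 \<partial>lborel) - 0) < e" by blast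
qed

text \<open>Fundamental lemma of the calculus of variations. Uniform mollification extends the
  hypothesis to continuous compactly supported functions; bounded almost everywhere convergence
  extends it to \<open>sgn (f x)\<close>, which turns the integral into the L1 norm of
  \<open>f\<close>.\<close>

lemma AE_eq_0_of_test_functions:
  fixes f :: "'b::euclidean_space \<Rightarrow> real"
  assumes f: "integrable lborel f" and t: "\<And>\<phi>. \<phi> \<in> test_functions UNIV \<Longrightarrow> (\<integral>x. f x * \<phi> x \<partial>lborel) = 0"
  shows "AE x in lborel. f x = 0"
proof -
  note fb[measurable] = borel_measurable_integrable[OF f, unfolded measurable_lborel1]
  have c: "(\<integral>x. f x * g x \<partial>lborel) = 0" if g: "continuous_on UNIV g" "\<And>x. norm x > R \<Longrightarrow> g x = 0" for g R
  proof -
    obtain B where B: "\<forall>z. \<bar>g z\<bar> \<le> B" using continuous_zero_outside_ball_bounded[OF g] by meson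
    have gb[measurable]: "g \<in> borel_measurable borel" by (rule borel_measurable_continuous_onI[OF g(1)])
    have gi: "integrable lborel g" by (rule integrable_zero_outside_ball[OF gb g(2) B[rule_format]])
    have "\<bar>\<integral>x. f x * g x \<partial>lborel\<bar> \<le> e * (\<integral>x. \<bar>f x\<bar> \<partial>lborel)" if "e > 0" for e
    proof -
      obtain k where k: "\<forall>x. \<bar>conv (moll k) g x - g x\<bar> \<le> e" using conv_moll_uniform[OF g \<open>e > 0\<close>] by blast
      have tk: "conv (moll k) g \<in> test_functions UNIV" by (rule conv_test[OF moll_test gi g(2)])
      obtain B' where B': "\<forall>z. \<bar>conv (moll k) g z\<bar> \<le> B'" using test_functions_bounded[OF tk] by meson
      have i1: "integrable lborel (\<lambda>x. f x * g x)"
        using integrable_bounded_mult[OF f, of g B] B by (simp add: mult.commute)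
      have i2: "integrable lborel (\<lambda>x. f x * conv (moll k) g x)"
        using integrable_bounded_mult[OF f, of "conv (moll k) g" B'] B' conv_borel[OF moll_test gi] by (simp add: mult.commute)
      have "(\<integral>x. f x * g x \<partial>lborel) = (\<integral>x. f x * g x - f x * conv (moll k) g x \<partial>lborel)"
        using t[OF tk] i1 i2 by simp
      also have "\<bar>\<dots>\<bar> \<le> (\<integral>x. \<bar>f x * g x - f x * conv (moll k) g x\<bar> \<partial>lborel)" by (rule integral_abs_bound)
      also have "\<dots> \<le> (\<integral>x. e * \<bar>f x\<bar> \<partial>lborel)"
      proof (rule integral_mono)
        show "integrable lborel (\<lambda>x. \<bar>f x * g x - f x * conv (moll k) g x\<bar>)" using i1 i2 by simp
        show "integrable lborel (\<lambda>x. e * \<bar>f x\<bar>)" using f by simp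
        show "\<bar>f x * g x - f x * conv (moll k) g x\<bar> \<le> e * \<bar>f x\<bar>" for x
        proof -
          have "\<bar>f x * g x - f x * conv (moll k) g x\<bar> = \<bar>f x\<bar> * \<bar>conv (moll k) g x - g x\<bar>"
            by (simp add: abs_mult abs_minus_commute flip: right_diff_distrib)
          also have "\<dots> \<le> \<bar>f x\<bar> * e" using k by (intro mult_left_mono) auto
          finally show ?thesis by (simp add: mult.commute)
        qed
      qed
      finally show ?thesis by simp
    qed
    note le = this
    show ?thesis
    proof (rule ccontr)
      define I where "I = (\<integral>x. \<bar>f x\<bar> \<partial>lborel)"
      have I: "I \<ge> 0" by (simp add: I_def)
      assume "(\<integral>x. f x * g x \<partial>lborel) \<noteq> 0"
      then have p: "\<bar>\<integral>x. f x * g x \<partial>lborel\<bar> > 0" by simp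
      \<comment> \<open>The bound \<open>le\<close> with \<open>e\<close> equal to the left side
        over \<open>I + 1\<close>; the ratio \<open>I / (I + 1)\<close> is less than 1, which is
        absurd.\<close>
      have "\<bar>\<integral>x. f x * g x \<partial>lborel\<bar> \<le> (\<bar>\<integral>x. f x * g x \<partial>lborel\<bar> / (I + 1)) * I"
        using le[of "\<bar>\<integral>x. f x * g x \<partial>lborel\<bar> / (I + 1)"] p I unfolding I_def by simp
      also have "\<dots> < \<bar>\<integral>x. f x * g x \<partial>lborel\<bar>" using p I by (simp add: divide_simps)
      finally show False by simp
    qed
  qed
  obtain h where h: "\<forall>n. continuous_on UNIV (h n)" "\<forall>n x. \<bar>h n x\<bar> \<le> 1"
    "\<forall>n x. norm x > real n + 1 \<longrightarrow> h n x = 0" "AE x in lborel. (\<lambda>n. h n x) \<longlonglongrightarrow> sgn (f x)"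
    using bounded_continuous_approx[of "\<lambda>x. sgn (f x)" 1] by (auto simp: abs_sgn_eq)
  have [measurable]: "h n \<in> borel_measurable borel" for n using h(1) borel_measurable_continuous_onI by blast
  have "(\<lambda>n. \<integral>x. f x * h n x \<partial>lborel) \<longlonglongrightarrow> (\<integral>x. f x * sgn (f x) \<partial>lborel)"
  proof (rule integral_dominated_convergence[where w="\<lambda>x. \<bar>f x\<bar>"])
    show "AE x in lborel. (\<lambda>n. f x * h n x) \<longlonglongrightarrow> f x * sgn (f x)"
      using h(4) by eventually_elim (intro tendsto_intros)
    show "AE x in lborel. norm (f x * h n x) \<le> \<bar>f x\<bar>" for n
      using h(2) by (simp add: abs_mult mult_left_le)
  qed (use f in auto)
  moreover have "(\<integral>x. f x * h n x \<partial>lborel) = 0" for n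
    by (rule c[of "h n" "real n + 1"]) (use h in auto)
  ultimately have "(\<integral>x. f x * sgn (f x) \<partial>lborel) = 0" by (simp add: LIMSEQ_const_iff)
  then have "(\<integral>x. \<bar>f x\<bar> \<partial>lborel) = 0" by (simp add: abs_sgn mult.commute)
  then show ?thesis
    using integral_nonneg_eq_0_iff_AE[of lborel "\<lambda>x. \<bar>f x\<bar>"] f by simp
qed

text \<open>Mollifies the indicator of the closed \<open>e / 2\<close>-neighbourhood of
  \<open>K\<close> at radius \<open>e / 4\<close>. The value 1 is attained on an open set around
  \<open>K\<close>, so that the derivatives of \<open>\<zeta>\<close> vanish there too; the
  localisation of the equation depends on this.\<close>

lemma smooth_cutoff:
  fixes K :: "'b::euclidean_space set"
  assumes K: "compact K" and U: "open U" "K \<subseteq> U"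
  shows "\<exists>\<zeta>\<in>test_functions U. (\<forall>x. 0 \<le> \<zeta> x \<and> \<zeta> x \<le> 1) \<and> (\<exists>V. open V \<and> K \<subseteq> V \<and> (\<forall>x\<in>V. \<zeta> x = 1))"
proof (cases "K = {}")
  case True
  have "(\<lambda>x. 0) \<in> test_functions U" by (rule test_functionsI[where K="{}"]) auto
  then show ?thesis using True by (intro bexI[of _ "\<lambda>x. 0"]) auto
next
  case False
  obtain e where e: "e > 0" "{x. infdist x K \<le> e} \<subseteq> U"
    using compact_in_open_separated[OF False K U] by blast
  define A where "A = {x. infdist x K \<le> e / 2}"
  have cA: "compact A" unfolding A_def by (rule compact_infdist_le[OF False K]) (use e in simp)
  obtain R where R: "\<forall>x\<in>A. norm x \<le> R" using compact_imp_bounded[OF cA] bounded_iff by blast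
  define f where "f = (indicator A :: 'b \<Rightarrow> real)"
  have [measurable]: "A \<in> sets borel" using cA compact_imp_closed borel_closed by blast
  have fi: "integrable lborel f"
    unfolding f_def by (rule integrable_real_indicator) (use emeasure_bounded_finite[OF compact_imp_bounded[OF cA]] in auto)
  define d where "d = e / 4"
  have d: "d > 0" using e by (simp add: d_def)
  define \<zeta> where "\<zeta> = conv (mollifier d) f"
  have inf: "infdist x K \<le> infdist y K + norm (x - y)" for x y
    using infdist_triangle[of x K y] by (simp add: dist_norm)
  have sm: "smooth \<zeta>" unfolding \<zeta>_def by (rule smooth_conv[OF mollifier_test[OF d] fi])
  have out: "\<zeta> x = 0" if "x \<notin> {x. infdist x K \<le> e}" for x
    unfolding \<zeta>_def
  proof (rule conv_eq_0[of d])
    show "mollifier d z = 0" if "norm z > d" for z :: 'b by (rule mollifier_props(3)[OF d]) (use that in simp)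
    fix y assume "f y \<noteq> 0"
    then have "infdist y K \<le> e / 2" by (auto simp: f_def A_def indicator_def split: if_splits)
    moreover have "infdist x K > e" using that by simp
    ultimately have "norm (x - y) > e / 2" using inf[of x y] by linarith
    then show "d < norm (x - y)" using e by (simp add: d_def)
  qed
  have "\<zeta> \<in> test_functions U"
    by (rule test_functionsI[OF sm compact_infdist_le[OF False K e(1)] e(2) out])
  moreover have "0 \<le> \<zeta> x \<and> \<zeta> x \<le> 1" for x
  proof -
    have "\<bar>conv (mollifier d) f x - 1/2\<bar> \<le> 1/2"
      by (rule conv_const_bound[OF d fi]) (auto simp: f_def indicator_def)
    then show ?thesis unfolding \<zeta>_def by (simp add: abs_le_iff field_simps)
  qed
  moreover have "\<zeta> x = 1" if "x \<in> {x. infdist x K < e / 4}" for x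
  proof -
    have "\<bar>conv (mollifier d) f x - 1\<bar> \<le> 0"
    proof (rule conv_const_bound[OF d fi])
      fix y assume "norm (x - y) < d"
      then have "infdist y K \<le> e / 2" using inf[of y x] that by (simp add: d_def norm_minus_commute)
      then show "\<bar>f y - 1\<bar> \<le> 0" by (simp add: f_def A_def)
    qed
    then show ?thesis by (simp add: \<zeta>_def)
  qed
  moreover have "open {x. infdist x K < e / 4}"
    by (intro open_Collect_less continuous_on_infdist continuous_on_id continuous_on_const)
  moreover have "K \<subseteq> {x. infdist x K < e / 4}" using e by auto
  ultimately show ?thesis by blast
qed

text \<open>Fubini's theorem, applicable because the kernel is bounded and the product of the two
  integrable functions is integrable on the product space.\<close>

lemma conv_adjoint:
  fixes f \<psi> :: "'b::euclidean_space \<Rightarrow> real"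
  assumes \<rho>: "\<rho> \<in> test_functions UNIV" and f: "integrable lborel f" and p: "integrable lborel \<psi>"
  shows "(\<integral>x. conv \<rho> f x * \<psi> x \<partial>lborel) = (\<integral>y. f y * conv (\<lambda>z. \<rho> (- z)) \<psi> y \<partial>lborel)"
proof -
  note [measurable] = smooth_borel[OF test_functionsD(1)[OF \<rho>]]
    borel_measurable_integrable[OF f, unfolded measurable_lborel1] borel_measurable_integrable[OF p, unfolded measurable_lborel1]
  obtain B where B: "\<forall>z. \<bar>\<rho> z\<bar> \<le> B" using test_functions_bounded[OF \<rho>] by meson
  have "integrable (lborel \<Otimes>\<^sub>M lborel) (\<lambda>(x, y). \<psi> x * f y)"
    by (rule lborel_pair.Fubini_integrable) (use f p in \<open>auto simp: abs_mult\<close>)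
  then have "integrable (lborel \<Otimes>\<^sub>M lborel) (\<lambda>z. (\<lambda>(x, y). \<rho> (x - y)) z * (\<lambda>(x, y). \<psi> x * f y) z)"
    by (rule integrable_bounded_mult[where B=B]) (use B in auto)
  then have int: "integrable (lborel \<Otimes>\<^sub>M lborel) (case_prod (\<lambda>x y. \<rho> (x - y) * (\<psi> x * f y)))"
    by (simp add: case_prod_beta')
  have "(\<integral>x. conv \<rho> f x * \<psi> x \<partial>lborel) = (\<integral>x. (\<integral>y. \<rho> (x - y) * (\<psi> x * f y) \<partial>lborel) \<partial>lborel)"
  proof -
    have "conv \<rho> f x * \<psi> x = (\<integral>y. \<rho> (x - y) * (\<psi> x * f y) \<partial>lborel)" for x
      unfolding conv_def by (subst integral_mult_left_zero[symmetric]) (simp add: mult_ac)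
    then show ?thesis by simp
  qed
  also have "\<dots> = (\<integral>y. (\<integral>x. \<rho> (x - y) * (\<psi> x * f y) \<partial>lborel) \<partial>lborel)"
    by (rule lborel_pair.Fubini_integral[OF int, symmetric])
  also have "\<dots> = (\<integral>y. f y * conv (\<lambda>z. \<rho> (- z)) \<psi> y \<partial>lborel)"
  proof -
    have "f y * conv (\<lambda>z. \<rho> (- z)) \<psi> y = (\<integral>x. \<rho> (x - y) * (\<psi> x * f y) \<partial>lborel)" for y
      unfolding conv_def by (subst integral_mult_right_zero[symmetric]) (simp add: mult_ac)
    then show ?thesis by simp
  qed
  finally show ?thesis .
qed

section \<open>Derivatives on the zero set\<close>

lemma sq_integrable_partial:
  "\<phi> \<in> test_functions U \<Longrightarrow> b \<in> Basis \<Longrightarrow> sq_integrable (partial_deriv b \<phi>)"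
  by (rule test_functions_sq_integrable[OF test_functions_partial])

text \<open>
  Chain rule with \<open>G s = \<delta> arctan (s / \<delta>)\<close>: \<open>G\<close> is small while \<open>G'\<close> equals 1 at 0, so that the
  derivative of \<open>w k\<close> has vanishing mass where the limit of \<open>w k\<close> vanishes.
\<close>

lemma integral_partial_deriv_on_zero_set:
  fixes w :: "nat \<Rightarrow> 'b::euclidean_space \<Rightarrow> real"
  assumes w: "\<And>k. w k \<in> test_functions UNIV" and w0: "sq_integrable w0"
    and lim: "(\<lambda>k. \<integral>x. (w k x - w0 x)\<^sup>2 \<partial>lborel) \<longlonglongrightarrow> 0"
    and b: "b \<in> Basis" and C: "\<And>k. (\<integral>x. (partial_deriv b (w k) x)\<^sup>2 \<partial>lborel) \<le> C"
    and Z: "Z \<in> sets borel" "Z \<subseteq> cball 0 R" "AE x in lborel. x \<in> Z \<longrightarrow> w0 x = 0"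
    and \<phi>: "\<phi> \<in> borel_measurable borel" "\<And>x. \<bar>\<phi> x\<bar> \<le> M"
  shows "(\<lambda>k. \<integral>x. partial_deriv b (w k) x * (indicator Z x * \<phi> x) \<partial>lborel) \<longlonglongrightarrow> 0"
proof (rule LIMSEQ_I)
  fix e :: real assume e: "e > 0"
  note [measurable] = Z(1) \<phi>(1) sq_integrableD(1)[OF w0]
  have M: "M \<ge> 0" using \<phi>(2)[of 0] by linarith
  have "0 \<le> (\<integral>x. (partial_deriv b (w 0) x)\<^sup>2 \<partial>lborel)" by simp
  then have C0: "C \<ge> 0" using C[of 0] by linarith
  define \<psi> where "\<psi> = (\<lambda>x. indicator Z x * \<phi> x)"
  have [measurable]: "\<psi> \<in> borel_measurable borel" unfolding \<psi>_def by measurable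
  have \<psi>0: "\<psi> x = 0" if "norm x > R" for x
    using Z(2) that by (auto simp: \<psi>_def indicator_def)
  have \<psi>M: "\<bar>\<psi> x\<bar> \<le> M" for x using \<phi>(2)[of x] M by (auto simp: \<psi>_def indicator_def)
  have \<psi>: "sq_integrable \<psi>" by (rule sq_integrable_ball[OF _ \<psi>0 \<psi>M]) simp
  \<comment> \<open>Replacing \<open>\<psi>\<close> by the smooth \<open>\<tau>\<close> costs, by
    Cauchy-Schwarz against the derivative bound \<open>C\<close>, less than \<open>e / 4\<close> for
    all \<open>k\<close> at once.\<close>
  have "\<forall>\<^sub>F j in sequentially. (\<integral>x. (conv (moll j) \<psi> x - \<psi> x)\<^sup>2 \<partial>lborel) < (e/4)\<^sup>2 / (C + 1)"
    by (rule order_tendstoD(2)[OF conv_moll_L2[OF \<psi> \<psi>0]]) (use e C0 in auto)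
  then obtain j where j: "(\<integral>x. (conv (moll j) \<psi> x - \<psi> x)\<^sup>2 \<partial>lborel) < (e/4)\<^sup>2 / (C + 1)"
    using eventually_happens' sequentially_bot by blast
  define \<tau> where "\<tau> = conv (moll j) \<psi>"
  have \<tau>: "\<tau> \<in> test_functions UNIV" unfolding \<tau>_def
    by (rule conv_test[OF moll_test sq_integrable_imp_integrable[OF \<psi> \<psi>0] \<psi>0])
  define D where "D = (\<integral>x. \<bar>partial_deriv b \<tau> x\<bar> \<partial>lborel)"
  have D: "D \<ge> 0" by (simp add: D_def)
  \<comment> \<open>Integration by parts will pair \<open>G\<close>, bounded by
    \<open>2 * \<delta>\<close>, with the derivative of \<open>\<tau>\<close>, whose L1 norm is
    \<open>D\<close>; this choice keeps the product below \<open>e / 2\<close>.\<close>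
  define \<delta> where "\<delta> = e / (8 * (D + 1))"
  have \<delta>: "\<delta> > 0" using e D by (simp add: \<delta>_def)
  have \<delta>D: "2 * \<delta> * D < e / 4 + e / 4" using e D by (simp add: \<delta>_def divide_simps)
  define G where "G = (\<lambda>s. \<delta> * arctan (s / \<delta>))"
  define G' where "G' = (\<lambda>s::real. 1 / (1 + (s / \<delta>)\<^sup>2))"
  have Gd: "(G has_real_derivative G' s) (at s)" for s
    unfolding G_def G'_def using \<delta> by (auto intro!: derivative_eq_intros simp: divide_simps)
  have Gb: "\<bar>G s\<bar> \<le> 2 * \<delta>" for s
  proof -
    have "\<bar>arctan (s / \<delta>)\<bar> \<le> 2"
      using arctan_bounded[of "s / \<delta>"] pi_less_4 by (simp add: abs_le_iff)
    then show ?thesis using \<delta> by (simp add: G_def abs_mult)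
  qed
  have G'01: "0 \<le> G' s" "\<bar>G' s\<bar> \<le> 1" for s
  proof -
    have "0 < 1 + (s / \<delta>)\<^sup>2" "1 \<le> 1 + (s / \<delta>)\<^sup>2" by (simp_all add: add_pos_nonneg)
    then show "0 \<le> G' s" "\<bar>G' s\<bar> \<le> 1" unfolding G'_def by (simp_all only: abs_divide abs_of_pos abs_one divide_le_eq_1_pos) simp
  qed
  \<comment> \<open>On \<open>Z\<close> the limit \<open>w0\<close> vanishes, so there
    \<open>1 - G' (w k x)\<close> is at most \<open>\<bar>w k x - w0 x\<bar> / \<delta>\<close>,
    which tends to 0 in L2.\<close>
  have G'1: "\<bar>1 - G' s\<bar> \<le> \<bar>s\<bar> / \<delta>" for s
  proof -
    define y where "y = s / \<delta>"
    have y: "1 + y\<^sup>2 > 0" by (simp add: add_pos_nonneg)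
    have "2 * \<bar>y\<bar> \<le> 1 + y\<^sup>2" using sum_squares_bound[of 1 "\<bar>y\<bar>"] by simp
    then have "\<bar>y\<bar> * \<bar>y\<bar> \<le> \<bar>y\<bar> * (1 + y\<^sup>2)" by (intro mult_left_mono) linarith+
    then have "y\<^sup>2 / (1 + y\<^sup>2) \<le> \<bar>y\<bar>" using y by (simp add: pos_divide_le_eq power2_eq_square)
    moreover have "1 - G' s = y\<^sup>2 / (1 + y\<^sup>2)" unfolding G'_def y_def[symmetric] using y by (simp add: field_simps)
    ultimately show ?thesis using y \<delta> by (simp add: y_def)
  qed
  have contG: "continuous_on UNIV G" unfolding G_def using \<delta> by (intro continuous_intros) auto
  have contG': "continuous_on UNIV G'" unfolding G'_def using \<delta>
    by (intro continuous_intros) (auto simp: add_nonneg_eq_0_iff)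
  have [measurable]: "G \<in> borel_measurable borel" "G' \<in> borel_measurable borel"
    using contG contG' borel_measurable_continuous_onI by blast+
  note \<tau>s = test_functionsD(1)[OF \<tau>]
  have [measurable]: "\<tau> \<in> borel_measurable borel" by (rule smooth_borel[OF \<tau>s])
  have sq\<tau>: "sq_integrable \<tau>" by (rule test_functions_sq_integrable[OF \<tau>])
  obtain R' where R': "\<forall>z. norm z > R' \<longrightarrow> \<tau> z = 0" using test_functions_ball[OF \<tau>] by meson
  \<comment> \<open>The integrand is split by \<open>1 = (1 - G') + G'\<close> and
    \<open>\<psi> = (\<psi> - \<tau>) + \<tau>\<close>. The parts \<open>I2\<close> and
    \<open>I3\<close> are small uniformly in \<open>k\<close> by the choices of \<open>j\<close> and
    \<open>\<delta>\<close>; only \<open>I1\<close> needs \<open>k\<close> to be large.\<close>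
  define I1 where "I1 = (\<lambda>k. \<integral>x. partial_deriv b (w k) x * ((1 - G' (w k x)) * \<psi> x) \<partial>lborel)"
  have bound: "norm ((\<integral>x. partial_deriv b (w k) x * \<psi> x \<partial>lborel) - I1 k) < e / 4 + (e / 4 + e / 4)" for k
  proof -
    note ws = test_functionsD(1)[OF w[of k]]
    have [measurable]: "w k \<in> borel_measurable borel" by (rule smooth_borel[OF ws])
    have wc: "continuous_on UNIV (w k)" by (rule smooth_continuous[OF ws])
    have dw: "sq_integrable (partial_deriv b (w k))" by (rule sq_integrable_partial[OF w b])
    define I2 where "I2 = (\<integral>x. partial_deriv b (w k) x * (G' (w k x) * (\<psi> x - \<tau> x)) \<partial>lborel)"
    define I3 where "I3 = (\<integral>x. partial_deriv b (w k) x * (G' (w k x) * \<tau> x) \<partial>lborel)"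
    have s1: "sq_integrable (\<lambda>x. (1 - G' (w k x)) * \<psi> x)"
    proof (rule sq_integrable_bounded_mult[OF \<psi>])
      show "\<bar>1 - G' (w k x)\<bar> \<le> 1" for x using G'01[of "w k x"] by linarith
    qed measurable
    have s2: "sq_integrable (\<lambda>x. G' (w k x) * (\<psi> x - \<tau> x))"
      by (rule sq_integrable_bounded_mult[OF sq_integrable_diff[OF \<psi> sq\<tau>] _ G'01(2)]) measurable
    have s3: "sq_integrable (\<lambda>x. G' (w k x) * \<tau> x)"
      by (rule sq_integrable_bounded_mult[OF sq\<tau> _ G'01(2)]) measurable
    note i = sq_integrable_mult[OF dw s1] sq_integrable_mult[OF dw s2] sq_integrable_mult[OF dw s3]
    have "(\<integral>x. partial_deriv b (w k) x * \<psi> x \<partial>lborel) =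
      (\<integral>x. partial_deriv b (w k) x * ((1 - G' (w k x)) * \<psi> x) + partial_deriv b (w k) x * (G' (w k x) * (\<psi> x - \<tau> x))
        + partial_deriv b (w k) x * (G' (w k x) * \<tau> x) \<partial>lborel)"
      by (rule arg_cong[where f="integral\<^sup>L lborel"]) (simp add: fun_eq_iff algebra_simps)
    also have "\<dots> = I1 k + I2 + I3"
      using i by (simp add: I1_def I2_def I3_def)
    finally have eq: "(\<integral>x. partial_deriv b (w k) x * \<psi> x \<partial>lborel) = I1 k + I2 + I3" .
    have "I2\<^sup>2 \<le> (\<integral>x. (partial_deriv b (w k) x)\<^sup>2 \<partial>lborel) * (\<integral>x. (G' (w k x) * (\<psi> x - \<tau> x))\<^sup>2 \<partial>lborel)"
      unfolding I2_def by (rule Cauchy_Schwarz_integral[OF dw s2])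
    also have "\<dots> \<le> C * (\<integral>x. (\<tau> x - \<psi> x)\<^sup>2 \<partial>lborel)"
    proof (rule mult_mono[OF C _ C0])
      show "(\<integral>x. (G' (w k x) * (\<psi> x - \<tau> x))\<^sup>2 \<partial>lborel) \<le> (\<integral>x. (\<tau> x - \<psi> x)\<^sup>2 \<partial>lborel)"
      proof (rule integral_mono[OF sq_integrableD(2)[OF s2] sq_integrableD(2)[OF sq_integrable_diff[OF sq\<tau> \<psi>]]])
        fix x
        have "\<bar>G' (w k x)\<bar> * \<bar>\<psi> x - \<tau> x\<bar> \<le> 1 * \<bar>\<psi> x - \<tau> x\<bar>"
          by (rule mult_right_mono[OF G'01(2)]) simp
        then have "\<bar>G' (w k x) * (\<psi> x - \<tau> x)\<bar> \<le> \<bar>\<tau> x - \<psi> x\<bar>"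
          by (simp add: abs_mult abs_minus_commute)
        then show "(G' (w k x) * (\<psi> x - \<tau> x))\<^sup>2 \<le> (\<tau> x - \<psi> x)\<^sup>2" by (simp only: abs_le_square_iff)
      qed
    qed simp
    also have "\<dots> \<le> (C + 1) * (\<integral>x. (\<tau> x - \<psi> x)\<^sup>2 \<partial>lborel)"
      by (intro mult_right_mono) auto
    also have "\<dots> < (e/4)\<^sup>2"
      using j C0 by (simp add: \<tau>_def pos_less_divide_eq mult.commute)
    finally have I2: "\<bar>I2\<bar> < e / 4" using e abs_le_square_iff[of "e/4" I2] by (simp add: not_le[symmetric])
    \<comment> \<open>\<open>G' (w k x)\<close> times the derivative of \<open>w k\<close> is the
      derivative of \<open>G (w k x)\<close>. The product with \<open>\<tau>\<close> has compact
      support, so the derivative can be moved to \<open>\<tau>\<close>.\<close>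
    let ?f = "\<lambda>x. G (w k x) * \<tau> x"
    have wd: "w k differentiable (at z)" for z by (rule smooth_differentiable[OF ws])
    have \<tau>d: "\<tau> differentiable (at z)" for z by (rule smooth_differentiable[OF \<tau>s])
    have Gwd: "(\<lambda>z. G (w k z)) differentiable (at z)" for z
      using has_derivative_compose[OF has_derivative_partial[OF wd] Gd[unfolded has_field_derivative_def]]
        differentiable_def by blast
    have peq: "partial_deriv b ?f = (\<lambda>z. partial_deriv b (w k) z * (G' (w k z) * \<tau> z) + G (w k z) * partial_deriv b \<tau> z)"
    proof
      fix z
      have "partial_deriv b ?f z = partial_deriv b (\<lambda>z. G (w k z)) z * \<tau> z + G (w k z) * partial_deriv b \<tau> z"
        by (rule partial_deriv_mult[OF Gwd \<tau>d])
      also have "partial_deriv b (\<lambda>z. G (w k z)) z = G' (w k z) * partial_deriv b (w k) z"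
        by (rule partial_deriv_chain[OF wd Gd])
      finally show "partial_deriv b ?f z = partial_deriv b (w k) z * (G' (w k z) * \<tau> z) + G (w k z) * partial_deriv b \<tau> z"
        by (simp add: algebra_simps)
    qed
    have "(\<integral>z. partial_deriv b ?f z \<partial>lborel) = 0"
    proof (rule integral_partial_deriv_eq_0(2)[where R=R'])
      show "?f differentiable at z" for z by (rule differentiable_mult[OF Gwd \<tau>d])
      show "continuous_on UNIV (partial_deriv b ?f)" unfolding peq
        by (intro continuous_intros smooth_continuous[OF smooth_partial[OF ws b]]
            smooth_continuous[OF smooth_partial[OF \<tau>s b]] smooth_continuous[OF \<tau>s]
            continuous_on_compose2[OF contG wc] continuous_on_compose2[OF contG' wc]) auto
      show "?f z = 0" if "norm z > R'" for z using R' that by simp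
    qed
    moreover have iG: "integrable lborel (\<lambda>z. G (w k z) * partial_deriv b \<tau> z)"
      by (rule integrable_bounded_mult[OF test_functions_integrable[OF test_functions_partial[OF \<tau> b]] _ Gb]) measurable
    ultimately have "I3 = - (\<integral>z. G (w k z) * partial_deriv b \<tau> z \<partial>lborel)"
      using i(3) unfolding peq I3_def by simp
    then have "\<bar>I3\<bar> \<le> (\<integral>z. \<bar>G (w k z) * partial_deriv b \<tau> z\<bar> \<partial>lborel)"
      using integral_abs_bound[of lborel "\<lambda>z. G (w k z) * partial_deriv b \<tau> z"] by simp
    also have "\<dots> \<le> (\<integral>z. (2 * \<delta>) * \<bar>partial_deriv b \<tau> z\<bar> \<partial>lborel)"
    proof (rule integral_mono)
      show "integrable lborel (\<lambda>z. \<bar>G (w k z) * partial_deriv b \<tau> z\<bar>)" using iG by simp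
      show "integrable lborel (\<lambda>z. (2 * \<delta>) * \<bar>partial_deriv b \<tau> z\<bar>)"
        using test_functions_integrable[OF test_functions_partial[OF \<tau> b]] by simp
      show "\<bar>G (w k z) * partial_deriv b \<tau> z\<bar> \<le> (2 * \<delta>) * \<bar>partial_deriv b \<tau> z\<bar>" for z
        unfolding abs_mult by (rule mult_right_mono[OF Gb]) simp
    qed
    also have "\<dots> = 2 * \<delta> * D" by (simp add: D_def)
    finally have "\<bar>I3\<bar> < e / 4 + e / 4" using \<delta>D by linarith
    then show ?thesis unfolding eq real_norm_def using I2 by linarith
  qed
  have "I1 \<longlonglongrightarrow> 0"
  proof (rule tendsto_0_of_square_le)
    fix k
    have ws: "smooth (w k)" by (rule test_functionsD(1)[OF w])
    have [measurable]: "w k \<in> borel_measurable borel" by (rule smooth_borel[OF ws])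
    have dw: "sq_integrable (partial_deriv b (w k))" by (rule sq_integrable_partial[OF w b])
    have sqw: "sq_integrable (\<lambda>x. w k x - w0 x)"
      by (rule sq_integrable_diff[OF test_functions_sq_integrable[OF w] w0])
    have s1: "sq_integrable (\<lambda>x. (1 - G' (w k x)) * \<psi> x)"
    proof (rule sq_integrable_bounded_mult[OF \<psi>])
      show "\<bar>1 - G' (w k x)\<bar> \<le> 1" for x using G'01[of "w k x"] by linarith
    qed measurable
    have "(I1 k)\<^sup>2 \<le> (\<integral>x. (partial_deriv b (w k) x)\<^sup>2 \<partial>lborel) * (\<integral>x. ((1 - G' (w k x)) * \<psi> x)\<^sup>2 \<partial>lborel)"
      unfolding I1_def by (rule Cauchy_Schwarz_integral[OF dw s1])
    also have "\<dots> \<le> C * ((M / \<delta>)\<^sup>2 * (\<integral>x. (w k x - w0 x)\<^sup>2 \<partial>lborel))"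
    proof (rule mult_mono[OF C _ C0])
      have "(\<integral>x. ((1 - G' (w k x)) * \<psi> x)\<^sup>2 \<partial>lborel) \<le> (\<integral>x. (M / \<delta>)\<^sup>2 * (w k x - w0 x)\<^sup>2 \<partial>lborel)"
      proof (rule integral_mono_AE[OF sq_integrableD(2)[OF s1]])
        show "integrable lborel (\<lambda>x. (M / \<delta>)\<^sup>2 * (w k x - w0 x)\<^sup>2)"
          by (rule integrable_mult_right[OF sq_integrableD(2)[OF sqw]])
        show "AE x in lborel. ((1 - G' (w k x)) * \<psi> x)\<^sup>2 \<le> (M / \<delta>)\<^sup>2 * (w k x - w0 x)\<^sup>2"
          using Z(3)
        proof eventually_elim
          case (elim x)
          have "\<bar>(1 - G' (w k x)) * \<psi> x\<bar> \<le> \<bar>(M / \<delta>) * (w k x - w0 x)\<bar>"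
          proof (cases "x \<in> Z")
            case True
            then have "w0 x = 0" using elim by simp
            have "\<bar>1 - G' (w k x)\<bar> * \<bar>\<psi> x\<bar> \<le> (\<bar>w k x\<bar> / \<delta>) * M"
              by (rule mult_mono[OF G'1 \<psi>M]) (use \<delta> in auto)
            then show ?thesis using \<delta> M \<open>w0 x = 0\<close> by (simp add: abs_mult mult.commute)
          next
            case False
            then show ?thesis by (simp add: \<psi>_def)
          qed
          then have "((1 - G' (w k x)) * \<psi> x)\<^sup>2 \<le> ((M / \<delta>) * (w k x - w0 x))\<^sup>2" by (simp only: abs_le_square_iff)
          then show ?case unfolding power_mult_distrib[of "M / \<delta>"] .
        qed
      qed
      then show "(\<integral>x. ((1 - G' (w k x)) * \<psi> x)\<^sup>2 \<partial>lborel) \<le> (M / \<delta>)\<^sup>2 * (\<integral>x. (w k x - w0 x)\<^sup>2 \<partial>lborel)"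
        by simp
    qed simp
    finally show "(I1 k)\<^sup>2 \<le> C * ((M / \<delta>)\<^sup>2 * (\<integral>x. (w k x - w0 x)\<^sup>2 \<partial>lborel))" .
  next
    show "(\<lambda>k. C * ((M / \<delta>)\<^sup>2 * (\<integral>x. (w k x - w0 x)\<^sup>2 \<partial>lborel))) \<longlonglongrightarrow> 0"
      using tendsto_mult_left[OF tendsto_mult_left[OF lim]] by simp
  qed
  then have "\<forall>\<^sub>F k in sequentially. norm (I1 k) < e / 4"
    using e by (intro order_tendstoD(2)[where y=0] tendsto_norm_zero) auto
  then obtain N where N: "\<forall>k\<ge>N. norm (I1 k) < e / 4" by (auto simp: eventually_sequentially)
  have "norm ((\<integral>x. partial_deriv b (w k) x * (indicator Z x * \<phi> x) \<partial>lborel) - 0) < e" if "k \<ge> N" for k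
  proof -
    have "norm (I1 k) < e / 4" using N that by blast
    then show ?thesis using bound[of k] unfolding \<psi>_def real_norm_def by linarith
  qed
  then show "\<exists>N. \<forall>k\<ge>N. norm ((\<integral>x. partial_deriv b (w k) x * (indicator Z x * \<phi> x) \<partial>lborel) - 0) < e" by blast
qed

text \<open>Computed because the right-hand side is visibly symmetric in \<open>a\<close> and
  \<open>b\<close>. This is how mixed second derivatives are shown to commute, first for the kernel
  and then for everything that is mollified by it.\<close>

lemma partial_deriv_partial_deriv_mollifier:
  fixes z :: "'b::euclidean_space"
  shows
  "partial_deriv a (partial_deriv b (mollifier d)) z =
    (4 * (z \<bullet> b) * (z \<bullet> a) * (flat_exp 4 (d\<^sup>2 - z \<bullet> z) - 2 * flat_exp 3 (d\<^sup>2 - z \<bullet> z))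
      - 2 * (a \<bullet> b) * flat_exp 2 (d\<^sup>2 - z \<bullet> z)) / (\<integral>y. flat_exp 0 (d\<^sup>2 - y \<bullet> y) \<partial>(lborel :: 'b measure))"
proof -
  let ?N = "\<integral>y. flat_exp 0 (d\<^sup>2 - y \<bullet> y) \<partial>(lborel :: 'b measure)"
  have q: "((\<lambda>z. d\<^sup>2 - z \<bullet> z) has_derivative (\<lambda>h. - 2 * (z \<bullet> h))) (at z)" for z :: 'b
    by (auto intro!: derivative_eq_intros simp: inner_commute)
  have F: "((\<lambda>z::'b. flat_exp k (d\<^sup>2 - z \<bullet> z)) has_derivative
      (\<lambda>h. (flat_exp (k+2) (d\<^sup>2 - z \<bullet> z) - real k * flat_exp (k+1) (d\<^sup>2 - z \<bullet> z)) * (- 2 * (z \<bullet> h)))) (at z)" for k z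
    using has_derivative_compose[OF q flat_exp_deriv[unfolded has_field_derivative_def]] by simp
  have 1: "partial_deriv b (mollifier d) z = - 2 * (z \<bullet> b) * flat_exp 2 (d\<^sup>2 - z \<bullet> z) / ?N" for z :: 'b
  proof (rule partial_deriv_eq[THEN trans])
    show "(mollifier d has_derivative (\<lambda>h. (flat_exp 2 (d\<^sup>2 - z \<bullet> z) * (- 2 * (z \<bullet> h))) * inverse ?N)) (at z)"
      unfolding mollifier_def divide_inverse
      by (rule has_derivative_mult_left) (use F[of 0 z] in \<open>simp add: numeral_2_eq_2\<close>)
  qed (simp add: divide_inverse)
  have eq: "partial_deriv b (mollifier d) = (\<lambda>z. ((- 2 * (z \<bullet> b)) * flat_exp 2 (d\<^sup>2 - z \<bullet> z)) * inverse ?N)"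
    by (rule ext) (simp add: 1 divide_inverse)
  have l: "((\<lambda>z. - 2 * (z \<bullet> b)) has_derivative (\<lambda>h. - 2 * (h \<bullet> b))) (at z)" for z :: 'b
    by (auto intro!: derivative_eq_intros)
  have "(partial_deriv b (mollifier d) has_derivative
     (\<lambda>h. ((- 2 * (z \<bullet> b)) * ((flat_exp (2+2) (d\<^sup>2 - z \<bullet> z) - real 2 * flat_exp (2+1) (d\<^sup>2 - z \<bullet> z)) * (- 2 * (z \<bullet> h)))
        + (- 2 * (h \<bullet> b)) * flat_exp 2 (d\<^sup>2 - z \<bullet> z)) * inverse ?N)) (at z)"
    unfolding eq by (rule has_derivative_mult_left[OF has_derivative_mult[OF l F]])
  moreover have "(2::nat) + 2 = 4" "(2::nat) + 1 = 3" by simp_all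
  ultimately have "(partial_deriv b (mollifier d) has_derivative
     (\<lambda>h. ((- 2 * (z \<bullet> b)) * ((flat_exp 4 (d\<^sup>2 - z \<bullet> z) - 2 * flat_exp 3 (d\<^sup>2 - z \<bullet> z)) * (- 2 * (z \<bullet> h)))
        + (- 2 * (h \<bullet> b)) * flat_exp 2 (d\<^sup>2 - z \<bullet> z)) * inverse ?N)) (at z)"
    by (simp only: of_nat_numeral)
  from partial_deriv_eq[OF this, of a] show "partial_deriv a (partial_deriv b (mollifier d)) z =
    (4 * (z \<bullet> b) * (z \<bullet> a) * (flat_exp 4 (d\<^sup>2 - z \<bullet> z) - 2 * flat_exp 3 (d\<^sup>2 - z \<bullet> z))
      - 2 * (a \<bullet> b) * flat_exp 2 (d\<^sup>2 - z \<bullet> z)) / ?N"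
    by (simp add: divide_inverse algebra_simps)
qed

lemma mollifier_partials_commute:
  "partial_deriv a (partial_deriv b (mollifier d)) = partial_deriv b (partial_deriv a (mollifier d))"
  by (rule ext) (simp add: partial_deriv_partial_deriv_mollifier inner_commute mult_ac)

text \<open>Both derivatives fall on the kernel, whose Hessian is symmetric.\<close>

lemma conv_moll_partials_commute:
  assumes d: "d > 0" and f: "integrable lborel f" and a: "a \<in> Basis" and b: "b \<in> Basis"
  shows "partial_deriv a (partial_deriv b (conv (mollifier d) f)) = partial_deriv b (partial_deriv a (conv (mollifier d) f))"
proof -
  note t = mollifier_test[OF d]
  show ?thesis
    unfolding partial_deriv_conv[OF t f a] partial_deriv_conv[OF t f b]
      partial_deriv_conv[OF test_functions_partial[OF t b] f a] partial_deriv_conv[OF test_functions_partial[OF t a] f b]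
      mollifier_partials_commute[of a b] ..
qed

section \<open>Second derivatives on the zero set\<close>

text \<open>Two integrations by parts exchange one derivative between the factors. They meet third
  derivatives in the order b, a, a, to be rearranged as a, b, a. Commutation is available for
  mollified functions, and \<open>partial_deriv a V\<close> is one of them: it is the mollification
  of the weak derivative \<open>g\<close>.\<close>

lemma conv_mollifier_H2_identity:
  fixes v :: "'b::euclidean_space \<Rightarrow> real"
  assumes d: "d > 0" and v: "integrable lborel v" and out: "\<And>x. norm x > R \<Longrightarrow> v x = 0"
    and a: "a \<in> Basis" and b: "b \<in> Basis" and g: "integrable lborel g"
    and weak: "\<And>\<phi>. \<phi> \<in> test_functions UNIV \<Longrightarrow>
      (\<integral>x. v x * partial_deriv a \<phi> x \<partial>lborel) = - (\<integral>x. g x * \<phi> x \<partial>lborel)"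
  defines "V \<equiv> conv (mollifier d) v"
  shows "(\<integral>x. partial_deriv b (partial_deriv b V) x * partial_deriv a (partial_deriv a V) x \<partial>lborel)
    = (\<integral>x. (partial_deriv a (partial_deriv b V) x)\<^sup>2 \<partial>lborel)"
proof -
  have tV: "V \<in> test_functions UNIV"
    unfolding V_def by (rule conv_test[OF mollifier_test[OF d] v out])
  note ta = test_functions_partial[OF tV a] and tb = test_functions_partial[OF tV b]
  have com: "partial_deriv a (partial_deriv b V) = partial_deriv b (partial_deriv a V)"
    unfolding V_def by (rule conv_moll_partials_commute[OF d v a b])
  have eq: "partial_deriv a V = conv (mollifier d) g"
    unfolding V_def partial_deriv_conv[OF mollifier_test[OF d] v a]
    by (rule conv_weak_deriv[OF mollifier_test[OF d] a weak])
  have com3: "partial_deriv b (partial_deriv a (partial_deriv a V)) = partial_deriv a (partial_deriv b (partial_deriv a V))"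
    unfolding eq by (rule conv_moll_partials_commute[OF d g b a])
  have "(\<integral>x. partial_deriv b (partial_deriv b V) x * partial_deriv a (partial_deriv a V) x \<partial>lborel)
    = - (\<integral>x. partial_deriv b V x * partial_deriv b (partial_deriv a (partial_deriv a V)) x \<partial>lborel)"
    using integral_by_parts[OF test_functionsD(1)[OF tb] test_functions_partial[OF ta a] b] by simp
  also have "\<dots> = - (\<integral>x. partial_deriv b V x * partial_deriv a (partial_deriv b (partial_deriv a V)) x \<partial>lborel)"
    unfolding com3 ..
  also have "\<dots> = (\<integral>x. partial_deriv a (partial_deriv b V) x * partial_deriv b (partial_deriv a V) x \<partial>lborel)"
    using integral_by_parts[OF test_functionsD(1)[OF tb] test_functions_partial[OF ta b] a] by simp
  finally show ?thesis unfolding com by (simp add: power2_eq_square)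
qed

lemma smooth_even_partial_odd:
  assumes "smooth f" "\<And>z. f (- z) = f z"
  shows "partial_deriv b f (- z) = - partial_deriv b f z"
  using partial_deriv_reflect[OF assms(1), of b 0 z] assms(2) by (simp add: fun_eq_iff)

text \<open>The weak residual of the equation -(sum of \<open>c b\<close> times the second
  derivative of \<open>v\<close> along \<open>b\<close>) = \<open>h\<close> is dominated by
  \<open>C0\<close> times the indicator of \<open>Z\<close>, a bounded set of zeros of
  \<open>v\<close>. Supports are bounded so that mollification on the whole space applies. The
  instance is a cutoff of the minimizer.\<close>

locale zero_set_regularity =
  fixes v h :: "'b::euclidean_space \<Rightarrow> real" and g :: "'b \<Rightarrow> 'b \<Rightarrow> real" and c :: "'b \<Rightarrow> real"
    and Z :: "'b set" and R C0 :: real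
  assumes v: "sq_integrable v" and h: "sq_integrable h" and g: "\<And>b. b \<in> Basis \<Longrightarrow> sq_integrable (g b)"
    and v_out: "\<And>x. norm x > R \<Longrightarrow> v x = 0" and h_out: "\<And>x. norm x > R \<Longrightarrow> h x = 0"
    and g_out: "\<And>b x. b \<in> Basis \<Longrightarrow> norm x > R \<Longrightarrow> g b x = 0"
    and weak: "\<And>b \<phi>. b \<in> Basis \<Longrightarrow> \<phi> \<in> test_functions UNIV \<Longrightarrow>
      (\<integral>x. v x * partial_deriv b \<phi> x \<partial>lborel) = - (\<integral>x. g b x * \<phi> x \<partial>lborel)"
    and c: "\<And>b. b \<in> Basis \<Longrightarrow> c b > 0"
    and Z[measurable]: "Z \<in> sets borel" and Z_ball: "Z \<subseteq> cball 0 R" and v_Z: "\<And>x. x \<in> Z \<Longrightarrow> v x = 0"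
    and C0: "C0 \<ge> 0"
    and residual: "\<And>\<phi>. \<phi> \<in> test_functions UNIV \<Longrightarrow>
      \<bar>(\<Sum>b\<in>Basis. c b * (\<integral>x. g b x * partial_deriv b \<phi> x \<partial>lborel)) - (\<integral>x. h x * \<phi> x \<partial>lborel)\<bar>
        \<le> C0 * (\<integral>x. indicator Z x * \<bar>\<phi> x\<bar> \<partial>lborel)"
begin

text \<open>The residual of that equation as a functional on test functions.\<close>

definition M :: "('b \<Rightarrow> real) \<Rightarrow> real" where
  "M \<phi> = (\<Sum>b\<in>Basis. c b * (\<integral>x. g b x * partial_deriv b \<phi> x \<partial>lborel)) - (\<integral>x. h x * \<phi> x \<partial>lborel)"

lemma v_int: "integrable lborel v" by (rule sq_integrable_imp_integrable[OF v v_out])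
lemma h_int: "integrable lborel h" by (rule sq_integrable_imp_integrable[OF h h_out])
lemma g_int: "b \<in> Basis \<Longrightarrow> integrable lborel (g b)" by (rule sq_integrable_imp_integrable[OF g g_out])

definition vk :: "nat \<Rightarrow> 'b \<Rightarrow> real" where "vk k = conv (moll k) v"

lemma vk_test: "vk k \<in> test_functions UNIV"
  unfolding vk_def by (rule conv_test[OF moll_test v_int v_out])

lemma partial_vk: "b \<in> Basis \<Longrightarrow> partial_deriv b (vk k) = conv (moll k) (g b)"
  unfolding vk_def by (simp only: partial_deriv_conv[OF moll_test v_int] conv_weak_deriv[OF moll_test _ weak])

lemma partial2_vk: "b \<in> Basis \<Longrightarrow> partial_deriv b (partial_deriv b (vk k)) = conv (partial_deriv b (moll k)) (g b)"
  by (simp only: partial_vk partial_deriv_conv[OF moll_test g_int])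

lemma sq_Z: "sq_integrable (indicator Z :: 'b \<Rightarrow> real)"
  by (rule sq_integrable_indicator[OF Z Z_ball])

text \<open>Stampacchia's lemma. The derivatives of the mollifications converge to
  \<open>g b\<close> in L2 but have no mass on \<open>Z\<close> in the limit; testing with the sign
  of \<open>g b\<close> shows that the integral of its absolute value over \<open>Z\<close> is
  0.\<close>

lemma g_zero_AE:
  assumes b: "b \<in> Basis"
  shows "AE x in lborel. x \<in> Z \<longrightarrow> g b x = 0"
proof -
  note [measurable] = sq_integrableD(1)[OF g[OF b]]
  define s where "s = (\<lambda>x. sgn (g b x))"
  have [measurable]: "s \<in> borel_measurable borel" unfolding s_def by measurable
  have s1: "\<bar>s x\<bar> \<le> 1" for x by (simp add: s_def abs_sgn_eq)
  have sq: "sq_integrable (\<lambda>x. indicator Z x * s x)"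
    using sq_integrable_bounded_mult[OF sq_Z \<open>s \<in> borel_measurable borel\<close> s1] by (simp add: mult.commute)
  have kd: "inverse (real (Suc k)) > 0" for k by simp
  have "(\<lambda>k. \<integral>x. partial_deriv b (vk k) x * (indicator Z x * s x) \<partial>lborel) \<longlonglongrightarrow> 0"
  proof (rule integral_partial_deriv_on_zero_set[OF vk_test v _ b _ Z Z_ball])
    show "(\<lambda>k. \<integral>x. (vk k x - v x)\<^sup>2 \<partial>lborel) \<longlonglongrightarrow> 0"
      unfolding vk_def by (rule conv_moll_L2[OF v v_out])
    show "(\<integral>x. (partial_deriv b (vk k) x)\<^sup>2 \<partial>lborel) \<le> (\<integral>x. (g b x)\<^sup>2 \<partial>lborel)" for k
      unfolding partial_vk[OF b] by (rule conv_contraction(2)[OF kd g_int[OF b] g[OF b]])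
    show "\<bar>s x\<bar> \<le> 1" for x by (rule s1)
  qed (use v_Z in auto)
  moreover have "(\<lambda>k. \<integral>x. partial_deriv b (vk k) x * (indicator Z x * s x) \<partial>lborel)
      \<longlonglongrightarrow> (\<integral>x. g b x * (indicator Z x * s x) \<partial>lborel)"
    unfolding partial_vk[OF b]
    by (rule L2_tendsto_integral_mult[OF conv_contraction(1)[OF kd g_int[OF b] g[OF b]] g[OF b] sq
          conv_moll_L2[OF g[OF b] g_out[OF b]]])
  ultimately have "(\<integral>x. g b x * (indicator Z x * s x) \<partial>lborel) = 0" using LIMSEQ_unique by blast
  then have "(\<integral>x. indicator Z x * \<bar>g b x\<bar> \<partial>lborel) = 0"
    by (simp add: s_def mult_ac abs_sgn)
  moreover have "integrable lborel (\<lambda>x. indicator Z x * \<bar>g b x\<bar>)"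
    by (rule integrable_bounded_mult[where B=1]) (use g_int[OF b] in \<open>auto simp: indicator_def\<close>)
  ultimately have "AE x in lborel. indicator Z x * \<bar>g b x\<bar> = 0"
    by (subst (asm) integral_nonneg_eq_0_iff_AE) auto
  then show ?thesis by eventually_elim auto
qed

definition residual_k :: "nat \<Rightarrow> 'b \<Rightarrow> real" where
  "residual_k k x = - (\<Sum>b\<in>Basis. c b * partial_deriv b (partial_deriv b (vk k)) x) - conv (moll k) h x"

text \<open>Mollification commutes with constant coefficients, so the pointwise residual of the
  mollified equation at \<open>x\<close> is the weak one tested with the kernel centred at
  \<open>x\<close>.\<close>

lemma residual_k_eq: "residual_k k x = M (\<lambda>y. moll k (x - y))"
proof -
  have sm: "smooth (moll k :: 'b \<Rightarrow> real)" by (rule test_functionsD(1)[OF moll_test])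
  have "(\<integral>y. g b y * partial_deriv b (\<lambda>y. moll k (x - y)) y \<partial>lborel) = - partial_deriv b (partial_deriv b (vk k)) x"
    if "b \<in> Basis" for b
    unfolding partial_deriv_reflect[OF sm] partial2_vk[OF that] conv_def by (simp add: mult.commute)
  then show ?thesis
    unfolding residual_k_def M_def by (simp add: conv_def mult.commute sum_negf)
qed

lemma sq_partial2_vk: "b \<in> Basis \<Longrightarrow> sq_integrable (partial_deriv b (partial_deriv b (vk k)))"
  by (rule sq_integrable_partial[OF test_functions_partial[OF vk_test]])

lemma sq_conv_h: "sq_integrable (conv (moll k) h)"
  by (rule conv_contraction(1)[OF _ h_int h]) simp

lemma sq_residual_k: "sq_integrable (residual_k k)"
  unfolding residual_k_def
  by (intro sq_integrable_diff sq_integrable_uminus sq_integrable_sum sq_integrable_cmult sq_partial2_vk sq_conv_h) auto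

text \<open>Tested with the nonnegative kernel, the hypothesis bounds the residual pointwise by
  \<open>C0\<close> times the mollified indicator of \<open>Z\<close>. The contraction property
  removes the dependence on \<open>k\<close>.\<close>

lemma residual_k_L2: "(\<integral>x. (residual_k k x)\<^sup>2 \<partial>lborel) \<le> C0\<^sup>2 * (\<integral>x. (indicator Z x)\<^sup>2 \<partial>lborel)"
proof -
  have kd: "inverse (real (Suc k)) > 0" by simp
  have Zi: "integrable lborel (indicator Z :: 'b \<Rightarrow> real)"
    by (rule sq_integrable_imp_integrable[OF sq_Z, of R]) (use Z_ball in \<open>auto simp: indicator_def\<close>)
  note ct = conv_contraction[OF kd Zi sq_Z]
  have b: "\<bar>residual_k k x\<bar> \<le> C0 * conv (moll k) (indicator Z) x" for x
  proof -
    have "\<bar>residual_k k x\<bar> \<le> C0 * (\<integral>y. indicator Z y * \<bar>moll k (x - y)\<bar> \<partial>lborel)"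
      unfolding residual_k_eq M_def by (rule residual[OF test_functions_reflect[OF moll_test]])
    also have "(\<lambda>y. indicator Z y * \<bar>moll k (x - y)\<bar>) = (\<lambda>y. moll k (x - y) * indicator Z y)"
      by (rule ext) (simp only: abs_of_nonneg[OF mollifier_props(2)[OF kd]] mult.commute)
    finally show ?thesis unfolding conv_def .
  qed
  have "(\<integral>x. (residual_k k x)\<^sup>2 \<partial>lborel) \<le> (\<integral>x. C0\<^sup>2 * (conv (moll k) (indicator Z) x)\<^sup>2 \<partial>lborel)"
  proof (rule integral_mono[OF sq_integrableD(2)[OF sq_residual_k]])
    show "integrable lborel (\<lambda>x. C0\<^sup>2 * (conv (moll k) (indicator Z) x)\<^sup>2)"
      by (rule integrable_mult_right[OF sq_integrableD(2)[OF ct(1)]])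
    show "(residual_k k x)\<^sup>2 \<le> C0\<^sup>2 * (conv (moll k) (indicator Z) x)\<^sup>2" for x
      using power_mono[OF b[of x], of 2] by (simp add: power_mult_distrib)
  qed
  also have "\<dots> = C0\<^sup>2 * (\<integral>x. (conv (moll k) (indicator Z) x)\<^sup>2 \<partial>lborel)" by simp
  also have "\<dots> \<le> C0\<^sup>2 * (\<integral>x. (indicator Z x)\<^sup>2 \<partial>lborel)"
    by (rule mult_left_mono[OF ct(2)]) simp
  finally show ?thesis .
qed

text \<open>In the expanded square of the sum of \<open>c b * q b\<close> all terms have nonnegative
  integral, by \<open>conv_mollifier_H2_identity\<close> and the positivity of \<open>c\<close>.
  Hence each diagonal term is at most the whole square, and the sum of the \<open>c b * q b\<close>
  is minus the residual minus the mollified \<open>h\<close>, both bounded in L2.\<close>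

lemma partial2_vk_bounded:
  assumes b: "b \<in> Basis"
  shows "\<exists>C. \<forall>k. (\<integral>x. (partial_deriv b (partial_deriv b (vk k)) x)\<^sup>2 \<partial>lborel) \<le> C"
proof -
  define K where "K = 2 * (C0\<^sup>2 * (\<integral>x. (indicator Z x)\<^sup>2 \<partial>lborel)) + 2 * (\<integral>x. (h x)\<^sup>2 \<partial>lborel)"
  have "(\<integral>x. (partial_deriv b (partial_deriv b (vk k)) x)\<^sup>2 \<partial>lborel) \<le> K / (c b)\<^sup>2" for k
  proof -
    have kd: "inverse (real (Suc k)) > 0" by simp
    define q where "q = (\<lambda>b. partial_deriv b (partial_deriv b (vk k)))"
    have sq: "sq_integrable (q b)" if "b \<in> Basis" for b unfolding q_def by (rule sq_partial2_vk[OF that])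
    have qq: "0 \<le> (\<integral>x. q b x * q a x \<partial>lborel)" if "a \<in> Basis" "b \<in> Basis" for a b
      unfolding q_def vk_def
      using conv_mollifier_H2_identity[OF kd v_int v_out that g_int[OF that(1)] weak[OF that(1)]] by simp
    have c': "0 \<le> c b" if "b \<in> Basis" for b using c[OF that] by simp
    have eq: "(\<lambda>x. \<Sum>b\<in>Basis. c b * q b x) = (\<lambda>x. - residual_k k x + - conv (moll k) h x)"
      by (simp add: fun_eq_iff residual_k_def q_def)
    have "(c b)\<^sup>2 * (\<integral>x. (q b x)\<^sup>2 \<partial>lborel) = c b * c b * (\<integral>x. q b x * q b x \<partial>lborel)"
      by (simp add: power2_eq_square)
    \<comment> \<open>One diagonal entry is compared with its row, then the row with the full double
      sum; every entry left out is nonnegative.\<close>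
    also have "\<dots> \<le> (\<Sum>a\<in>Basis. c b * c a * (\<integral>x. q b x * q a x \<partial>lborel))"
      by (rule member_le_sum[OF b]) (use qq c' b in \<open>auto intro!: mult_nonneg_nonneg\<close>)
    also have "\<dots> \<le> (\<Sum>b\<in>Basis. \<Sum>a\<in>Basis. c b * c a * (\<integral>x. q b x * q a x \<partial>lborel))"
      by (rule member_le_sum[OF b, of "\<lambda>b. \<Sum>a\<in>Basis. c b * c a * (\<integral>x. q b x * q a x \<partial>lborel)"])
        (use qq c' in \<open>auto intro!: mult_nonneg_nonneg sum_nonneg\<close>)
    also have "\<dots> = (\<Sum>b\<in>Basis. \<Sum>a\<in>Basis. \<integral>x. (c b * q b x) * (c a * q a x) \<partial>lborel)"
    proof (intro sum.cong refl)
      fix a b :: 'b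
      have "(\<lambda>x. (c b * q b x) * (c a * q a x)) = (\<lambda>x. (c b * c a) * (q b x * q a x))"
        by (simp add: fun_eq_iff mult_ac)
      then show "c b * c a * (\<integral>x. q b x * q a x \<partial>lborel) = (\<integral>x. (c b * q b x) * (c a * q a x) \<partial>lborel)"
        by simp
    qed
    also have "\<dots> = (\<integral>x. (\<Sum>b\<in>Basis. \<Sum>a\<in>Basis. (c b * q b x) * (c a * q a x)) \<partial>lborel)"
    proof -
      have i: "integrable lborel (\<lambda>x. (c b * q b x) * (c a * q a x))" if "a \<in> Basis" "b \<in> Basis" for a b
        by (rule sq_integrable_mult[OF sq_integrable_cmult[OF sq[OF that(2)]] sq_integrable_cmult[OF sq[OF that(1)]]])
      then have "integrable lborel (\<lambda>x. \<Sum>a\<in>Basis. (c b * q b x) * (c a * q a x))" if "b \<in> Basis" for b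
        using that by (intro Bochner_Integration.integrable_sum)
      with i show ?thesis by (simp add: Bochner_Integration.integral_sum)
    qed
    also have "\<dots> = (\<integral>x. (- residual_k k x + - conv (moll k) h x)\<^sup>2 \<partial>lborel)"
      unfolding sum_product[symmetric] fun_cong[OF eq] power2_eq_square ..
    also have "\<dots> \<le> 2 * (\<integral>x. (- residual_k k x)\<^sup>2 \<partial>lborel) + 2 * (\<integral>x. (- conv (moll k) h x)\<^sup>2 \<partial>lborel)"
      by (rule integral_square_add_le[OF sq_integrable_uminus[OF sq_residual_k] sq_integrable_uminus[OF sq_conv_h]])
    also have "\<dots> \<le> K"
      using residual_k_L2[of k] conv_contraction(2)[OF kd h_int h] unfolding K_def by simp
    finally show ?thesis using c[OF b] by (simp add: q_def pos_le_divide_eq mult.commute)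
  qed
  then show ?thesis by blast
qed

text \<open>The zero set lemma one order higher: it is applied to the first derivatives of
  \<open>vk k\<close>, whose L2 limit \<open>g b\<close> vanishes almost everywhere on
  \<open>Z\<close> by \<open>g_zero_AE\<close>.\<close>

lemma partial2_vk_tendsto_0:
  assumes b: "b \<in> Basis" and \<phi>: "\<phi> \<in> borel_measurable borel" "\<And>x. \<bar>\<phi> x\<bar> \<le> B"
  shows "(\<lambda>k. \<integral>x. partial_deriv b (partial_deriv b (vk k)) x * (indicator Z x * \<phi> x) \<partial>lborel) \<longlonglongrightarrow> 0"
proof -
  obtain C where C: "\<forall>k. (\<integral>x. (partial_deriv b (partial_deriv b (vk k)) x)\<^sup>2 \<partial>lborel) \<le> C"
    using partial2_vk_bounded[OF b] by blast
  show ?thesis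
  proof (rule integral_partial_deriv_on_zero_set[OF test_functions_partial[OF vk_test b] g[OF b] _ b C[rule_format] Z Z_ball g_zero_AE[OF b] \<phi>])
    show "(\<lambda>k. \<integral>x. (partial_deriv b (vk k) x - g b x)\<^sup>2 \<partial>lborel) \<longlonglongrightarrow> 0"
      unfolding partial_vk[OF b] by (rule conv_moll_L2[OF g[OF b] g_out[OF b]])
  qed
qed

lemma M_diff:
  assumes \<phi>: "\<phi> \<in> test_functions UNIV" and \<psi>: "\<psi> \<in> test_functions UNIV"
  shows "M \<phi> - M \<psi> = M (\<lambda>x. \<phi> x - \<psi> x)"
proof -
  have p: "partial_deriv b (\<lambda>x. \<phi> x - \<psi> x) z = partial_deriv b \<phi> z - partial_deriv b \<psi> z" for b z
    using partial_deriv_add[of \<phi> z "\<lambda>z. (-1) * \<psi> z" b] partial_deriv_cmult[of \<psi> z b "-1"]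
      smooth_differentiable[OF test_functionsD(1)[OF \<phi>]] smooth_differentiable[OF test_functionsD(1)[OF \<psi>]]
      smooth_differentiable[OF smooth_cmult[OF test_functionsD(1)[OF \<psi>]], of "-1"] by simp
  have "(\<integral>x. g b x * partial_deriv b (\<lambda>x. \<phi> x - \<psi> x) x \<partial>lborel) =
      (\<integral>x. g b x * partial_deriv b \<phi> x \<partial>lborel) - (\<integral>x. g b x * partial_deriv b \<psi> x \<partial>lborel)" if "b \<in> Basis" for b
    unfolding p right_diff_distrib
    by (rule Bochner_Integration.integral_diff) (rule sq_integrable_mult[OF g[OF that] sq_integrable_partial[OF _ that]] \<phi> \<psi>)+
  moreover have "(\<integral>x. h x * (\<phi> x - \<psi> x) \<partial>lborel) = (\<integral>x. h x * \<phi> x \<partial>lborel) - (\<integral>x. h x * \<psi> x \<partial>lborel)"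
    unfolding right_diff_distrib
    by (rule Bochner_Integration.integral_diff) (rule sq_integrable_mult[OF h test_functions_sq_integrable] \<phi> \<psi>)+
  ultimately show ?thesis
    by (simp add: M_def right_diff_distrib sum_subtractf)
qed

lemma integral_residual_k:
  assumes \<psi>: "sq_integrable \<psi>"
  shows "(\<integral>x. residual_k k x * \<psi> x \<partial>lborel) =
     - (\<Sum>b\<in>Basis. c b * (\<integral>x. partial_deriv b (partial_deriv b (vk k)) x * \<psi> x \<partial>lborel))
     - (\<integral>x. conv (moll k) h x * \<psi> x \<partial>lborel)"
proof -
  have i: "integrable lborel (\<lambda>x. partial_deriv b (partial_deriv b (vk k)) x * \<psi> x)" if "b \<in> Basis" for b
    by (rule sq_integrable_mult[OF sq_partial2_vk[OF that] \<psi>])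
  have "(\<lambda>x. residual_k k x * \<psi> x) = (\<lambda>x. - (\<Sum>b\<in>Basis. c b * (partial_deriv b (partial_deriv b (vk k)) x * \<psi> x))
      - conv (moll k) h x * \<psi> x)"
    by (simp add: fun_eq_iff residual_k_def left_diff_distrib sum_distrib_right mult.assoc)
  then show ?thesis
    using i sq_integrable_mult[OF sq_conv_h \<psi>] by (simp add: Bochner_Integration.integral_sum)
qed

text \<open>Shifts the mollification from the solution to \<open>\<psi>\<close>, which need not be
  smooth. The kernel is even and thus its own adjoint; its derivative is odd, which accounts for the
  sign.\<close>

lemma M_conv:
  assumes \<psi>: "integrable lborel \<psi>" "sq_integrable \<psi>"
  shows "(\<integral>x. residual_k k x * \<psi> x \<partial>lborel) = M (conv (moll k) \<psi>)"
proof -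
  have kd: "inverse (real (Suc k)) > 0" by simp
  have ev: "(\<lambda>z. moll k (- z)) = (moll k :: 'b \<Rightarrow> real)"
    by (rule ext) (rule mollifier_props(4)[OF kd])
  have "(\<integral>x. partial_deriv b (partial_deriv b (vk k)) x * \<psi> x \<partial>lborel) =
      - (\<integral>x. g b x * partial_deriv b (conv (moll k) \<psi>) x \<partial>lborel)" if b: "b \<in> Basis" for b
  proof -
    have od: "(\<lambda>z. partial_deriv b (moll k) (- z)) = (\<lambda>z. - partial_deriv b (moll k :: 'b \<Rightarrow> real) z)"
      by (rule ext) (rule smooth_even_partial_odd[OF mollifier_props(1)[OF kd] mollifier_props(4)[OF kd]])
    have "(\<integral>x. partial_deriv b (partial_deriv b (vk k)) x * \<psi> x \<partial>lborel) =
       (\<integral>y. g b y * conv (\<lambda>z. - partial_deriv b (moll k) z) \<psi> y \<partial>lborel)"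
      unfolding partial2_vk[OF b] conv_adjoint[OF test_functions_partial[OF moll_test b] g_int[OF b] \<psi>(1)] od ..
    also have "\<dots> = - (\<integral>x. g b x * conv (partial_deriv b (moll k)) \<psi> x \<partial>lborel)"
      by (simp add: conv_def)
    finally show ?thesis by (simp only: partial_deriv_conv[OF moll_test \<psi>(1) b])
  qed
  moreover have "(\<integral>x. conv (moll k) h x * \<psi> x \<partial>lborel) = (\<integral>x. h x * conv (moll k) \<psi> x \<partial>lborel)"
    using conv_adjoint[OF moll_test h_int \<psi>(1), of k] unfolding ev .
  ultimately show ?thesis unfolding integral_residual_k[OF \<psi>(2)] by (simp add: M_def sum_negf)
qed

text \<open>Formally the residual charges only \<open>Z\<close>, so \<open>M \<phi>\<close> equals
  \<open>M\<close> at the indicator of \<open>Z\<close> times \<open>\<phi>\<close>, and on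
  \<open>Z\<close> the second derivatives contribute nothing, which leaves \<open>h\<close>. As that
  product is not a test function, all three functionals are evaluated at mollifications and compared
  in the limit.\<close>

theorem M_eq:
  assumes \<phi>: "\<phi> \<in> test_functions UNIV"
  shows "M \<phi> = - (\<integral>x. indicator Z x * (h x * \<phi> x) \<partial>lborel)"
proof -
  obtain B where B: "\<forall>x. \<bar>\<phi> x\<bar> \<le> B" using test_functions_bounded[OF \<phi>] by meson
  have \<phi>b[measurable]: "\<phi> \<in> borel_measurable borel" by (rule smooth_borel[OF test_functionsD(1)[OF \<phi>]])
  have kd: "inverse (real (Suc k)) > 0" for k by simp
  define \<psi> where "\<psi> = (\<lambda>x. indicator Z x * \<phi> x)"
  have sq\<psi>: "sq_integrable \<psi>"
    unfolding \<psi>_def using sq_integrable_bounded_mult[OF sq_Z \<phi>b B[rule_format]] by (simp add: mult.commute)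
  have \<psi>_out: "\<psi> x = 0" if "norm x > R" for x using Z_ball that by (auto simp: \<psi>_def indicator_def)
  have \<psi>_int: "integrable lborel \<psi>" by (rule sq_integrable_imp_integrable[OF sq\<psi> \<psi>_out])
  have \<phi>_int: "integrable lborel \<phi>" by (rule test_functions_integrable[OF \<phi>])
  have sq\<phi>: "sq_integrable \<phi>" by (rule test_functions_sq_integrable[OF \<phi>])
  obtain R' where R': "\<forall>z. norm z > R' \<longrightarrow> \<phi> z = 0" using test_functions_ball[OF \<phi>] by meson
  let ?S = "max R R'"
  have c\<phi>: "conv (moll k) \<phi> \<in> test_functions UNIV" for k
    by (rule conv_test[OF moll_test \<phi>_int R'[rule_format]])
  have c\<psi>: "conv (moll k) \<psi> \<in> test_functions UNIV" for k
    by (rule conv_test[OF moll_test \<psi>_int \<psi>_out])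
  have 1: "(\<lambda>k. M (conv (moll k) \<psi>)) \<longlonglongrightarrow> - (\<integral>x. h x * \<psi> x \<partial>lborel)"
  proof -
    have "M (conv (moll k) \<psi>) = - (\<Sum>b\<in>Basis. c b * (\<integral>x. partial_deriv b (partial_deriv b (vk k)) x * \<psi> x \<partial>lborel))
     - (\<integral>x. conv (moll k) h x * \<psi> x \<partial>lborel)" for k
      unfolding M_conv[OF \<psi>_int sq\<psi>, symmetric] by (rule integral_residual_k[OF sq\<psi>])
    moreover have "(\<lambda>k. - (\<Sum>b\<in>Basis. c b * (\<integral>x. partial_deriv b (partial_deriv b (vk k)) x * \<psi> x \<partial>lborel))
     - (\<integral>x. conv (moll k) h x * \<psi> x \<partial>lborel)) \<longlonglongrightarrow> - (\<Sum>b\<in>(Basis::'b set). c b * 0) - (\<integral>x. h x * \<psi> x \<partial>lborel)"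
    proof (intro tendsto_intros)
      show "(\<lambda>k. \<integral>x. partial_deriv b (partial_deriv b (vk k)) x * \<psi> x \<partial>lborel) \<longlonglongrightarrow> 0" if "b \<in> Basis" for b
        unfolding \<psi>_def by (rule partial2_vk_tendsto_0[OF that \<phi>b B[rule_format]])
      show "(\<lambda>k. \<integral>x. conv (moll k) h x * \<psi> x \<partial>lborel) \<longlonglongrightarrow> (\<integral>x. h x * \<psi> x \<partial>lborel)"
        by (rule L2_tendsto_integral_mult[OF sq_conv_h h sq\<psi> conv_moll_L2[OF h h_out]])
    qed
    ultimately show ?thesis by simp
  qed
  have 2: "(\<lambda>k. M (conv (moll k) \<phi>)) \<longlonglongrightarrow> M \<phi>"
    unfolding M_def
  proof (intro tendsto_intros)
    fix b :: 'b assume b: "b \<in> Basis"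
    have sm: "smooth \<phi>" by (rule test_functionsD(1)[OF \<phi>])
    note t\<phi> = test_functions_partial[OF \<phi> b]
    have "\<exists>R'. \<forall>z. norm z > R' \<longrightarrow> partial_deriv b \<phi> z = 0" using test_functions_ball[OF \<phi>] by meson
    then obtain R' where R': "\<forall>z. norm z > R' \<longrightarrow> partial_deriv b \<phi> z = 0" by blast
    have eq: "partial_deriv b (conv (moll k) \<phi>) = conv (moll k) (partial_deriv b \<phi>)" for k
      unfolding partial_deriv_conv[OF moll_test \<phi>_int b]
      by (rule conv_weak_deriv[OF moll_test b]) (rule integral_by_parts[OF sm _ b])
    have "(\<lambda>k. \<integral>x. conv (moll k) (partial_deriv b \<phi>) x * g b x \<partial>lborel) \<longlonglongrightarrow> (\<integral>x. partial_deriv b \<phi> x * g b x \<partial>lborel)"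
      by (rule L2_tendsto_integral_mult[OF conv_contraction(1)[OF kd test_functions_integrable[OF t\<phi>] test_functions_sq_integrable[OF t\<phi>]]
            test_functions_sq_integrable[OF t\<phi>] g[OF b] conv_moll_L2[OF test_functions_sq_integrable[OF t\<phi>] R'[rule_format]]])
    then show "(\<lambda>k. \<integral>x. g b x * partial_deriv b (conv (moll k) \<phi>) x \<partial>lborel) \<longlonglongrightarrow> (\<integral>x. g b x * partial_deriv b \<phi> x \<partial>lborel)"
      unfolding eq by (simp add: mult.commute)
  next
    have "(\<lambda>k. \<integral>x. conv (moll k) \<phi> x * h x \<partial>lborel) \<longlonglongrightarrow> (\<integral>x. \<phi> x * h x \<partial>lborel)"
      by (rule L2_tendsto_integral_mult[OF conv_contraction(1)[OF kd \<phi>_int sq\<phi>] sq\<phi> h conv_moll_L2[OF sq\<phi> R'[rule_format]]])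
    then show "(\<lambda>k. \<integral>x. h x * conv (moll k) \<phi> x \<partial>lborel) \<longlonglongrightarrow> (\<integral>x. h x * \<phi> x \<partial>lborel)"
      by (simp add: mult.commute)
  qed
  have 3: "(\<lambda>k. M (conv (moll k) \<phi>) - M (conv (moll k) \<psi>)) \<longlonglongrightarrow> 0"
  proof -
    define F where "F = (\<lambda>x. \<phi> x - \<psi> x)"
    have sqF: "sq_integrable F" unfolding F_def by (rule sq_integrable_diff[OF sq\<phi> sq\<psi>])
    have F_out: "F x = 0" if "norm x > ?S" for x
      using R' \<psi>_out[of x] that by (simp add: F_def)
    have F_int: "integrable lborel F" by (rule sq_integrable_imp_integrable[OF sqF F_out])
    have FZ: "F x = 0" if "x \<in> Z" for x using that by (simp add: F_def \<psi>_def)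
    have sqk: "sq_integrable (\<lambda>x. conv (moll k) F x - F x)" for k
      by (rule sq_integrable_diff[OF conv_contraction(1)[OF kd F_int sqF] sqF])
    have sqa: "sq_integrable (\<lambda>x. \<bar>conv (moll k) F x - F x\<bar>)" for k
    proof -
      note [measurable] = sq_integrableD(1)[OF sqk[of k]]
      have "(\<lambda>x. \<bar>conv (moll k) F x - F x\<bar>) \<in> borel_measurable borel" by measurable
      then show ?thesis using sq_integrableD(2)[OF sqk[of k]] by (simp only: sq_integrable_def power2_abs simp_thms)
    qed
    have bd: "\<bar>M (conv (moll k) \<phi>) - M (conv (moll k) \<psi>)\<bar> \<le> C0 * (\<integral>x. indicator Z x * \<bar>conv (moll k) F x - F x\<bar> \<partial>lborel)" for k
    proof -
      have eq: "(\<lambda>x. conv (moll k) \<phi> x - conv (moll k) \<psi> x) = conv (moll k) F"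
        unfolding F_def by (rule ext) (rule conv_diff[OF moll_test \<phi>_int \<psi>_int, symmetric])
      have tF: "conv (moll k) F \<in> test_functions UNIV" by (rule conv_test[OF moll_test F_int F_out])
      have "\<bar>M (conv (moll k) \<phi>) - M (conv (moll k) \<psi>)\<bar> = \<bar>M (conv (moll k) F)\<bar>"
        unfolding M_diff[OF c\<phi> c\<psi>] eq ..
      also have "\<dots> \<le> C0 * (\<integral>x. indicator Z x * \<bar>conv (moll k) F x\<bar> \<partial>lborel)"
        unfolding M_def by (rule residual[OF tF])
      \<comment> \<open>\<open>F\<close> vanishes on \<open>Z\<close>. Subtracting it there changes
        nothing and brings in the L2 convergence of its mollifications.\<close>
      also have "(\<lambda>x. indicator Z x * \<bar>conv (moll k) F x\<bar>) = (\<lambda>x. indicator Z x * \<bar>conv (moll k) F x - F x\<bar>)"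
        using FZ by (auto simp: fun_eq_iff indicator_def)
      finally show ?thesis .
    qed
    show ?thesis
    proof (rule tendsto_0_of_square_le)
      fix k
      have "(M (conv (moll k) \<phi>) - M (conv (moll k) \<psi>))\<^sup>2 \<le> (C0 * (\<integral>x. indicator Z x * \<bar>conv (moll k) F x - F x\<bar> \<partial>lborel))\<^sup>2"
        using power_mono[OF bd[of k], of 2] by simp
      also have "\<dots> = C0\<^sup>2 * (\<integral>x. indicator Z x * \<bar>conv (moll k) F x - F x\<bar> \<partial>lborel)\<^sup>2"
        by (rule power_mult_distrib)
      also have "\<dots> \<le> C0\<^sup>2 * ((\<integral>x. (indicator Z x)\<^sup>2 \<partial>lborel) * (\<integral>x. \<bar>conv (moll k) F x - F x\<bar>\<^sup>2 \<partial>lborel))"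
        by (rule mult_left_mono[OF Cauchy_Schwarz_integral[OF sq_Z sqa]]) simp
      finally show "(M (conv (moll k) \<phi>) - M (conv (moll k) \<psi>))\<^sup>2 \<le>
          C0\<^sup>2 * ((\<integral>x. (indicator Z x)\<^sup>2 \<partial>lborel) * (\<integral>x. (conv (moll k) F x - F x)\<^sup>2 \<partial>lborel))"
        by simp
    next
      show "(\<lambda>k. C0\<^sup>2 * ((\<integral>x. (indicator Z x)\<^sup>2 \<partial>lborel) * (\<integral>x. (conv (moll k) F x - F x)\<^sup>2 \<partial>lborel))) \<longlonglongrightarrow> 0"
      proof -
        have "(\<lambda>k. \<integral>x. (conv (moll k) F x - F x)\<^sup>2 \<partial>lborel) \<longlonglongrightarrow> 0" by (rule conv_moll_L2[OF sqF F_out])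
        from tendsto_mult_left[OF tendsto_mult_left[OF this]] show ?thesis by (simp del: of_nat_Suc)
      qed
    qed
  qed
  have "(\<lambda>k. M (conv (moll k) \<phi>) - M (conv (moll k) \<psi>)) \<longlonglongrightarrow> M \<phi> - (- (\<integral>x. h x * \<psi> x \<partial>lborel))"
    by (rule tendsto_diff[OF 2 1])
  with 3 have "M \<phi> - (- (\<integral>x. h x * \<psi> x \<partial>lborel)) = 0" using LIMSEQ_unique by blast
  then show ?thesis by (simp add: \<psi>_def mult_ac)
qed

end

section \<open>Weak derivatives through Borel representatives\<close>

text \<open>
  Lebesgue measurable functions on \<open>U\<close> are handled through Borel functions that agree with them
  almost everywhere on \<open>U\<close>; the values outside \<open>U\<close> are unconstrained.
\<close>

definition borel_version :: "'b::euclidean_space set \<Rightarrow> ('b \<Rightarrow> real) \<Rightarrow> ('b \<Rightarrow> real) \<Rightarrow> bool" where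
  "borel_version U f f' \<longleftrightarrow> f' \<in> borel_measurable borel \<and> (AE x in lborel. x \<in> U \<longrightarrow> f x = f' x)"

lemma borel_versionD:
  assumes "borel_version U f f'"
  shows "f' \<in> borel_measurable borel" "AE x in lborel. x \<in> U \<longrightarrow> f x = f' x"
  using assms by (auto simp: borel_version_def)

lemma borel_version_refl: "f \<in> borel_measurable borel \<Longrightarrow> borel_version U f f"
  by (simp add: borel_version_def)

lemma borel_version_mono: "borel_version U f f' \<Longrightarrow> V \<subseteq> U \<Longrightarrow> borel_version V f f'"
  unfolding borel_version_def by (auto elim!: eventually_mono)

lemma borel_version_mult:
  assumes f: "borel_version U f f'" and g: "borel_version U g g'"
  shows "borel_version U (\<lambda>x. f x * g x) (\<lambda>x. f' x * g' x)"
proof -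
  note [measurable] = borel_versionD(1)[OF f] borel_versionD(1)[OF g]
  have "AE x in lborel. x \<in> U \<longrightarrow> f x * g x = f' x * g' x"
    using borel_versionD(2)[OF f] borel_versionD(2)[OF g] by eventually_elim auto
  then show ?thesis by (simp add: borel_version_def)
qed

lemma borel_version_add:
  assumes f: "borel_version U f f'" and g: "borel_version U g g'"
  shows "borel_version U (\<lambda>x. f x + g x) (\<lambda>x. f' x + g' x)"
proof -
  note [measurable] = borel_versionD(1)[OF f] borel_versionD(1)[OF g]
  have "AE x in lborel. x \<in> U \<longrightarrow> f x + g x = f' x + g' x"
    using borel_versionD(2)[OF f] borel_versionD(2)[OF g] by eventually_elim auto
  then show ?thesis by (simp add: borel_version_def)
qed

lemma borel_version_comp:
  assumes f: "borel_version U f f'" and [measurable]: "F \<in> borel_measurable borel"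
  shows "borel_version U (\<lambda>x. F (f x)) (\<lambda>x. F (f' x))"
proof -
  note [measurable] = borel_versionD(1)[OF f]
  have "AE x in lborel. x \<in> U \<longrightarrow> F (f x) = F (f' x)"
    using borel_versionD(2)[OF f] by eventually_elim auto
  then show ?thesis by (simp add: borel_version_def)
qed

lemma borel_version_smooth: "smooth \<phi> \<Longrightarrow> borel_version U \<phi> \<phi>"
  by (rule borel_version_refl[OF smooth_borel])

text \<open>Completeness of Lebesgue measure; it leads back from a Borel version to measurability of
  the original function.\<close>

lemma borel_measurable_lebesgue_AE:
  fixes f g :: "'b::euclidean_space \<Rightarrow> real"
  assumes "f \<in> borel_measurable lebesgue" "AE x in lebesgue. f x = g x"
  shows "g \<in> borel_measurable lebesgue"
proof (rule measurableI)
  fix A :: "real set" assume A: "A \<in> sets borel"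
  show "g -` A \<inter> space lebesgue \<in> sets lebesgue"
  proof (rule completion.in_sets_AE)
    show "AE x in lebesgue. x \<in> f -` A \<inter> space lebesgue \<longleftrightarrow> x \<in> g -` A \<inter> space lebesgue"
      using assms(2) by eventually_elim auto
    show "f -` A \<inter> space lebesgue \<in> sets lebesgue" by (rule measurable_sets[OF assms(1) A])
  qed auto
qed auto

lemma borel_version_measurable:
  assumes f: "borel_version U f f'" and U: "U \<in> sets borel"
  shows "f \<in> borel_measurable (lebesgue_on U)"
proof -
  have UL: "U \<in> sets lebesgue" using U by simp
  have "(\<lambda>x. if x \<in> U then f' x else 0) \<in> borel_measurable lebesgue"
    using borel_versionD(1)[OF f] U by (intro measurable_completion) simp
  moreover have "AE x in lebesgue. (if x \<in> U then f' x else 0) = (if x \<in> U then f x else 0)"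
    using borel_versionD(2)[OF f] by (intro AE_completion) (auto elim!: eventually_mono)
  ultimately have "(\<lambda>x. if x \<in> U then f x else 0) \<in> borel_measurable lebesgue"
    by (rule borel_measurable_lebesgue_AE)
  then show ?thesis using borel_measurable_if[OF UL] by blast
qed

lemma ex_borel_version:
  assumes f: "f \<in> borel_measurable (lebesgue_on U)" and U: "U \<in> sets borel"
  shows "\<exists>f'. borel_version U f f'"
proof -
  have UL: "U \<in> sets lebesgue" using U by simp
  have "(\<lambda>x. if x \<in> U then f x else 0) \<in> borel_measurable lebesgue"
    using f borel_measurable_if[OF UL] by blast
  then obtain f' where f': "f' \<in> borel_measurable lborel" "AE x in lborel. (if x \<in> U then f x else 0) = f' x"
    using completion_ex_borel_measurable_real by blast
  have "AE x in lborel. x \<in> U \<longrightarrow> f x = f' x" using f'(2) by eventually_elim auto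
  with f'(1) show ?thesis by (auto simp: borel_version_def)
qed

lemma lebesgue_on_version:
  assumes f: "borel_version U f f'" and U: "U \<in> sets borel"
  shows "integral\<^sup>L (lebesgue_on U) f = (\<integral>x. indicator U x * f' x \<partial>lborel)"
    and "integrable (lebesgue_on U) f \<longleftrightarrow> integrable lborel (\<lambda>x. indicator U x * f' x)"
proof -
  note [measurable] = borel_versionD(1)[OF f] U
  have UL: "U \<in> sets lebesgue" using U by simp
  have m: "(\<lambda>x. indicator U x * f' x) \<in> borel_measurable lborel" by measurable
  have m2: "(\<lambda>x. indicator U x *\<^sub>R f x) \<in> borel_measurable lebesgue"
    using borel_version_measurable[OF f U] borel_measurable_restrict_space_iff[of U lebesgue f] UL by simp
  have ae: "AE x in lebesgue. indicator U x *\<^sub>R f x = indicator U x * f' x"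
    using borel_versionD(2)[OF f] by (intro AE_completion) (auto elim!: eventually_mono simp: indicator_def)
  have "integral\<^sup>L (lebesgue_on U) f = integral\<^sup>L lebesgue (\<lambda>x. indicator U x *\<^sub>R f x)"
    using UL by (simp add: integral_restrict_space)
  also have "\<dots> = integral\<^sup>L lebesgue (\<lambda>x. indicator U x * f' x)"
    by (rule integral_cong_AE[OF m2 measurable_completion[OF m] ae])
  also have "\<dots> = (\<integral>x. indicator U x * f' x \<partial>lborel)" by (rule integral_completion[OF m])
  finally show "integral\<^sup>L (lebesgue_on U) f = (\<integral>x. indicator U x * f' x \<partial>lborel)" .
  have "integrable (lebesgue_on U) f \<longleftrightarrow> integrable lebesgue (\<lambda>x. indicator U x *\<^sub>R f x)"
    using UL by (simp add: integrable_restrict_space)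
  also have "\<dots> \<longleftrightarrow> integrable lebesgue (\<lambda>x. indicator U x * f' x)"
    by (rule integrable_cong_AE[OF m2 measurable_completion[OF m] ae])
  also have "\<dots> \<longleftrightarrow> integrable lborel (\<lambda>x. indicator U x * f' x)" by (rule integrable_completion[OF m])
  finally show "integrable (lebesgue_on U) f \<longleftrightarrow> integrable lborel (\<lambda>x. indicator U x * f' x)" .
qed

lemma indicator_absorb:
  assumes "\<And>x. x \<notin> U \<Longrightarrow> p x = (0::real)"
  shows "(\<lambda>x. indicator U x * p x) = p"
  using assms by (auto simp: fun_eq_iff indicator_def)

lemma lebesgue_on_version_supported:
  assumes f: "borel_version U f p" and U: "U \<in> sets borel" and p: "\<And>x. x \<notin> U \<Longrightarrow> p x = 0"
  shows "integral\<^sup>L (lebesgue_on U) f = (\<integral>x. p x \<partial>lborel)"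
    and "integrable (lebesgue_on U) f \<longleftrightarrow> integrable lborel p"
proof -
  have "(\<lambda>x. indicator U x * p x) = p" by (rule indicator_absorb) (rule p)
  then show "integral\<^sup>L (lebesgue_on U) f = (\<integral>x. p x \<partial>lborel)"
    and "integrable (lebesgue_on U) f \<longleftrightarrow> integrable lborel p"
    using lebesgue_on_version[OF f U] by simp_all
qed

section \<open>Weak derivatives of Borel functions\<close>

definition loc_int :: "'b::euclidean_space set \<Rightarrow> ('b \<Rightarrow> real) \<Rightarrow> bool" where
  "loc_int U f \<longleftrightarrow> (\<forall>K. compact K \<and> K \<subseteq> U \<longrightarrow> integrable lborel (\<lambda>x. indicator K x * f x))"

lemma loc_integrable_on_version:
  assumes f: "borel_version U f f'"
  shows "loc_integrable_on U f \<longleftrightarrow> loc_int U f'"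
proof -
  have "integrable (lebesgue_on K) f \<longleftrightarrow> integrable lborel (\<lambda>x. indicator K x * f' x)" if "compact K" "K \<subseteq> U" for K
    by (rule lebesgue_on_version(2)[OF borel_version_mono[OF f that(2)]])
      (use that compact_imp_closed borel_closed in blast)
  then show ?thesis by (auto simp: loc_integrable_on_def loc_int_def)
qed

lemma loc_int_test:
  assumes f: "loc_int U f" and \<phi>: "\<phi> \<in> test_functions U"
  shows "integrable lborel (\<lambda>x. f x * \<phi> x)"
proof -
  note D = test_functionsD[OF \<phi>]
  obtain B where B: "\<forall>x. \<bar>\<phi> x\<bar> \<le> B" using test_functions_bounded[OF \<phi>] by meson
  have "integrable lborel (\<lambda>x. indicator (supp \<phi>) x * f x)" using f D unfolding loc_int_def by blast
  then have "integrable lborel (\<lambda>x. \<phi> x * (indicator (supp \<phi>) x * f x))"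
    by (rule integrable_bounded_mult[OF _ _ B[rule_format]]) (use smooth_borel[OF D(1)] in simp)
  moreover have "\<phi> x * (indicator (supp \<phi>) x * f x) = f x * \<phi> x" for x
    using not_in_supp[of x \<phi>] by (cases "x \<in> supp \<phi>") auto
  ultimately show ?thesis by simp
qed

lemma open_compact_exhaustion:
  fixes U :: "'b::euclidean_space set"
  assumes "open U"
  shows "\<exists>C::nat \<Rightarrow> 'b set. (\<forall>n. compact (C n) \<and> C n \<subseteq> U \<and> C n \<subseteq> C (Suc n)) \<and> \<Union>(range C) = U"
proof (rule open_Union_compact_subsets[OF assms])
  fix C :: "nat \<Rightarrow> 'b set"
  assume C: "\<And>n. compact (C n)" "\<And>n. C n \<subseteq> U" "\<And>n. C n \<subseteq> interior (C (Suc n))" "\<Union>(range C) = U"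
  have "C n \<subseteq> C (Suc n)" for n using C(3)[of n] interior_subset by blast
  with C show ?thesis by blast
qed

lemma borel_measurable_lebesgue_on_UN:
  fixes f :: "'b::euclidean_space \<Rightarrow> real" and V :: "nat \<Rightarrow> 'b set"
  assumes V: "\<And>n. V n \<in> sets lebesgue" "\<And>n. V n \<subseteq> V (Suc n)"
    and f: "\<And>n. f \<in> borel_measurable (lebesgue_on (V n))"
  shows "f \<in> borel_measurable (lebesgue_on (\<Union>n. V n))"
proof -
  have mono: "V n \<subseteq> V m" if "n \<le> m" for n m
    by (rule lift_Suc_mono_le[of V, OF V(2) that])
  have UL: "(\<Union>n. V n) \<in> sets lebesgue" using V(1) by blast
  have "(\<lambda>x. if x \<in> (\<Union>n. V n) then f x else 0) \<in> borel_measurable lebesgue"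
  proof (rule borel_measurable_LIMSEQ_real)
    show "(\<lambda>x. if x \<in> V n then f x else 0) \<in> borel_measurable lebesgue" for n
      using borel_measurable_if[OF V(1)] f by blast
    show "(\<lambda>n. if x \<in> V n then f x else 0) \<longlonglongrightarrow> (if x \<in> (\<Union>n. V n) then f x else 0)" for x
    proof (cases "x \<in> (\<Union>n. V n)")
      case True
      then obtain N where N: "x \<in> V N" by blast
      have "\<forall>\<^sub>F n in sequentially. (if x \<in> V n then f x else 0) = f x"
        by (rule eventually_sequentiallyI[of N]) (use mono N in auto)
      then show ?thesis using True by (simp add: tendsto_eventually)
    next
      case False
      then have "x \<notin> V n" for n by blast
      then show ?thesis using False by simp
    qed
  qed
  then show ?thesis using borel_measurable_if[OF UL] by blast
qed

text \<open>Integrability on compact sets includes measurability there, and an exhaustion by compact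
  sets carries this over to \<open>U\<close>. Thus every function that occurs as a weak derivative
  has a Borel version.\<close>

lemma loc_integrable_measurable:
  assumes U: "open U" and f: "loc_integrable_on U f"
  shows "f \<in> borel_measurable (lebesgue_on U)"
proof -
  obtain C :: "nat \<Rightarrow> 'a set" where C': "\<forall>n. compact (C n) \<and> C n \<subseteq> U \<and> C n \<subseteq> C (Suc n)" and CU: "\<Union>(range C) = U"
    using open_compact_exhaustion[OF U] by blast
  note C = C'[rule_format, THEN conjunct1] C'[rule_format, THEN conjunct2, THEN conjunct1]
    C'[rule_format, THEN conjunct2, THEN conjunct2]
  have "f \<in> borel_measurable (lebesgue_on (\<Union>n. C n))"
  proof (rule borel_measurable_lebesgue_on_UN[of C, OF fmeasurableD[OF lmeasurable_compact[OF C(1)]] C(3)])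
    show "f \<in> borel_measurable (lebesgue_on (C n))" for n
      using f C(1,2) unfolding loc_integrable_on_def by (intro borel_measurable_integrable) blast
  qed
  then show ?thesis using CU by simp
qed

text \<open>Counterpart of \<open>has_weak_deriv\<close> for Borel functions. The integrals run over
  the whole space because test functions vanish outside \<open>U\<close>.\<close>

definition weak_partial :: "'b::euclidean_space set \<Rightarrow> 'b \<Rightarrow> ('b \<Rightarrow> real) \<Rightarrow> ('b \<Rightarrow> real) \<Rightarrow> bool" where
  "weak_partial U b f g \<longleftrightarrow> loc_int U f \<and> loc_int U g \<and>
     (\<forall>\<phi>\<in>test_functions U. (\<integral>x. f x * partial_deriv b \<phi> x \<partial>lborel) = - (\<integral>x. g x * \<phi> x \<partial>lborel))"

lemma has_weak_deriv_version:
  assumes U: "open U" and f: "borel_version U f f'" and g: "borel_version U g g'" and b: "b \<in> Basis"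
  shows "has_weak_deriv U b f g \<longleftrightarrow> weak_partial U b f' g'"
proof -
  have UB: "U \<in> sets borel" using U by simp
  have "(\<integral>z. f z * partial_deriv b \<phi> z \<partial>lebesgue_on U) = (\<integral>x. f' x * partial_deriv b \<phi> x \<partial>lborel)"
    "(\<integral>z. g z * \<phi> z \<partial>lebesgue_on U) = (\<integral>x. g' x * \<phi> x \<partial>lborel)" if \<phi>: "\<phi> \<in> test_functions U" for \<phi>
  proof -
    note D = test_functionsD[OF \<phi>]
    have z: "\<phi> x = 0" "partial_deriv b \<phi> x = 0" if "x \<notin> U" for x
      using not_in_supp[of x \<phi>] partial_deriv_not_in_supp[of x \<phi> b] D(3) that by blast+
    show "(\<integral>z. f z * partial_deriv b \<phi> z \<partial>lebesgue_on U) = (\<integral>x. f' x * partial_deriv b \<phi> x \<partial>lborel)"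
      by (rule lebesgue_on_version_supported(1)[OF borel_version_mult[OF f borel_version_smooth[OF smooth_partial[OF D(1) b]]] UB])
        (simp add: z)
    show "(\<integral>z. g z * \<phi> z \<partial>lebesgue_on U) = (\<integral>x. g' x * \<phi> x \<partial>lborel)"
      by (rule lebesgue_on_version_supported(1)[OF borel_version_mult[OF g borel_version_smooth[OF D(1)]] UB])
        (simp add: z)
  qed
  then show ?thesis
    unfolding has_weak_deriv_def weak_partial_def loc_integrable_on_version[OF f] loc_integrable_on_version[OF g]
    by simp
qed

lemma has_weak_deriv_imp_versions:
  assumes U: "open U" and w: "has_weak_deriv U b f g"
  shows "\<exists>f'. borel_version U f f'" "\<exists>g'. borel_version U g g'"
  using w loc_integrable_measurable[OF U] ex_borel_version[of _ U] U
  by (auto simp: has_weak_deriv_def)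

text \<open>The fundamental lemma on an open set: multiplied by a cutoff that is 1 on a compact
  piece, \<open>d\<close> becomes integrable on the whole space, and countably many pieces exhaust
  \<open>U\<close>.\<close>

lemma AE_eq_0_on_of_test_functions:
  assumes U: "open U" and d: "loc_int U d"
    and t: "\<And>\<phi>. \<phi> \<in> test_functions U \<Longrightarrow> (\<integral>x. d x * \<phi> x \<partial>lborel) = 0"
  shows "AE x in lborel. x \<in> U \<longrightarrow> d x = 0"
proof -
  obtain C :: "nat \<Rightarrow> 'a set" where C': "\<forall>n. compact (C n) \<and> C n \<subseteq> U \<and> C n \<subseteq> C (Suc n)" and CU: "\<Union>(range C) = U"
    using open_compact_exhaustion[OF U] by blast
  note C = C'[rule_format, THEN conjunct1] C'[rule_format, THEN conjunct2, THEN conjunct1]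
    C'[rule_format, THEN conjunct2, THEN conjunct2] CU
  have "AE x in lborel. x \<in> C n \<longrightarrow> d x = 0" for n :: nat
  proof -
    obtain \<zeta> where \<zeta>: "\<zeta> \<in> test_functions U" "\<exists>V. open V \<and> C n \<subseteq> V \<and> (\<forall>x\<in>V. \<zeta> x = 1)"
      using smooth_cutoff[OF C(1)[of n] U C(2)[of n]] by blast
    have "AE x in lborel. d x * \<zeta> x = 0"
    proof (rule AE_eq_0_of_test_functions[OF loc_int_test[OF d \<zeta>(1)]])
      fix \<phi> :: "'a \<Rightarrow> real" assume "\<phi> \<in> test_functions UNIV"
      then have "(\<integral>x. d x * (\<phi> x * \<zeta> x) \<partial>lborel) = 0"
        by (intro t test_functions_mult[OF \<zeta>(1)] test_functionsD(1))
      then show "(\<integral>x. d x * \<zeta> x * \<phi> x \<partial>lborel) = 0" by (simp add: mult_ac)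
    qed
    then show ?thesis
    proof eventually_elim
      case (elim x)
      then show ?case using \<zeta>(2) by auto
    qed
  qed
  then have "AE x in lborel. \<forall>n. x \<in> C n \<longrightarrow> d x = 0" unfolding AE_all_countable by blast
  then show ?thesis by eventually_elim (use C(4) in blast)
qed

lemma loc_int_add: "loc_int U f \<Longrightarrow> loc_int U g \<Longrightarrow> loc_int U (\<lambda>x. f x + g x)"
  by (auto simp: loc_int_def distrib_left)

lemma loc_int_cmult: "loc_int U f \<Longrightarrow> loc_int U (\<lambda>x. c * f x)"
proof -
  assume "loc_int U f"
  then have "integrable lborel (\<lambda>x. c * (indicator K x * f x))" if "compact K" "K \<subseteq> U" for K
    using that unfolding loc_int_def by (intro integrable_mult_right) blast
  then show ?thesis by (simp add: loc_int_def mult.left_commute)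
qed

lemma loc_int_diff: "loc_int U f \<Longrightarrow> loc_int U g \<Longrightarrow> loc_int U (\<lambda>x. f x - g x)"
  using loc_int_add[OF _ loc_int_cmult[of U g "-1"]] by simp

lemma loc_int_mono: "loc_int U f \<Longrightarrow> V \<subseteq> U \<Longrightarrow> loc_int V f"
  by (auto simp: loc_int_def)

lemma loc_int_continuous:
  assumes "continuous_on UNIV f"
  shows "loc_int U f"
  unfolding loc_int_def
proof (intro allI impI)
  fix K :: "'a set" assume K: "compact K \<and> K \<subseteq> U"
  have [measurable]: "f \<in> borel_measurable borel" by (rule borel_measurable_continuous_onI[OF assms])
  have "bounded (f ` K)"
    using K by (intro compact_imp_bounded compact_continuous_image continuous_on_subset[OF assms]) auto
  then obtain B where B: "\<forall>x\<in>K. \<bar>f x\<bar> \<le> B" unfolding bounded_iff by auto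
  have [measurable]: "K \<in> sets borel" using K compact_imp_closed borel_closed by blast
  have "integrable lborel (\<lambda>x. indicator K x *\<^sub>R f x)"
    by (rule integrableI_bounded_set_indicator[where B=B])
      (use B K emeasure_bounded_finite[OF compact_imp_bounded[of K]] in auto)
  then show "integrable lborel (\<lambda>x. indicator K x * f x)" by simp
qed

lemma weak_partial_unique:
  assumes U: "open U" and 1: "weak_partial U b f g1" and 2: "weak_partial U b f g2"
  shows "AE x in lborel. x \<in> U \<longrightarrow> g1 x = g2 x"
proof -
  have l: "loc_int U g1" "loc_int U g2" using 1 2 by (auto simp: weak_partial_def)
  have "AE x in lborel. x \<in> U \<longrightarrow> g1 x - g2 x = 0"
  proof (rule AE_eq_0_on_of_test_functions[OF U loc_int_diff[OF l]])
    fix \<phi> assume \<phi>: "\<phi> \<in> test_functions U"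
    have "(\<integral>x. g1 x * \<phi> x \<partial>lborel) = (\<integral>x. g2 x * \<phi> x \<partial>lborel)"
      using 1 2 \<phi> by (simp add: weak_partial_def)
    then show "(\<integral>x. (g1 x - g2 x) * \<phi> x \<partial>lborel) = 0"
      using loc_int_test[OF l(1) \<phi>] loc_int_test[OF l(2) \<phi>] by (simp add: left_diff_distrib)
  qed
  then show ?thesis by eventually_elim simp
qed

lemma weak_partial_mono: "weak_partial U b f g \<Longrightarrow> V \<subseteq> U \<Longrightarrow> weak_partial V b f g"
  unfolding weak_partial_def using loc_int_mono test_functions_mono by blast

lemma weak_partial_add:
  assumes b: "b \<in> Basis" and 1: "weak_partial U b f1 g1" and 2: "weak_partial U b f2 g2"
  shows "weak_partial U b (\<lambda>x. f1 x + f2 x) (\<lambda>x. g1 x + g2 x)"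
  unfolding weak_partial_def
proof (intro conjI ballI loc_int_add)
  have l: "loc_int U f1" "loc_int U f2" "loc_int U g1" "loc_int U g2" using 1 2 by (auto simp: weak_partial_def)
  then show "loc_int U f1" "loc_int U f2" "loc_int U g1" "loc_int U g2" by auto
  fix \<phi> assume \<phi>: "\<phi> \<in> test_functions U"
  then have "(\<integral>x. f1 x * partial_deriv b \<phi> x \<partial>lborel) = - (\<integral>x. g1 x * \<phi> x \<partial>lborel)"
    "(\<integral>x. f2 x * partial_deriv b \<phi> x \<partial>lborel) = - (\<integral>x. g2 x * \<phi> x \<partial>lborel)"
    using 1 2 by (auto simp: weak_partial_def)
  then show "(\<integral>x. (f1 x + f2 x) * partial_deriv b \<phi> x \<partial>lborel) = - (\<integral>x. (g1 x + g2 x) * \<phi> x \<partial>lborel)"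
    using loc_int_test[OF l(1) test_functions_partial[OF \<phi> b]] loc_int_test[OF l(2) test_functions_partial[OF \<phi> b]]
      loc_int_test[OF l(3) \<phi>] loc_int_test[OF l(4) \<phi>] by (simp add: distrib_right)
qed

lemma weak_partial_cmult:
  assumes "weak_partial U b f g"
  shows "weak_partial U b (\<lambda>x. c * f x) (\<lambda>x. c * g x)"
  using assms by (auto simp: weak_partial_def loc_int_cmult mult.assoc)

lemma weak_partial_smooth:
  assumes "smooth f" "b \<in> Basis"
  shows "weak_partial U b f (partial_deriv b f)"
  unfolding weak_partial_def
  using integral_by_parts[OF assms(1) _ assms(2)] loc_int_continuous smooth_continuous assms smooth_partial by metis

lemma weak_partial_cong_AE:
  assumes w: "weak_partial U b f g" and U: "U \<in> sets borel" and b: "b \<in> Basis"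
    and [measurable]: "f \<in> borel_measurable borel" "g \<in> borel_measurable borel" "f' \<in> borel_measurable borel" "g' \<in> borel_measurable borel"
    and f: "AE x in lborel. x \<in> U \<longrightarrow> f x = f' x" and g: "AE x in lborel. x \<in> U \<longrightarrow> g x = g' x"
  shows "weak_partial U b f' g'"
proof -
  have l: "loc_int U h'" if "loc_int U h" and [measurable]: "h \<in> borel_measurable borel" "h' \<in> borel_measurable borel"
    and ae: "AE x in lborel. x \<in> U \<longrightarrow> h x = h' x" for h h'
    unfolding loc_int_def
  proof (intro allI impI)
    fix K assume K: "compact K \<and> K \<subseteq> U"
    have [measurable]: "K \<in> sets borel" using K compact_imp_closed borel_closed by blast
    have "integrable lborel (\<lambda>x. indicator K x * h x)" using that(1) K unfolding loc_int_def by blast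
    moreover have "AE x in lborel. indicator K x * h x = indicator K x * h' x"
      using ae by eventually_elim (use K in \<open>auto simp: indicator_def\<close>)
    ultimately show "integrable lborel (\<lambda>x. indicator K x * h' x)"
      by (subst (asm) integrable_cong_AE[where g="\<lambda>x. indicator K x * h' x"]) auto
  qed
  have i: "(\<integral>x. h x * \<phi> x \<partial>lborel) = (\<integral>x. h' x * \<phi> x \<partial>lborel)"
    if \<phi>: "\<phi> \<in> test_functions U" and [measurable]: "h \<in> borel_measurable borel" "h' \<in> borel_measurable borel"
    and ae: "AE x in lborel. x \<in> U \<longrightarrow> h x = h' x" for h h' \<phi>
  proof (rule integral_cong_AE)
    note [measurable] = smooth_borel[OF test_functionsD(1)[OF \<phi>]]
    show "(\<lambda>x. h x * \<phi> x) \<in> borel_measurable lborel" "(\<lambda>x. h' x * \<phi> x) \<in> borel_measurable lborel" by measurable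
    show "AE x in lborel. h x * \<phi> x = h' x * \<phi> x"
      using ae
    proof eventually_elim
      case (elim x)
      then show ?case using not_in_supp[of x \<phi>] test_functionsD(3)[OF \<phi>] by (cases "x \<in> U") auto
    qed
  qed
  show ?thesis
    unfolding weak_partial_def
  proof (intro conjI ballI)
    show "loc_int U f'" "loc_int U g'" using w l f g by (auto simp: weak_partial_def)
    fix \<phi> assume \<phi>: "\<phi> \<in> test_functions U"
    show "(\<integral>x. f' x * partial_deriv b \<phi> x \<partial>lborel) = - (\<integral>x. g' x * \<phi> x \<partial>lborel)"
      using w \<phi> i[OF test_functions_partial[OF \<phi> b] _ _ f] i[OF \<phi> _ _ g] by (simp add: weak_partial_def)
  qed
qed

text \<open>Once some weak derivative exists, the choice made by \<open>weak_deriv\<close> is one,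
  and uniqueness identifies it almost everywhere with \<open>g\<close>. This is what allows
  \<open>dt\<close> and \<open>grad_x\<close> to be replaced by explicit representatives.\<close>

lemma weak_deriv_version:
  assumes U: "open U" and b: "b \<in> Basis" and f: "borel_version U f f'"
    and [measurable]: "g \<in> borel_measurable borel" and w: "weak_partial U b f' g"
  shows "borel_version U (weak_deriv U b f) g" "has_weak_deriv U b f (weak_deriv U b f)"
proof -
  have "has_weak_deriv U b f g"
    using w has_weak_deriv_version[OF U f borel_version_refl[of g U] b] by simp
  then show h: "has_weak_deriv U b f (weak_deriv U b f)" unfolding weak_deriv_def
    by (rule someI[where P="has_weak_deriv U b f"])
  obtain d where d: "borel_version U (weak_deriv U b f) d" using has_weak_deriv_imp_versions(2)[OF U h] by blast
  have "weak_partial U b f' d" using h has_weak_deriv_version[OF U f d b] by simp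
  then have "AE x in lborel. x \<in> U \<longrightarrow> d x = g x" using weak_partial_unique[OF U _ w] by blast
  then have "AE x in lborel. x \<in> U \<longrightarrow> weak_deriv U b f x = g x"
    using borel_versionD(2)[OF d] by eventually_elim auto
  then show "borel_version U (weak_deriv U b f) g" by (simp add: borel_version_def)
qed

text \<open>By uniqueness the local derivatives agree almost everywhere on overlaps, and a compact
  support fits into a single \<open>V n\<close>.\<close>

lemma weak_partial_glue:
  fixes V :: "nat \<Rightarrow> 'b::euclidean_space set"
  assumes V: "\<And>n. open (V n)" "\<And>m n. m \<le> n \<Longrightarrow> V m \<subseteq> V n" and b: "b \<in> Basis"
    and f[measurable]: "f \<in> borel_measurable borel" and g[measurable]: "\<And>n. g n \<in> borel_measurable borel"
    and w: "\<And>n. weak_partial (V n) b f (g n)"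
  shows "\<exists>G\<in>borel_measurable borel. weak_partial (\<Union>n. V n) b f G"
proof -
  have [measurable]: "V n \<in> sets borel" for n using V(1) by simp
  \<comment> \<open>At almost every point of the union this sequence is eventually constant, so the
    limit merely selects the common value in a measurable way.\<close>
  define G where "G = (\<lambda>x. lim (\<lambda>n. indicator (V n) x * g n x))"
  have [measurable]: "G \<in> borel_measurable borel" unfolding G_def by (rule borel_measurable_lim_metric) measurable
  have ae: "AE x in lborel. \<forall>m n. m \<le> n \<longrightarrow> x \<in> V m \<longrightarrow> g m x = g n x"
    unfolding AE_all_countable
  proof (intro allI)
    fix m n
    show "AE x in lborel. m \<le> n \<longrightarrow> x \<in> V m \<longrightarrow> g m x = g n x"
    proof (cases "m \<le> n")
      case True
      show ?thesis
        using weak_partial_unique[OF V(1) w[of m] weak_partial_mono[OF w[of n] V(2)[OF True]]] by eventually_elim simp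
    qed simp
  qed
  have G: "AE x in lborel. \<forall>m. x \<in> V m \<longrightarrow> g m x = G x"
    using ae
  proof eventually_elim
    case (elim x)
    show ?case
    proof (intro allI impI)
      fix m assume m: "x \<in> V m"
      have "\<forall>\<^sub>F n in sequentially. indicator (V n) x * g n x = g m x"
      proof (rule eventually_sequentiallyI[of m])
        fix n assume n: "m \<le> n"
        then have "x \<in> V n" "g m x = g n x" using V(2)[OF n] m elim by auto
        then show "indicator (V n) x * g n x = g m x" by simp
      qed
      then have "(\<lambda>n. indicator (V n) x * g n x) \<longlonglongrightarrow> g m x" by (rule tendsto_eventually)
      then show "g m x = G x" by (simp add: G_def limI)
    qed
  qed
  have wG: "weak_partial (V n) b f G" for n
    by (rule weak_partial_cong_AE[OF w[of n] _ b f g f]) (use G in \<open>auto elim!: eventually_mono\<close>)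
  have cpt: "\<exists>n. K \<subseteq> V n" if K: "compact K" "K \<subseteq> (\<Union>n. V n)" for K
  proof -
    obtain N where N: "finite N" "K \<subseteq> (\<Union>n\<in>N. V n)"
      using compactE_image[OF K(1), of UNIV V] V(1) K(2) by auto
    have "V n \<subseteq> V (Max N)" if "n \<in> N" for n using V(2) N(1) that by simp
    then show ?thesis using N(2) by blast
  qed
  have "weak_partial (\<Union>n. V n) b f G"
    unfolding weak_partial_def
  proof (intro conjI ballI)
    show "loc_int (\<Union>n. V n) f" "loc_int (\<Union>n. V n) G"
      using cpt wG unfolding loc_int_def weak_partial_def by meson+
    fix \<phi> assume \<phi>: "\<phi> \<in> test_functions (\<Union>n. V n)"
    obtain n where n: "supp \<phi> \<subseteq> V n" using cpt test_functionsD(2,3)[OF \<phi>] by blast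
    have "\<phi> \<in> test_functions (V n)"
      by (rule test_functionsI[OF test_functionsD(1,2)[OF \<phi>] n]) (rule not_in_supp)
    then show "(\<integral>x. f x * partial_deriv b \<phi> x \<partial>lborel) = - (\<integral>x. G x * \<phi> x \<partial>lborel)"
      using wG unfolding weak_partial_def by blast
  qed
  then show ?thesis by (intro bexI[of _ G]) auto
qed

lemma Lp2_version:
  assumes f: "borel_version U f f'" and U: "U \<in> sets borel"
  shows "f \<in> Lp_on 2 U \<longleftrightarrow> sq_integrable (\<lambda>x. indicator U x * f' x)"
proof -
  note [measurable] = borel_versionD(1)[OF f] U
  have "borel_version U (\<lambda>x. (f x)\<^sup>2) (\<lambda>x. (f' x)\<^sup>2)" by (rule borel_version_comp[OF f]) measurable
  note i = lebesgue_on_version(2)[OF this U]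
  have "\<bar>x\<bar> powr 2 = x\<^sup>2" for x :: real by (simp add: powr_numeral)
  moreover have "indicator U x * (f' x)\<^sup>2 = (indicator U x * f' x)\<^sup>2" for x by (simp add: indicator_def)
  ultimately show ?thesis
    using borel_version_measurable[OF f U] i by (simp add: Lp_on_def sq_integrable_def)
qed

section \<open>Space-time cylinders and the energy\<close>

text \<open>Leibniz rule, obtained by testing with \<open>\<phi> * \<zeta>\<close>. The cutoff also
  extends the functions by 0 from \<open>U\<close> to the whole space, where they can be
  mollified.\<close>

lemma weak_partial_cutoff:
  assumes w: "weak_partial U b f g" and b: "b \<in> Basis" and \<zeta>: "\<zeta> \<in> test_functions U"
  shows "weak_partial UNIV b (\<lambda>x. \<zeta> x * f x) (\<lambda>x. \<zeta> x * g x + partial_deriv b \<zeta> x * f x)"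
  unfolding weak_partial_def
proof (intro conjI ballI)
  have l: "loc_int U f" "loc_int U g" using w by (auto simp: weak_partial_def)
  note sz = test_functionsD(1)[OF \<zeta>]
  note t\<zeta> = test_functions_partial[OF \<zeta> b]
  have loc: "loc_int UNIV (\<lambda>x. \<tau> x * h x)" if h: "loc_int U h" and \<tau>: "\<tau> \<in> test_functions U" for \<tau> h
    unfolding loc_int_def
  proof (intro allI impI)
    fix K :: "'a set" assume K: "compact K \<and> K \<subseteq> UNIV"
    then have [measurable]: "K \<in> sets borel" using compact_imp_closed borel_closed by blast
    have "integrable lborel (\<lambda>x. indicator K x * (h x * \<tau> x))"
      by (rule integrable_bounded_mult[OF loc_int_test[OF h \<tau>], where B=1]) (auto simp: indicator_def)
    then show "integrable lborel (\<lambda>x. indicator K x * (\<tau> x * h x))" by (simp add: mult.commute[of "\<tau> _"])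
  qed
  show "loc_int UNIV (\<lambda>x. \<zeta> x * f x)" by (rule loc[OF l(1) \<zeta>])
  show "loc_int UNIV (\<lambda>x. \<zeta> x * g x + partial_deriv b \<zeta> x * f x)"
    by (rule loc_int_add[OF loc[OF l(2) \<zeta>] loc[OF l(1) t\<zeta>]])
  fix \<phi> :: "'a \<Rightarrow> real" assume \<phi>: "\<phi> \<in> test_functions UNIV"
  note s\<phi> = test_functionsD(1)[OF \<phi>]
  have t: "(\<lambda>x. \<phi> x * \<zeta> x) \<in> test_functions U" by (rule test_functions_mult[OF \<zeta> s\<phi>])
  have t1: "(\<lambda>x. partial_deriv b \<phi> x * \<zeta> x) \<in> test_functions U"
    by (rule test_functions_mult[OF \<zeta> smooth_partial[OF s\<phi> b]])
  have t2: "(\<lambda>x. \<phi> x * partial_deriv b \<zeta> x) \<in> test_functions U" by (rule test_functions_mult[OF t\<zeta> s\<phi>])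
  have p: "partial_deriv b (\<lambda>x. \<phi> x * \<zeta> x) x = partial_deriv b \<phi> x * \<zeta> x + \<phi> x * partial_deriv b \<zeta> x" for x
    by (rule partial_deriv_mult[OF smooth_differentiable[OF s\<phi>] smooth_differentiable[OF sz]])
  note i1 = loc_int_test[OF l(1) t1] and i2 = loc_int_test[OF l(1) t2] and i3 = loc_int_test[OF l(2) t]
  have "(\<integral>x. f x * partial_deriv b (\<lambda>x. \<phi> x * \<zeta> x) x \<partial>lborel) = - (\<integral>x. g x * (\<phi> x * \<zeta> x) \<partial>lborel)"
    using w t unfolding weak_partial_def by blast
  then have "(\<integral>x. f x * (partial_deriv b \<phi> x * \<zeta> x) \<partial>lborel) + (\<integral>x. f x * (\<phi> x * partial_deriv b \<zeta> x) \<partial>lborel)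
      = - (\<integral>x. g x * (\<phi> x * \<zeta> x) \<partial>lborel)"
    unfolding p distrib_left using i1 i2 by simp
  moreover have "(\<integral>x. (\<zeta> x * g x + partial_deriv b \<zeta> x * f x) * \<phi> x \<partial>lborel) =
     (\<integral>x. g x * (\<phi> x * \<zeta> x) \<partial>lborel) + (\<integral>x. f x * (\<phi> x * partial_deriv b \<zeta> x) \<partial>lborel)"
    using Bochner_Integration.integral_add[OF i3 i2] by (simp add: algebra_simps)
  ultimately show "(\<integral>x. \<zeta> x * f x * partial_deriv b \<phi> x \<partial>lborel)
      = - (\<integral>x. (\<zeta> x * g x + partial_deriv b \<zeta> x * f x) * \<phi> x \<partial>lborel)"
    by (simp add: mult_ac)
qed

section \<open>Coordinates and cylinders in space-time\<close>

lemma time_Basis: "(0, 1) \<in> (Basis :: ('a::euclidean_space \<times> real) set)"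
  by (simp add: Basis_prod_def)

lemma space_Basis: "i \<in> Basis \<Longrightarrow> (i, 0) \<in> (Basis :: ('a::euclidean_space \<times> real) set)"
  by (simp add: Basis_prod_def)

lemma sum_Basis_space_time:
  "(\<Sum>b\<in>(Basis :: ('a::euclidean_space \<times> real) set). f b) = (\<Sum>i\<in>Basis. f (i, 0)) + f (0, 1)"
proof -
  have "(\<Sum>b\<in>(Basis :: ('a \<times> real) set). f b) = (\<Sum>b\<in>(\<lambda>u. (u, 0)) ` (Basis :: 'a set). f b) + (\<Sum>b\<in>{(0, 1)}. f b)"
    unfolding Basis_prod_def by (subst sum.union_disjoint) auto
  also have "(\<Sum>b\<in>(\<lambda>u. (u, 0)) ` (Basis :: 'a set). f b) = (\<Sum>i\<in>Basis. f (i, 0))"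
    by (subst sum.reindex) (auto intro: inj_onI)
  finally show ?thesis by simp
qed

lemma Basis_space_time_cases:
  assumes "b \<in> (Basis :: ('a::euclidean_space \<times> real) set)"
  obtains "b = (0, 1)" | i where "i \<in> Basis" "b = (i, 0)"
  using assms by (auto simp: Basis_prod_def)

lemma open_Q_cyl: "open (Q_cyl r)" unfolding Q_cyl_def by (intro open_Times) auto
lemma open_Q_all: "open Q_all" unfolding Q_all_def by (intro open_Times) auto

lemma borel_Q_cyl [measurable]: "Q_cyl r \<in> sets borel" by (rule borel_open[OF open_Q_cyl])
lemma borel_Q_all [measurable]: "Q_all \<in> sets borel" by (rule borel_open[OF open_Q_all])

lemma Q_cyl_mono: "0 \<le> r \<Longrightarrow> r \<le> s \<Longrightarrow> Q_cyl r \<subseteq> Q_cyl s"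
proof -
  assume "0 \<le> r" "r \<le> s"
  then have "r\<^sup>2 \<le> s\<^sup>2" by (intro power_mono)
  with \<open>r \<le> s\<close> show "Q_cyl r \<subseteq> Q_cyl s" by (auto simp: Q_cyl_def)
qed

lemma Q_cyl_subset: "Q_cyl r \<subseteq> Q_all" by (auto simp: Q_cyl_def Q_all_def)

lemma UN_Q_cyl: "(\<Union>n. Q_cyl (real (Suc n))) = (Q_all :: ('a::euclidean_space \<times> real) set)"
proof (intro equalityI subsetI)
  fix z :: "'a \<times> real" assume "z \<in> Q_all"
  then obtain x t where z: "z = (x, t)" "t > 0" by (auto simp: Q_all_def)
  obtain n where n: "max (norm x) t < real n" using reals_Archimedean2 by blast
  \<comment> \<open>The height of a cylinder is the square of its radius, which is no smaller than
    the radius when the latter is at least 1.\<close>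
  have "real (Suc n) \<le> (real (Suc n))\<^sup>2" by (simp add: power2_eq_square)
  then have "z \<in> Q_cyl (real (Suc n))" using n z by (auto simp: Q_cyl_def)
  then show "z \<in> (\<Union>n. Q_cyl (real (Suc n)))" by blast
qed (use Q_cyl_subset in blast)

text \<open>In the energy \<open>t\<close> is the outer variable, whereas Fubini for null sets
  yields \<open>x\<close> as the outer one. Passing to a Borel null set \<open>N\<close> provides
  the measurability needed to exchange the order.\<close>

lemma lborel_AE_swap:
  fixes P :: "'a::euclidean_space \<times> real \<Rightarrow> bool"
  assumes "AE z in lborel. P z"
  shows "AE t in lborel. AE x in lborel. P (x, t)"
proof -
  obtain N where N': "{z \<in> space lborel. \<not> P z} \<subseteq> N" "emeasure lborel N = 0" "N \<in> sets (lborel :: ('a \<times> real) measure)"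
    using AE_E[OF assms] by blast
  then have N: "N \<in> sets (lborel :: ('a \<times> real) measure)" "emeasure lborel N = 0" "{z. \<not> P z} \<subseteq> N" by auto
  have Nb[measurable]: "N \<in> sets (lborel \<Otimes>\<^sub>M lborel)" using N(1) unfolding lborel_prod .
  have "AE z in lborel. z \<notin> N" using N(1,2) by (intro AE_not_in null_setsI) auto
  then have "AE z in (lborel :: 'a measure) \<Otimes>\<^sub>M (lborel :: real measure). z \<notin> N" unfolding lborel_prod .
  then have "AE x in lborel. AE t in lborel. (x, t) \<notin> N" by (rule lborel_pair.AE_pair)
  moreover have "{z \<in> space (lborel \<Otimes>\<^sub>M lborel). (fst z, snd z) \<notin> N} \<in> sets (lborel \<Otimes>\<^sub>M lborel)"
    by measurable
  ultimately have "AE t in lborel. AE x in lborel. (x, t) \<notin> N"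
    by (subst (asm) lborel_pair.AE_commute) (auto simp: space_pair_measure)
  then show ?thesis
  proof eventually_elim
    case (elim t)
    then show ?case by eventually_elim (use N(3) in blast)
  qed
qed

lemma lborel_AE_fst:
  fixes P :: "'a::euclidean_space \<Rightarrow> bool"
  assumes "AE x in lborel. P x"
  shows "AE z in (lborel :: ('a \<times> real) measure). P (fst z)"
proof -
  obtain N where N': "{z \<in> space lborel. \<not> P z} \<subseteq> N" "emeasure lborel N = 0" "N \<in> sets (lborel :: 'a measure)"
    using AE_E[OF assms] by blast
  then have N: "N \<in> sets (lborel :: 'a measure)" "emeasure lborel N = 0" "{z. \<not> P z} \<subseteq> N" by auto
  have "N \<times> (UNIV :: real set) \<in> null_sets (lborel \<Otimes>\<^sub>M lborel)"
    using N(1,2) by (intro lborel.times_in_null_sets1) (auto intro: null_setsI)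
  then have "AE z in (lborel :: ('a \<times> real) measure). z \<notin> N \<times> UNIV"
    by (intro AE_not_in) (simp add: lborel_prod)
  then show ?thesis by eventually_elim (use N(3) in auto)
qed

lemma measurable_fst_borel [measurable]: "fst \<in> borel_measurable (borel :: ('a::euclidean_space \<times> real) measure)"
  by (intro borel_measurable_continuous_onI continuous_intros)

lemma measurable_snd_borel [measurable]: "snd \<in> borel_measurable (borel :: ('a::euclidean_space \<times> real) measure)"
  by (intro borel_measurable_continuous_onI continuous_intros)

section \<open>Functions of the space variable regarded on space-time\<close>

lemma integrable_product:
  fixes f :: "'a::euclidean_space \<Rightarrow> real" and g :: "real \<Rightarrow> real"
  assumes f: "integrable lborel f" and g: "integrable lborel g"
  shows "integrable lborel (\<lambda>z. f (fst z) * g (snd z))"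
proof -
  note [measurable] = borel_measurable_integrable[OF f, unfolded measurable_lborel1]
    borel_measurable_integrable[OF g, unfolded measurable_lborel1]
  have "integrable (lborel \<Otimes>\<^sub>M lborel) (\<lambda>(x, y). f x * g y)"
    by (rule lborel_pair.Fubini_integrable) (use f g in \<open>auto simp: abs_mult\<close>)
  then show ?thesis by (simp add: lborel_prod case_prod_beta')
qed

lemma loc_int_fst:
  fixes f :: "'a::euclidean_space \<Rightarrow> real"
  assumes f: "loc_int UNIV f"
  shows "loc_int UNIV (\<lambda>z::'a \<times> real. f (fst z))"
  unfolding loc_int_def
proof (intro allI impI)
  fix K :: "('a \<times> real) set" assume K: "compact K \<and> K \<subseteq> UNIV"
  then have [measurable]: "K \<in> sets borel" using compact_imp_closed borel_closed by blast
  have "compact (fst ` K)" "compact (snd ` K)"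
    using K by (auto intro!: compact_continuous_image continuous_intros)
  then have i: "integrable lborel (\<lambda>x. indicator (fst ` K) x * f x)" "integrable lborel (indicator (snd ` K) :: real \<Rightarrow> real)"
    using f emeasure_bounded_finite[OF compact_imp_bounded[of "snd ` K"]] compact_imp_closed[of "snd ` K"]
    by (auto simp: loc_int_def intro!: integrable_real_indicator)
  \<comment> \<open>\<open>K\<close> is contained in the product of its two projections, on which
    integrability is a statement about products.\<close>
  have "integrable lborel (\<lambda>z. indicator K z * (indicator (fst ` K) (fst z) * f (fst z) * indicator (snd ` K) (snd z)))"
    by (rule integrable_bounded_mult[OF integrable_product[OF i], where B=1]) (auto simp: indicator_def)
  moreover have "indicator K z * (indicator (fst ` K) (fst z) * f (fst z) * indicator (snd ` K) (snd z)) = indicator K z * f (fst z)" for z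
    by (auto simp: indicator_def)
  ultimately show "integrable lborel (\<lambda>z. indicator K z * f (fst z))" by simp
qed

lemma smooth_section:
  fixes \<phi> :: "'a::euclidean_space \<times> real \<Rightarrow> real"
  assumes "smooth \<phi>"
  shows "smooth (\<lambda>x. \<phi> (x, t))" "partial_deriv i (\<lambda>x. \<phi> (x, t)) x = partial_deriv (i, 0) \<phi> (x, t)"
    "smooth (\<lambda>t. \<phi> (x, t))" "partial_deriv 1 (\<lambda>t. \<phi> (x, t)) t = partial_deriv (0, 1) \<phi> (x, t)"
proof -
  have 1: "((\<lambda>x. (x, t)) has_derivative (\<lambda>h. (h, 0))) (at y)" for y :: 'a
    by (intro derivative_eq_intros) auto
  have 2: "((\<lambda>t. (x, t)) has_derivative (\<lambda>h. (0, h))) (at s)" for s :: real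
    by (intro derivative_eq_intros) auto
  show "smooth (\<lambda>x. \<phi> (x, t))" by (rule smooth_linear_comp(1)[OF assms 1]) (auto intro: space_Basis)
  show "partial_deriv i (\<lambda>x. \<phi> (x, t)) x = partial_deriv (i, 0) \<phi> (x, t)"
    by (rule smooth_linear_comp(2)[OF assms 1]) (auto intro: space_Basis)
  show "smooth (\<lambda>t. \<phi> (x, t))" by (rule smooth_linear_comp(1)[OF assms 2]) (auto intro: time_Basis)
  show "partial_deriv 1 (\<lambda>t. \<phi> (x, t)) t = partial_deriv (0, 1) \<phi> (x, t)"
    by (rule smooth_linear_comp(2)[OF assms 2]) (auto intro: time_Basis)
qed

lemma smooth_fst:
  fixes \<phi> :: "'a::euclidean_space \<Rightarrow> real"
  assumes "smooth \<phi>"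
  shows "smooth (\<lambda>z::'a \<times> real. \<phi> (fst z))"
    "partial_deriv b (\<lambda>z::'a \<times> real. \<phi> (fst z)) z = partial_deriv (fst b) \<phi> (fst z)"
proof -
  have 1: "(fst has_derivative fst) (at y)" for y :: "'a \<times> real"
    by (intro derivative_eq_intros) auto
  have 2: "fst b \<in> insert 0 Basis" if "b \<in> Basis" for b :: "'a \<times> real"
    using that by (auto simp: Basis_prod_def)
  show "smooth (\<lambda>z::'a \<times> real. \<phi> (fst z))" by (rule smooth_linear_comp(1)[OF assms 1 2])
  show "partial_deriv b (\<lambda>z::'a \<times> real. \<phi> (fst z)) z = partial_deriv (fst b) \<phi> (fst z)"
    by (rule smooth_linear_comp(2)[OF assms 1 2])
qed

lemma test_functions_section:
  fixes \<phi> :: "'a::euclidean_space \<times> real \<Rightarrow> real"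
  assumes \<phi>: "\<phi> \<in> test_functions UNIV"
  shows "(\<lambda>x. \<phi> (x, t)) \<in> test_functions UNIV" "(\<lambda>t. \<phi> (x, t)) \<in> test_functions UNIV"
proof -
  obtain R where R: "\<forall>z. norm z > R \<longrightarrow> \<phi> z = 0" using test_functions_ball[OF \<phi>] by meson
  have "\<phi> (x, t) = 0" if "norm x > R" for x t
    using R norm_fst_le[of x t] that by fastforce
  then show "(\<lambda>x. \<phi> (x, t)) \<in> test_functions UNIV"
    by (rule test_functions_UNIV_ballI[OF smooth_section(1)[OF test_functionsD(1)[OF \<phi>]]])
  have "\<phi> (x, t) = 0" if "norm t > R" for x t
    using R norm_snd_le[of t x] that by fastforce
  then show "(\<lambda>t. \<phi> (x, t)) \<in> test_functions UNIV"
    by (rule test_functions_UNIV_ballI[OF smooth_section(3)[OF test_functionsD(1)[OF \<phi>]]])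
qed

lemma test_functions_partial_integral_0:
  assumes "\<phi> \<in> test_functions UNIV" "b \<in> Basis"
  shows "(\<integral>x. partial_deriv b \<phi> x \<partial>lborel) = 0"
  using integral_by_parts[OF smooth_const assms, of 1] by simp

text \<open>Fubini's theorem in both orders: at fixed \<open>t\<close> the section of a test
  function is a test function in \<open>x\<close>, and at fixed \<open>x\<close> the time derivative
  of a test function integrates to 0.\<close>

lemma weak_partial_fst:
  fixes f g :: "'a::euclidean_space \<Rightarrow> real"
  assumes i: "i \<in> Basis" and w: "weak_partial UNIV i f g"
  shows "weak_partial UNIV (i, 0) (\<lambda>z::'a \<times> real. f (fst z)) (\<lambda>z. g (fst z))"
    and "weak_partial UNIV (0, 1) (\<lambda>z::'a \<times> real. f (fst z)) (\<lambda>z. 0)"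
proof -
  have l: "loc_int UNIV (\<lambda>z::'a \<times> real. f (fst z))" "loc_int UNIV (\<lambda>z::'a \<times> real. g (fst z))"
    using w by (auto simp: weak_partial_def intro: loc_int_fst)
  have l0: "loc_int UNIV (\<lambda>z::'a \<times> real. 0)" by (simp add: loc_int_def)
  have F: "integrable (lborel \<Otimes>\<^sub>M lborel) (\<lambda>(x, t). h (fst (x, t)) * \<phi> (x, t))"
    if "loc_int UNIV (\<lambda>z::'a \<times> real. h (fst z))" "\<phi> \<in> test_functions UNIV" for h :: "'a \<Rightarrow> real" and \<phi> :: "'a \<times> real \<Rightarrow> real"
    using loc_int_test[OF that] by (simp add: lborel_prod case_prod_beta')
  have snd: "(\<integral>z. h (fst z) * \<phi> z \<partial>lborel) = (\<integral>t. (\<integral>x. h x * \<phi> (x, t) \<partial>lborel) \<partial>lborel)"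
    and fst: "(\<integral>z. h (fst z) * \<phi> z \<partial>lborel) = (\<integral>x. (\<integral>t. h x * \<phi> (x, t) \<partial>lborel) \<partial>lborel)"
    if "loc_int UNIV (\<lambda>z::'a \<times> real. h (fst z))" "\<phi> \<in> test_functions UNIV" for h :: "'a \<Rightarrow> real" and \<phi> :: "'a \<times> real \<Rightarrow> real"
    using lborel_pair.integral_snd[OF F[OF that]] lborel_pair.integral_fst[OF F[OF that]]
    by (simp_all add: lborel_prod case_prod_beta')
  show "weak_partial UNIV (i, 0) (\<lambda>z::'a \<times> real. f (fst z)) (\<lambda>z. g (fst z))"
    unfolding weak_partial_def
  proof (intro conjI ballI l)
    fix \<phi> :: "'a \<times> real \<Rightarrow> real" assume \<phi>: "\<phi> \<in> test_functions UNIV"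
    note t\<phi> = test_functions_partial[OF \<phi> space_Basis[OF i]]
    have "(\<integral>x. f x * partial_deriv (i, 0) \<phi> (x, t) \<partial>lborel) = - (\<integral>x. g x * \<phi> (x, t) \<partial>lborel)" for t
      using w test_functions_section(1)[OF \<phi>, of t] smooth_section(2)[OF test_functionsD(1)[OF \<phi>], of i t]
      unfolding weak_partial_def by auto
    then show "(\<integral>z. f (fst z) * partial_deriv (i, 0) \<phi> z \<partial>lborel) = - (\<integral>z. g (fst z) * \<phi> z \<partial>lborel)"
      unfolding snd[OF l(1) t\<phi>] snd[OF l(2) \<phi>] by simp
  qed
  show "weak_partial UNIV (0, 1) (\<lambda>z::'a \<times> real. f (fst z)) (\<lambda>z. 0)"
    unfolding weak_partial_def
  proof (intro conjI ballI l l0)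
    fix \<phi> :: "'a \<times> real \<Rightarrow> real" assume \<phi>: "\<phi> \<in> test_functions UNIV"
    note t\<phi> = test_functions_partial[OF \<phi> time_Basis]
    have "(\<integral>t. partial_deriv (0, 1) \<phi> (x, t) \<partial>lborel) = 0" for x
      using test_functions_partial_integral_0[OF test_functions_section(2)[OF \<phi>, of x], of 1]
        smooth_section(4)[OF test_functionsD(1)[OF \<phi>], of x] by simp
    then show "(\<integral>z. f (fst z) * partial_deriv (0, 1) \<phi> z \<partial>lborel) = - (\<integral>z. 0 * \<phi> z \<partial>lborel)"
      unfolding fst[OF l(1) t\<phi>] by simp
  qed
qed

text \<open>Membership in \<open>\<U>\<close> gives weak derivatives on each cylinder separately,
  while \<open>dt\<close> and \<open>grad_x\<close> are taken on \<open>Q_all\<close>; gluing over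
  the cylinders of radius n + 1 bridges the gap. Local square integrability of the derivatives is
  recovered later from the finite energy.\<close>

lemma \<U>_versions:
  fixes w :: "'a::euclidean_space \<times> real \<Rightarrow> real"
  assumes w: "w \<in> \<U>"
  shows "\<exists>w'. borel_version Q_all w w' \<and> (\<forall>r>0. sq_integrable (\<lambda>z. indicator (Q_cyl r) z * w' z)) \<and>
    (\<forall>b\<in>Basis. \<exists>g\<in>borel_measurable borel. weak_partial Q_all b w' g)"
proof -
  have H: "w \<in> H1_on (Q_cyl r)" if "r > 0" for r using w that by (auto simp: \<U>_def)
  define V where "V = (\<lambda>n. Q_cyl (real (Suc n)) :: ('a \<times> real) set)"
  have V: "V m \<subseteq> V n" if "m \<le> n" for m n unfolding V_def by (rule Q_cyl_mono) (use that in auto)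
  have VU: "(\<Union>n. V n) = Q_all" unfolding V_def by (rule UN_Q_cyl)
  have "w \<in> borel_measurable (lebesgue_on (\<Union>n. V n))"
  proof (rule borel_measurable_lebesgue_on_UN)
    show "V n \<in> sets lebesgue" for n unfolding V_def using borel_Q_cyl by simp
    show "V n \<subseteq> V (Suc n)" for n by (rule V) simp
    show "w \<in> borel_measurable (lebesgue_on (V n))" for n
      using H[of "real (Suc n)"] unfolding V_def H1_on_def Lp_on_def by auto
  qed
  then obtain w' where w': "borel_version Q_all w w'"
    using ex_borel_version[OF _ borel_Q_all] unfolding VU by blast
  note wr = borel_version_mono[OF w' Q_cyl_subset]
  have sq: "sq_integrable (\<lambda>z. indicator (Q_cyl r) z * w' z)" if "r > 0" for r
    using H[OF that] Lp2_version[OF wr borel_Q_cyl] by (auto simp: H1_on_def)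
  have "\<exists>g\<in>borel_measurable borel. weak_partial Q_all b w' g" if b: "b \<in> Basis" for b
  proof -
    have "\<exists>g\<in>borel_measurable borel. weak_partial (V n) b w' g" for n
    proof -
      obtain g where g: "g \<in> Lp_on 2 (V n)" "has_weak_deriv (V n) b w g"
        using H[of "real (Suc n)"] b unfolding V_def H1_on_def by auto
      have oV: "open (V n)" unfolding V_def by (rule open_Q_cyl)
      obtain g' where g': "borel_version (V n) g g'" using has_weak_deriv_imp_versions(2)[OF oV g(2)] by blast
      have "weak_partial (V n) b w' g'"
        using g(2) has_weak_deriv_version[OF oV _ g' b, of w w'] wr unfolding V_def by blast
      then show ?thesis using borel_versionD(1)[OF g'] by blast
    qed
    then obtain g where g: "\<forall>n. g n \<in> borel_measurable borel \<and> weak_partial (V n) b w' (g n)" by metis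
    have "\<exists>G\<in>borel_measurable borel. weak_partial (\<Union>n. V n) b w' G"
    proof (rule weak_partial_glue[OF _ V b borel_versionD(1)[OF w']])
      show "open (V n)" for n unfolding V_def by (rule open_Q_cyl)
      show "g n \<in> borel_measurable borel" "weak_partial (V n) b w' (g n)" for n using g by blast+
    qed
    then show ?thesis unfolding VU .
  qed
  with w' sq show ?thesis by blast
qed

text \<open>Below, \<open>p (0, 1)\<close> and \<open>p (i, 0)\<close> stand for the time and space derivatives.\<close>

definition weight :: "real \<Rightarrow> 'a::euclidean_space \<times> real \<Rightarrow> real" where
  "weight \<epsilon> z = exp (- snd z / \<epsilon>) / \<epsilon>"

definition energy_density :: "real \<Rightarrow> real \<Rightarrow> ('a::euclidean_space \<times> real \<Rightarrow> real) \<Rightarrow>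
    ('a \<times> real \<Rightarrow> 'a \<times> real \<Rightarrow> real) \<Rightarrow> 'a \<times> real \<Rightarrow> real" where
  "energy_density \<epsilon> \<gamma> w p z = \<epsilon> * (p (0, 1) z)\<^sup>2 + (\<Sum>i\<in>Basis. (p (i, 0) z)\<^sup>2) + 2 * max (w z) 0 powr \<gamma>"

lemma norm_grad_sq:
  "(norm (\<Sum>i\<in>Basis. f i *\<^sub>R (i :: 'a::euclidean_space)))\<^sup>2 = (\<Sum>i\<in>Basis. (f i)\<^sup>2)"
  by (simp add: norm_eq_sqrt_inner inner_sum_left inner_sum_right inner_Basis if_distrib power2_eq_square
      sum_nonneg cong: if_cong)

text \<open>Sections of \<open>u\<close> and of its chosen weak derivatives are replaced by sections
  of Borel representatives for almost every \<open>t\<close>; then Tonelli's theorem merges the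
  iterated integral into one over space-time.\<close>

lemma energy_eq:
  fixes w :: "'a::euclidean_space \<times> real \<Rightarrow> real"
  assumes \<epsilon>: "\<epsilon> > 0" and w: "borel_version Q_all w w'"
    and p: "\<And>b. b \<in> Basis \<Longrightarrow> borel_version Q_all (weak_deriv Q_all b w) (p b)"
  shows "energy \<epsilon> \<gamma> w = (\<integral>\<^sup>+z. ennreal (indicator Q_all z * (weight \<epsilon> z * energy_density \<epsilon> \<gamma> w' p z)) \<partial>lborel)"
proof -
  have [measurable]: "p (0, 1) \<in> borel_measurable borel" by (rule borel_versionD(1)[OF p[OF time_Basis]])
  have [measurable]: "p (i, 0) \<in> borel_measurable borel" if "i \<in> Basis" for i
    by (rule borel_versionD(1)[OF p[OF space_Basis[OF that]]])
  have [measurable]: "w' \<in> borel_measurable borel" by (rule borel_versionD(1)[OF w])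
  define A where "A = (\<lambda>z. \<epsilon> * (p (0, 1) z)\<^sup>2 + (\<Sum>i\<in>Basis. (p (i, 0) z)\<^sup>2))"
  define P where "P = (\<lambda>z. max (w' z) 0 powr \<gamma>)"
  have [measurable]: "A \<in> borel_measurable borel" "P \<in> borel_measurable borel"
    unfolding A_def P_def by measurable
  have A0: "A z \<ge> 0" for z unfolding A_def using \<epsilon> by (intro add_nonneg_nonneg mult_nonneg_nonneg sum_nonneg) auto
  have P0: "P z \<ge> 0" for z unfolding P_def by simp
  have "AE z in lborel. \<forall>i\<in>Basis. z \<in> Q_all \<longrightarrow> weak_deriv Q_all (i, 0) w z = p (i, 0) z"
    using borel_versionD(2)[OF p[OF space_Basis]] by (subst AE_finite_all) auto
  then have "AE z in lborel. z \<in> Q_all \<longrightarrow> \<epsilon> * \<bar>dt w z\<bar>\<^sup>2 + (norm (grad_x w z))\<^sup>2 = A z \<and> max (w z) 0 powr \<gamma> = P z"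
    using borel_versionD(2)[OF p[OF time_Basis]] borel_versionD(2)[OF w]
  proof eventually_elim
    case (elim z)
    then show ?case by (auto simp: dt_def grad_x_def norm_grad_sq A_def P_def)
  qed
  from lborel_AE_swap[OF this]
  have ae: "AE t in lborel. t > 0 \<longrightarrow> (AE x in lborel. \<epsilon> * \<bar>dt w (x, t)\<bar>\<^sup>2 + (norm (grad_x w (x, t)))\<^sup>2 = A (x, t)
      \<and> max (w (x, t)) 0 powr \<gamma> = P (x, t))"
    by eventually_elim (auto simp: Q_all_def)
  have aeA: "AE x in lborel. \<epsilon> * \<bar>dt w (x, t)\<bar>\<^sup>2 + (norm (grad_x w (x, t)))\<^sup>2 = A (x, t)"
    and aeP: "AE x in lborel. max (w (x, t)) 0 powr \<gamma> = P (x, t)"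
    if "AE x in lborel. \<epsilon> * \<bar>dt w (x, t)\<bar>\<^sup>2 + (norm (grad_x w (x, t)))\<^sup>2 = A (x, t) \<and> max (w (x, t)) 0 powr \<gamma> = P (x, t)" for t
    using that by (auto elim!: eventually_mono)
  have m1: "(\<lambda>x. A (x, t)) \<in> borel_measurable borel" "(\<lambda>x. P (x, t)) \<in> borel_measurable borel" for t
    by (rule measurable_compose[where N=borel and f="\<lambda>x. (x, t)"], auto intro!: borel_measurable_continuous_onI continuous_intros)+
  have "energy \<epsilon> \<gamma> w = (\<integral>\<^sup>+t. (ennreal (exp (- t / \<epsilon>) / \<epsilon>) *
        ((\<integral>\<^sup>+x. ennreal (\<epsilon> * \<bar>dt w (x, t)\<bar>\<^sup>2 + (norm (grad_x w (x, t)))\<^sup>2) \<partial>lborel) +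
         2 * (\<integral>\<^sup>+x. ennreal (max (w (x, t)) 0 powr \<gamma>) \<partial>lborel))) * indicator {0<..} t \<partial>lborel)"
    \<comment> \<open>The rule holds for arbitrary integrands, which matters because sections of
      Lebesgue measurable functions need not be measurable.\<close>
    unfolding energy_def by (simp only: nn_integral_completion)
  also have "\<dots> = (\<integral>\<^sup>+t. (\<integral>\<^sup>+x. ennreal (indicator Q_all (x, t) * (weight \<epsilon> (x, t) * energy_density \<epsilon> \<gamma> w' p (x, t))) \<partial>lborel) \<partial>lborel)"
  proof (rule nn_integral_cong_AE)
    show "AE t in lborel. (ennreal (exp (- t / \<epsilon>) / \<epsilon>) *
        ((\<integral>\<^sup>+x. ennreal (\<epsilon> * \<bar>dt w (x, t)\<bar>\<^sup>2 + (norm (grad_x w (x, t)))\<^sup>2) \<partial>lborel) +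
         2 * (\<integral>\<^sup>+x. ennreal (max (w (x, t)) 0 powr \<gamma>) \<partial>lborel))) * indicator {0<..} t =
       (\<integral>\<^sup>+x. ennreal (indicator Q_all (x, t) * (weight \<epsilon> (x, t) * energy_density \<epsilon> \<gamma> w' p (x, t))) \<partial>lborel)"
      using ae
    proof eventually_elim
      case (elim t)
      show ?case
      proof (cases "t > 0")
        case False
        then show ?thesis by (simp add: Q_all_def)
      next
        case True
        let ?W = "exp (- t / \<epsilon>) / \<epsilon>"
        have W0: "?W \<ge> 0" using \<epsilon> by simp
        have "(\<integral>\<^sup>+x. ennreal (\<epsilon> * \<bar>dt w (x, t)\<bar>\<^sup>2 + (norm (grad_x w (x, t)))\<^sup>2) \<partial>lborel) = (\<integral>\<^sup>+x. ennreal (A (x, t)) \<partial>lborel)"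
        proof (rule nn_integral_cong_AE)
          have "AE x in lborel. \<epsilon> * \<bar>dt w (x, t)\<bar>\<^sup>2 + (norm (grad_x w (x, t)))\<^sup>2 = A (x, t)"
            using aeA elim True by blast
          then show "AE x in lborel. ennreal (\<epsilon> * \<bar>dt w (x, t)\<bar>\<^sup>2 + (norm (grad_x w (x, t)))\<^sup>2) = ennreal (A (x, t))"
            by eventually_elim simp
        qed
        moreover have "(\<integral>\<^sup>+x. ennreal (max (w (x, t)) 0 powr \<gamma>) \<partial>lborel) = (\<integral>\<^sup>+x. ennreal (P (x, t)) \<partial>lborel)"
        proof (rule nn_integral_cong_AE)
          have "AE x in lborel. max (w (x, t)) 0 powr \<gamma> = P (x, t)" using aeP elim True by blast
          then show "AE x in lborel. ennreal (max (w (x, t)) 0 powr \<gamma>) = ennreal (P (x, t))"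
            by eventually_elim simp
        qed
        moreover have "(\<integral>\<^sup>+x. ennreal (A (x, t)) \<partial>lborel) + 2 * (\<integral>\<^sup>+x. ennreal (P (x, t)) \<partial>lborel) = (\<integral>\<^sup>+x. ennreal (A (x, t) + 2 * P (x, t)) \<partial>lborel)"
        proof -
          have "2 * (\<integral>\<^sup>+x. ennreal (P (x, t)) \<partial>lborel) = (\<integral>\<^sup>+x. ennreal (2 * P (x, t)) \<partial>lborel)"
            using m1 P0 by (subst nn_integral_cmult[symmetric]) (auto simp: ennreal_mult' intro!: nn_integral_cong)
          then show ?thesis
            using m1 A0 P0 by (simp add: nn_integral_add[symmetric] ennreal_plus[symmetric] del: ennreal_plus)
        qed
        moreover have "ennreal ?W * (\<integral>\<^sup>+x. ennreal (A (x, t) + 2 * P (x, t)) \<partial>lborel) = (\<integral>\<^sup>+x. ennreal (?W * (A (x, t) + 2 * P (x, t))) \<partial>lborel)"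
        proof -
          have "(\<integral>\<^sup>+x. ennreal (?W * (A (x, t) + 2 * P (x, t))) \<partial>lborel) = (\<integral>\<^sup>+x. ennreal ?W * ennreal (A (x, t) + 2 * P (x, t)) \<partial>lborel)"
            by (intro nn_integral_cong ennreal_mult'[OF W0])
          also have "\<dots> = ennreal ?W * (\<integral>\<^sup>+x. ennreal (A (x, t) + 2 * P (x, t)) \<partial>lborel)"
            using m1 by (intro nn_integral_cmult) measurable
          finally show ?thesis by simp
        qed
        ultimately show ?thesis
          using True by (simp add: Q_all_def weight_def energy_density_def A_def P_def)
      qed
    qed
  qed
  also have "\<dots> = (\<integral>\<^sup>+z. ennreal (indicator Q_all z * (weight \<epsilon> z * energy_density \<epsilon> \<gamma> w' p z)) \<partial>(lborel \<Otimes>\<^sub>M lborel))"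
  proof (rule lborel_pair.nn_integral_snd)
    have "(\<lambda>z. ennreal (indicator Q_all z * (weight \<epsilon> z * energy_density \<epsilon> \<gamma> w' p z))) \<in> borel_measurable (borel :: ('a \<times> real) measure)"
      unfolding weight_def energy_density_def by measurable
    then show "(\<lambda>z. ennreal (indicator Q_all z * (weight \<epsilon> z * energy_density \<epsilon> \<gamma> w' p z))) \<in> borel_measurable (lborel \<Otimes>\<^sub>M lborel)"
      by (simp add: lborel_prod)
  qed
  finally show ?thesis by (simp add: lborel_prod)
qed

section \<open>A competitor of finite energy\<close>

lemma H1_onI:
  assumes U: "open U" and f: "borel_version U f f'" and sq: "sq_integrable (\<lambda>z. indicator U z * f' z)"
    and g: "\<And>b. b \<in> Basis \<Longrightarrow> g b \<in> borel_measurable borel"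
    "\<And>b. b \<in> Basis \<Longrightarrow> sq_integrable (\<lambda>z. indicator U z * g b z)"
    "\<And>b. b \<in> Basis \<Longrightarrow> weak_partial U b f' (g b)"
  shows "f \<in> H1_on U"
proof -
  have UB: "U \<in> sets borel" using U by simp
  have "\<exists>h\<in>Lp_on 2 U. has_weak_deriv U b f h" if b: "b \<in> Basis" for b
  proof (intro bexI)
    note v = borel_version_refl[OF g(1)[OF b], of U]
    show "has_weak_deriv U b f (g b)" using has_weak_deriv_version[OF U f v b] g(3)[OF b] by simp
    show "g b \<in> Lp_on 2 U" using Lp2_version[OF v UB] g(2)[OF b] by simp
  qed
  then show ?thesis using Lp2_version[OF f UB] sq by (simp add: H1_on_def)
qed

lemma H1_onD:
  assumes U: "open U" and f: "f \<in> H1_on U"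
  shows "\<exists>f' g. borel_version U f f' \<and> sq_integrable (\<lambda>z. indicator U z * f' z) \<and>
    (\<forall>b\<in>Basis. g b \<in> borel_measurable borel \<and> sq_integrable (\<lambda>z. indicator U z * g b z) \<and> weak_partial U b f' (g b))"
proof -
  have UB: "U \<in> sets borel" using U by simp
  have f2: "f \<in> Lp_on 2 U" using f by (simp add: H1_on_def)
  then have "f \<in> borel_measurable (lebesgue_on U)" by (simp add: Lp_on_def)
  then obtain f' where f': "borel_version U f f'" using ex_borel_version[OF _ UB] by blast
  have "\<exists>h. h \<in> borel_measurable borel \<and> sq_integrable (\<lambda>z. indicator U z * h z) \<and> weak_partial U b f' h"
    if b: "b \<in> Basis" for b
  proof -
    obtain h where h: "h \<in> Lp_on 2 U" "has_weak_deriv U b f h" using f b by (auto simp: H1_on_def)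
    obtain h' where h': "borel_version U h h'" using has_weak_deriv_imp_versions(2)[OF U h(2)] by blast
    have "weak_partial U b f' h'" using has_weak_deriv_version[OF U f' h' b] h(2) by simp
    moreover have "sq_integrable (\<lambda>z. indicator U z * h' z)" using Lp2_version[OF h' UB] h(1) by simp
    ultimately show ?thesis using borel_versionD(1)[OF h'] by blast
  qed
  then have "\<forall>b. \<exists>h. b \<in> Basis \<longrightarrow> h \<in> borel_measurable borel \<and> sq_integrable (\<lambda>z. indicator U z * h z) \<and> weak_partial U b f' h"
    by blast
  then obtain g where "\<forall>b. b \<in> Basis \<longrightarrow> g b \<in> borel_measurable borel \<and> sq_integrable (\<lambda>z. indicator U z * g b z) \<and> weak_partial U b f' (g b)"
    by (rule choice[THEN exE])
  with f' show ?thesis using Lp2_version[OF f' UB] f2 by blast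
qed

lemma H1_norm_sq_version:
  assumes U: "open U" and f: "borel_version U f f'"
    and g: "\<And>b. b \<in> Basis \<Longrightarrow> g b \<in> borel_measurable borel" "\<And>b. b \<in> Basis \<Longrightarrow> weak_partial U b f' (g b)"
  shows "H1_norm_sq U f = (\<integral>\<^sup>+z. ennreal ((f' z)\<^sup>2) * indicator U z \<partial>lborel) +
     (\<Sum>b\<in>Basis. \<integral>\<^sup>+z. ennreal ((g b z)\<^sup>2) * indicator U z \<partial>lborel)"
proof -
  have v: "(\<integral>\<^sup>+z. ennreal ((h z)\<^sup>2) * indicator U z \<partial>lebesgue) = (\<integral>\<^sup>+z. ennreal ((h' z)\<^sup>2) * indicator U z \<partial>lborel)"
    if "borel_version U h h'" for h h'
    unfolding nn_integral_completion
  proof (rule nn_integral_cong_AE)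
    show "AE z in lborel. ennreal ((h z)\<^sup>2) * indicator U z = ennreal ((h' z)\<^sup>2) * indicator U z"
      using borel_versionD(2)[OF that] by eventually_elim (auto simp: indicator_def)
  qed
  show ?thesis
    unfolding H1_norm_sq_def v[OF f]
    by (intro arg_cong2[where f="(+)"] refl sum.cong v weak_deriv_version(1)[OF U _ f] g)
qed

lemma borel_version_fst:
  fixes f :: "'a::euclidean_space \<Rightarrow> real"
  assumes "borel_version UNIV f f'"
  shows "borel_version U (\<lambda>z::'a \<times> real. f (fst z)) (\<lambda>z. f' (fst z))"
proof -
  note [measurable] = borel_versionD(1)[OF assms]
  have "AE x in lborel. f x = f' x" using borel_versionD(2)[OF assms] by simp
  from lborel_AE_fst[OF this] have "AE z::'a \<times> real in lborel. z \<in> U \<longrightarrow> f (fst z) = f' (fst z)"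
    by eventually_elim simp
  then show ?thesis by (simp add: borel_version_def)
qed

lemma sq_integrable_fst_Q_cyl:
  fixes f :: "'a::euclidean_space \<Rightarrow> real"
  assumes "sq_integrable f"
  shows "sq_integrable (\<lambda>z. indicator (Q_cyl r) z * f (fst z))"
proof -
  note [measurable] = sq_integrableD(1)[OF assms]
  have i: "integrable lborel (indicator {0<..<r\<^sup>2} :: real \<Rightarrow> real)"
    by (rule integrable_real_indicator) auto
  have "integrable lborel (\<lambda>z::'a \<times> real. indicator (Q_cyl r) z * ((f (fst z))\<^sup>2 * indicator {0<..<r\<^sup>2} (snd z)))"
    by (rule integrable_bounded_mult[OF integrable_product[OF sq_integrableD(2)[OF assms] i], where B=1])
      (auto simp: indicator_def)
  moreover have "indicator (Q_cyl r) z * ((f (fst z))\<^sup>2 * indicator {0<..<r\<^sup>2} (snd z)) = (indicator (Q_cyl r) z * f (fst z))\<^sup>2" for z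
    by (cases z) (auto simp: indicator_def Q_cyl_def)
  ultimately show ?thesis by (simp add: sq_integrable_def)
qed

lemma nn_integral_fst_Q_cyl_le:
  fixes f :: "'a::euclidean_space \<Rightarrow> real"
  assumes f: "sq_integrable f"
  shows "(\<integral>\<^sup>+z. ennreal ((f (fst z))\<^sup>2) * indicator (Q_cyl r) z \<partial>lborel) \<le> ennreal (r\<^sup>2 * (\<integral>x. (f x)\<^sup>2 \<partial>lborel))"
proof -
  note [measurable] = sq_integrableD(1)[OF f]
  have "(\<integral>\<^sup>+z. ennreal ((f (fst z))\<^sup>2) * indicator (Q_cyl r) z \<partial>lborel) \<le>
      (\<integral>\<^sup>+z. ennreal ((f (fst z))\<^sup>2) * indicator {0<..<r\<^sup>2} (snd z) \<partial>lborel)"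
    by (rule nn_integral_mono) (auto simp: indicator_def Q_cyl_def)
  also have "\<dots> = (\<integral>\<^sup>+z. ennreal ((f (fst z))\<^sup>2) * indicator {0<..<r\<^sup>2} (snd z) \<partial>(lborel \<Otimes>\<^sub>M lborel))"
    unfolding lborel_prod ..
  also have "\<dots> = (\<integral>\<^sup>+x. (\<integral>\<^sup>+t. ennreal ((f (fst (x, t)))\<^sup>2) * indicator {0<..<r\<^sup>2} (snd (x, t)) \<partial>lborel) \<partial>lborel)"
    by (rule lborel.nn_integral_fst[symmetric]) measurable
  also have "\<dots> = (\<integral>\<^sup>+x. ennreal ((f x)\<^sup>2) * ennreal (r\<^sup>2) \<partial>lborel)"
    by (simp add: nn_integral_cmult)
  also have "\<dots> = (\<integral>\<^sup>+x. ennreal ((f x)\<^sup>2) \<partial>lborel) * ennreal (r\<^sup>2)" by (rule nn_integral_multc) measurable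
  also have "(\<integral>\<^sup>+x. ennreal ((f x)\<^sup>2) \<partial>lborel) = ennreal (\<integral>x. (f x)\<^sup>2 \<partial>lborel)"
    by (rule nn_integral_eq_integral[OF sq_integrableD(2)[OF f]]) simp
  also have "ennreal (\<integral>x. (f x)\<^sup>2 \<partial>lborel) * ennreal (r\<^sup>2) = ennreal (r\<^sup>2 * (\<integral>x. (f x)\<^sup>2 \<partial>lborel))"
    by (simp add: ennreal_mult'' mult.commute)
  finally show ?thesis .
qed

lemma integrable_exp_weight:
  fixes \<epsilon> :: real
  assumes "\<epsilon> > 0"
  shows "integrable lborel (\<lambda>t. indicator {0<..} t * (exp (- t / \<epsilon>) / \<epsilon>))"
proof -
  have "(\<integral>\<^sup>+t. ennreal (exp (- t / \<epsilon>) / \<epsilon>) * indicator {0..} t \<partial>lborel) = ennreal (0 - (- exp (- 0 / \<epsilon>)))"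
  proof (rule nn_integral_FTC_atLeast)
    show "((\<lambda>t. - exp (- t / \<epsilon>)) has_real_derivative exp (- t / \<epsilon>) / \<epsilon>) (at t)" for t
      using assms by (auto intro!: derivative_eq_intros)
    have "filterlim (\<lambda>t. (- 1 / \<epsilon>) * t) at_bot at_top"
      using assms by (intro filterlim_tendsto_neg_mult_at_bot[OF tendsto_const _ filterlim_ident]) simp
    then have "((\<lambda>t. exp ((- 1 / \<epsilon>) * t)) \<longlongrightarrow> 0) at_top"
      by (rule filterlim_compose[OF exp_at_bot])
    from tendsto_minus[OF this] show "((\<lambda>t. - exp (- t / \<epsilon>)) \<longlongrightarrow> 0) at_top" by simp
  qed (use assms in auto)
  then have "(\<integral>\<^sup>+t. ennreal (indicator {0<..} t * (exp (- t / \<epsilon>) / \<epsilon>)) \<partial>lborel) \<le> 1"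
    using nn_integral_mono[of lborel "\<lambda>t. ennreal (indicator {0<..} t * (exp (- t / \<epsilon>) / \<epsilon>))"
        "\<lambda>t. ennreal (exp (- t / \<epsilon>) / \<epsilon>) * indicator {0..} t"] by (simp add: indicator_def)
  then show ?thesis
    using assms by (intro integrableI_nonneg) (auto intro: le_less_trans)
qed

text \<open>Data for the stationary extension. It is built from \<open>u0\<close> itself, to which
  \<open>\<U>\<^sub>0\<close> refers; \<open>v0\<close> and \<open>g\<close> are Borel
  representatives of \<open>u0\<close> and its gradient, with which integrals are computed.\<close>

locale initial_datum =
  fixes u0 v0 :: "'a::euclidean_space \<Rightarrow> real" and g :: "'a \<Rightarrow> 'a \<Rightarrow> real"
  assumes v0: "borel_version UNIV u0 v0" "sq_integrable v0"
    and g: "\<And>i. i \<in> Basis \<Longrightarrow> sq_integrable (g i)" "\<And>i. i \<in> Basis \<Longrightarrow> weak_partial UNIV i v0 (g i)"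
begin

definition w :: "'a \<times> real \<Rightarrow> real" where "w z = u0 (fst z)"
definition w' :: "'a \<times> real \<Rightarrow> real" where "w' z = v0 (fst z)"
text \<open>Among the basis vectors only \<open>(0, 1)\<close> has first component 0, so this is 0
  in the time direction and the gradient of the datum in the space directions.\<close>

definition p :: "'a \<times> real \<Rightarrow> 'a \<times> real \<Rightarrow> real" where
  "p b z = (if fst b = 0 then 0 else g (fst b) (fst z))"

lemma w_version: "borel_version U w w'"
  unfolding w_def w'_def by (rule borel_version_fst[OF v0(1)])

lemma p_weak: "b \<in> Basis \<Longrightarrow> weak_partial U b w' (p b)"
proof (rule weak_partial_mono[OF _ subset_UNIV])
  assume "b \<in> Basis"
  then consider "b = (0, 1)" | i where "i \<in> Basis" "b = (i, 0)" by (rule Basis_space_time_cases)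
  then show "weak_partial UNIV b w' (p b)"
  proof cases
    case 1
    obtain i :: 'a where "i \<in> Basis" using nonempty_Basis by blast
    from weak_partial_fst(2)[OF this g(2)[OF this]] show ?thesis using 1 by (simp add: w'_def[abs_def] p_def[abs_def])
  next
    case 2
    from weak_partial_fst(1)[OF 2(1) g(2)[OF 2(1)]] show ?thesis
      using 2 nonzero_Basis[OF 2(1)] by (simp add: w'_def[abs_def] p_def[abs_def])
  qed
qed

lemma p_sq: "b \<in> Basis \<Longrightarrow> sq_integrable (\<lambda>z. indicator (Q_cyl r) z * p b z)"
  and p_measurable: "b \<in> Basis \<Longrightarrow> p b \<in> borel_measurable borel"
proof -
  assume "b \<in> Basis"
  then consider "b = (0, 1)" | i where "i \<in> Basis" "b = (i, 0)" by (rule Basis_space_time_cases)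
  then show "sq_integrable (\<lambda>z. indicator (Q_cyl r) z * p b z)"
  proof cases
    case 1
    then show ?thesis by (simp add: p_def sq_integrable_def)
  next
    case 2
    then show ?thesis using sq_integrable_fst_Q_cyl[OF g(1)[OF 2(1)]] nonzero_Basis[OF 2(1)] by (simp add: p_def)
  qed
next
  assume "b \<in> Basis"
  then consider "b = (0, 1)" | i where "i \<in> Basis" "b = (i, 0)" by (rule Basis_space_time_cases)
  then show "p b \<in> borel_measurable borel"
  proof cases
    case 1
    then show ?thesis by (simp add: p_def[abs_def])
  next
    case 2
    note [measurable] = sq_integrableD(1)[OF g(1)[OF 2(1)]]
    have "(\<lambda>z::'a \<times> real. g i (fst z)) \<in> borel_measurable borel" by measurable
    then show ?thesis using 2 nonzero_Basis[OF 2(1)] by (simp add: p_def[abs_def])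
  qed
qed

lemma w_H1: "w \<in> H1_on (Q_cyl r)"
  by (rule H1_onI[OF open_Q_cyl w_version _ p_measurable p_sq p_weak])
    (use sq_integrable_fst_Q_cyl[OF v0(2)] in \<open>auto simp: w'_def\<close>)

text \<open>The trace asks for functions smooth on the whole space. They are mollifications of
  \<open>\<zeta> * v0\<close>, constant in time, with \<open>\<zeta> = 1\<close> near the closed
  ball so that the cutoff is invisible on the cylinder. The distance on the cylinder and the one at
  t = 0 both reduce to L2 convergence in the space variable.\<close>

lemma w_trace:
  assumes r: "r > 0"
  shows "has_initial_trace r w u0"
proof -
  obtain \<zeta> :: "'a \<Rightarrow> real" and V where \<zeta>: "\<zeta> \<in> test_functions UNIV" and V: "open V" "cball 0 r \<subseteq> V" "\<forall>x\<in>V. \<zeta> x = 1"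
    using smooth_cutoff[of "cball (0::'a) r" UNIV] by auto
  have s\<zeta>: "smooth \<zeta>" by (rule test_functionsD(1)[OF \<zeta>])
  obtain B where B: "\<forall>x. \<bar>\<zeta> x\<bar> \<le> B" using test_functions_bounded[OF \<zeta>] by meson
  obtain R where R: "\<forall>x. norm x > R \<longrightarrow> \<zeta> x = 0 \<and> (\<forall>b. partial_deriv b \<zeta> x = 0)" using test_functions_ball[OF \<zeta>] by meson
  have pV: "partial_deriv i \<zeta> x = 0" if "x \<in> V" for i x
    using partial_deriv_cong_open[OF V(1) that, of \<zeta> "\<lambda>x. 1" i] V(3) by simp
  define f where "f = (\<lambda>x. \<zeta> x * v0 x)"
  define h where "h = (\<lambda>i x. \<zeta> x * g i x + partial_deriv i \<zeta> x * v0 x)"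
  have sqf: "sq_integrable f"
    unfolding f_def by (rule sq_integrable_bounded_mult[OF v0(2) smooth_borel[OF s\<zeta>] B[rule_format]])
  have f_out: "f x = 0" if "norm x > R" for x using R that by (simp add: f_def)
  have f_int: "integrable lborel f" by (rule sq_integrable_imp_integrable[OF sqf f_out])
  have sqh: "sq_integrable (h i)" if i: "i \<in> Basis" for i
  proof -
    obtain B' where B': "\<forall>x. \<bar>partial_deriv i \<zeta> x\<bar> \<le> B'"
      using test_functions_bounded[OF test_functions_partial[OF \<zeta> i]] by meson
    show ?thesis unfolding h_def
      by (intro sq_integrable_add sq_integrable_bounded_mult[OF g(1)[OF i] smooth_borel[OF s\<zeta>] B[rule_format]]
          sq_integrable_bounded_mult[OF v0(2) smooth_borel[OF smooth_partial[OF s\<zeta> i]] B'[rule_format]])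
  qed
  have h_out: "h i x = 0" if "norm x > R" for i x using R that by (simp add: h_def)
  have h_int: "integrable lborel (h i)" if "i \<in> Basis" for i by (rule sq_integrable_imp_integrable[OF sqh[OF that] h_out])
  have wfh: "weak_partial UNIV i f (h i)" if i: "i \<in> Basis" for i
    unfolding f_def h_def by (rule weak_partial_cutoff[OF g(2)[OF i] i \<zeta>])
  have kd: "inverse (real (Suc k)) > 0" for k by simp
  have sqcf: "sq_integrable (\<lambda>x. conv (moll k) f x - f x)" for k
    by (rule sq_integrable_diff[OF conv_contraction(1)[OF kd f_int sqf] sqf])
  have sqch: "sq_integrable (\<lambda>x. conv (moll k) (h i) x - h i x)" if "i \<in> Basis" for k i
    by (rule sq_integrable_diff[OF conv_contraction(1)[OF kd h_int[OF that] sqh[OF that]] sqh[OF that]])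
  define \<phi> where "\<phi> = (\<lambda>k z::'a \<times> real. conv (moll k) f (fst z))"
  have sc: "smooth (conv (moll k) f)" for k by (rule smooth_conv[OF moll_test f_int])
  have s\<phi>: "smooth (\<phi> k)" for k unfolding \<phi>_def by (rule smooth_fst(1)[OF sc])
  have pc: "partial_deriv i (conv (moll k) f) = conv (moll k) (h i)" if i: "i \<in> Basis" for i k
    unfolding partial_deriv_conv[OF moll_test f_int i]
    by (rule conv_weak_deriv[OF moll_test i]) (use wfh[OF i] in \<open>auto simp: weak_partial_def\<close>)
  \<comment> \<open>The factor \<open>r\<^sup>2\<close> is the height of the cylinder; the time
    derivative contributes nothing.\<close>
  define A where "A = (\<lambda>k. r\<^sup>2 * (\<integral>x. (conv (moll k) f x - f x)\<^sup>2 \<partial>lborel) +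
      (\<Sum>i\<in>Basis. r\<^sup>2 * (\<integral>x. (conv (moll k) (h i) x - h i x)\<^sup>2 \<partial>lborel)))"
  have "A \<longlonglongrightarrow> r\<^sup>2 * 0 + (\<Sum>i\<in>(Basis :: 'a set). r\<^sup>2 * 0)"
    unfolding A_def by (intro tendsto_intros conv_moll_L2[OF sqf f_out] conv_moll_L2[OF sqh h_out])
  then have A0: "(\<lambda>k. ennreal (A k)) \<longlonglongrightarrow> 0" by (metis ennreal_0 tendsto_ennrealI mult_zero_right sum.neutral_const add_0)
  have "H1_norm_sq (Q_cyl r) (\<lambda>z. \<phi> k z - w z) \<le> ennreal (A k)" for k
  proof -
    have ver: "borel_version (Q_cyl r) (\<lambda>z. \<phi> k z - w z) (\<lambda>z. \<phi> k z + (-1) * w' z)"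
      using borel_version_add[OF borel_version_smooth[OF s\<phi>] borel_version_mult[OF borel_version_smooth[of "\<lambda>z. -1"] w_version]]
      by simp
    have wp: "weak_partial (Q_cyl r) b (\<lambda>z. \<phi> k z + (-1) * w' z) (\<lambda>z. partial_deriv b (\<phi> k) z + (-1) * p b z)"
      if b: "b \<in> Basis" for b
      by (rule weak_partial_add[OF b weak_partial_smooth[OF s\<phi> b] weak_partial_cmult[OF p_weak[OF b]]])
    have wm: "(\<lambda>z. partial_deriv b (\<phi> k) z + (-1) * p b z) \<in> borel_measurable borel" if b: "b \<in> Basis" for b
      using smooth_borel[OF smooth_partial[OF s\<phi> b], of k] p_measurable[OF b] by measurable
    have in_V: "fst z \<in> V" if "z \<in> Q_cyl r" for z
      using that V(2) by (auto simp: Q_cyl_def)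
    have "(\<integral>\<^sup>+z. ennreal ((\<phi> k z + (-1) * w' z)\<^sup>2) * indicator (Q_cyl r) z \<partial>lborel) =
        (\<integral>\<^sup>+z. ennreal ((conv (moll k) f (fst z) - f (fst z))\<^sup>2) * indicator (Q_cyl r) z \<partial>lborel)"
      using in_V V(3) by (intro nn_integral_cong) (auto simp: indicator_def \<phi>_def w'_def f_def)
    also have "\<dots> \<le> ennreal (r\<^sup>2 * (\<integral>x. (conv (moll k) f x - f x)\<^sup>2 \<partial>lborel))"
      by (rule nn_integral_fst_Q_cyl_le[OF sqcf])
    finally have 1: "(\<integral>\<^sup>+z. ennreal ((\<phi> k z + (-1) * w' z)\<^sup>2) * indicator (Q_cyl r) z \<partial>lborel)
      \<le> ennreal (r\<^sup>2 * (\<integral>x. (conv (moll k) f x - f x)\<^sup>2 \<partial>lborel))" .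
    have pf: "partial_deriv b (\<phi> k) z = partial_deriv (fst b) (conv (moll k) f) (fst z)" for b z
      unfolding \<phi>_def by (rule smooth_fst(2)[OF sc])
    have 2: "(\<integral>\<^sup>+z. ennreal ((partial_deriv (i, 0) (\<phi> k) z + (-1) * p (i, 0) z)\<^sup>2) * indicator (Q_cyl r) z \<partial>lborel)
      \<le> ennreal (r\<^sup>2 * (\<integral>x. (conv (moll k) (h i) x - h i x)\<^sup>2 \<partial>lborel))" if i: "i \<in> Basis" for i
    proof -
      have "(\<integral>\<^sup>+z. ennreal ((partial_deriv (i, 0) (\<phi> k) z + (-1) * p (i, 0) z)\<^sup>2) * indicator (Q_cyl r) z \<partial>lborel) =
          (\<integral>\<^sup>+z. ennreal ((conv (moll k) (h i) (fst z) - h i (fst z))\<^sup>2) * indicator (Q_cyl r) z \<partial>lborel)"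
      proof (rule nn_integral_cong)
        fix z :: "'a \<times> real"
        have "h i (fst z) = g i (fst z)" if "z \<in> Q_cyl r" using in_V[OF that] V(3) pV by (simp add: h_def)
        then show "ennreal ((partial_deriv (i, 0) (\<phi> k) z + (-1) * p (i, 0) z)\<^sup>2) * indicator (Q_cyl r) z =
          ennreal ((conv (moll k) (h i) (fst z) - h i (fst z))\<^sup>2) * indicator (Q_cyl r) z"
          using nonzero_Basis[OF i] by (simp add: indicator_def pf pc[OF i] p_def del: of_nat_Suc)
      qed
      also have "\<dots> \<le> ennreal (r\<^sup>2 * (\<integral>x. (conv (moll k) (h i) x - h i x)\<^sup>2 \<partial>lborel))"
        by (rule nn_integral_fst_Q_cyl_le[OF sqch[OF i]])
      finally show ?thesis .
    qed
    have 3: "(\<integral>\<^sup>+z. ennreal ((partial_deriv (0, 1) (\<phi> k) z + (-1) * p (0, 1) z)\<^sup>2) * indicator (Q_cyl r) z \<partial>lborel) = 0"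
    proof -
      have "partial_deriv 0 (conv (moll k) f) x = 0" for x
        unfolding partial_deriv_def by (rule linear_0[OF linear_frechet_derivative[OF smooth_differentiable[OF sc]]])
      then show ?thesis by (simp add: pf p_def del: of_nat_Suc)
    qed
    have eq: "H1_norm_sq (Q_cyl r) (\<lambda>z. \<phi> k z - w z) =
        (\<integral>\<^sup>+z. ennreal ((\<phi> k z + (-1) * w' z)\<^sup>2) * indicator (Q_cyl r) z \<partial>lborel) +
        (\<Sum>b\<in>Basis. \<integral>\<^sup>+z. ennreal ((partial_deriv b (\<phi> k) z + (-1) * p b z)\<^sup>2) * indicator (Q_cyl r) z \<partial>lborel)"
      by (rule H1_norm_sq_version[OF open_Q_cyl ver, where g="\<lambda>b z. partial_deriv b (\<phi> k) z + (-1) * p b z", OF wm wp])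
    have "H1_norm_sq (Q_cyl r) (\<lambda>z. \<phi> k z - w z) \<le> ennreal (r\<^sup>2 * (\<integral>x. (conv (moll k) f x - f x)\<^sup>2 \<partial>lborel)) +
        (\<Sum>i\<in>Basis. ennreal (r\<^sup>2 * (\<integral>x. (conv (moll k) (h i) x - h i x)\<^sup>2 \<partial>lborel)))"
      unfolding eq sum_Basis_space_time 3 add_0_right
      by (intro add_mono 1 sum_mono 2)
    also have "\<dots> = ennreal (A k)"
      unfolding A_def by (simp add: sum_ennreal sum_nonneg)
    finally show ?thesis .
  qed
  note Hb = this
  have H: "(\<lambda>k. H1_norm_sq (Q_cyl r) (\<lambda>z. \<phi> k z - w z)) \<longlonglongrightarrow> 0"
    by (rule tendsto_sandwich[OF _ _ tendsto_const A0]) (intro always_eventually allI zero_le Hb)+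
  have bd: "(\<integral>\<^sup>+x\<in>ball 0 r. ennreal ((\<phi> k (x, 0) - u0 x)\<^sup>2) \<partial>lebesgue) \<le> ennreal (\<integral>x. (conv (moll k) f x - f x)\<^sup>2 \<partial>lborel)" for k
  proof -
    have "(\<integral>\<^sup>+x\<in>ball 0 r. ennreal ((\<phi> k (x, 0) - u0 x)\<^sup>2) \<partial>lebesgue) \<le> (\<integral>\<^sup>+x. ennreal ((conv (moll k) f x - f x)\<^sup>2) \<partial>lborel)"
      unfolding nn_integral_completion
    proof (rule nn_integral_mono_AE)
      show "AE x in lborel. ennreal ((\<phi> k (x, 0) - u0 x)\<^sup>2) * indicator (ball 0 r) x \<le> ennreal ((conv (moll k) f x - f x)\<^sup>2)"
        using borel_versionD(2)[OF v0(1)]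
      proof eventually_elim
        case (elim x)
        show ?case
        proof (cases "x \<in> ball 0 r")
          case True
          then have "x \<in> V" using V(2) by auto
          then show ?thesis using elim V(3) by (simp add: \<phi>_def f_def indicator_def)
        qed simp
      qed
    qed
    also have "\<dots> = ennreal (\<integral>x. (conv (moll k) f x - f x)\<^sup>2 \<partial>lborel)"
      by (rule nn_integral_eq_integral[OF sq_integrableD(2)[OF sqcf]]) simp
    finally show ?thesis .
  qed
  have L: "(\<lambda>k. ennreal (\<integral>x. (conv (moll k) f x - f x)\<^sup>2 \<partial>lborel)) \<longlonglongrightarrow> 0"
    using tendsto_ennrealI[OF conv_moll_L2[OF sqf f_out]] by (simp del: of_nat_Suc)
  have T: "(\<lambda>k. \<integral>\<^sup>+x\<in>ball 0 r. ennreal ((\<phi> k (x, 0) - u0 x)\<^sup>2) \<partial>lebesgue) \<longlonglongrightarrow> 0"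
    by (rule tendsto_sandwich[OF _ _ tendsto_const L]) (intro always_eventually allI zero_le bd)+
  show ?thesis
    unfolding has_initial_trace_def by (intro conjI w_H1 exI[of _ \<phi>] allI s\<phi> H T)
qed

lemma w_in_\<U>\<^sub>0: "w \<in> \<U>\<^sub>0 u0"
  using w_H1 w_trace by (auto simp: \<U>\<^sub>0_def \<U>_def)

lemma energy_w_finite:
  assumes \<epsilon>: "\<epsilon> > 0" and \<gamma>: "\<gamma> \<ge> 1" and u0: "u0 \<in> Lp_on \<gamma> UNIV"
  shows "energy \<epsilon> \<gamma> w < \<infinity>"
proof -
  note [measurable] = sq_integrableD(1)[OF v0(2)]
  have "borel_version UNIV (\<lambda>x. \<bar>u0 x\<bar> powr \<gamma>) (\<lambda>x. \<bar>v0 x\<bar> powr \<gamma>)"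
    by (rule borel_version_comp[OF v0(1), where F="\<lambda>s. \<bar>s\<bar> powr \<gamma>"]) measurable
  from lebesgue_on_version(2)[OF this] have vi: "integrable lborel (\<lambda>x. \<bar>v0 x\<bar> powr \<gamma>)"
    using u0 by (simp add: Lp_on_def)
  define F where "F = (\<lambda>x. (\<Sum>i\<in>Basis. (g i x)\<^sup>2) + 2 * \<bar>v0 x\<bar> powr \<gamma>)"
  have Fi: "integrable lborel F"
    unfolding F_def using vi sq_integrableD(2)[OF g(1)] by (intro Bochner_Integration.integrable_add Bochner_Integration.integrable_sum) auto
  have F0: "F x \<ge> 0" for x unfolding F_def by (intro add_nonneg_nonneg sum_nonneg) auto
  have i: "integrable lborel (\<lambda>z. F (fst z) * (indicator {0<..} (snd z) * (exp (- snd z / \<epsilon>) / \<epsilon>)))"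
    by (rule integrable_product[OF Fi integrable_exp_weight[OF \<epsilon>]])
  have "energy \<epsilon> \<gamma> w = (\<integral>\<^sup>+z. ennreal (indicator Q_all z * (weight \<epsilon> z * energy_density \<epsilon> \<gamma> w' p z)) \<partial>lborel)"
    by (rule energy_eq[OF \<epsilon> w_version weak_deriv_version(1)[OF open_Q_all _ w_version p_measurable p_weak]])
  also have "\<dots> \<le> (\<integral>\<^sup>+z. ennreal (F (fst z) * (indicator {0<..} (snd z) * (exp (- snd z / \<epsilon>) / \<epsilon>))) \<partial>lborel)"
  proof (intro nn_integral_mono ennreal_leI)
    fix z :: "'a \<times> real"
    have "energy_density \<epsilon> \<gamma> w' p z = (\<Sum>i\<in>Basis. (g i (fst z))\<^sup>2) + 2 * max (v0 (fst z)) 0 powr \<gamma>"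
      unfolding energy_density_def p_def w'_def
      by (auto simp: nonzero_Basis intro!: sum.cong)
    also have "\<dots> \<le> F (fst z)"
      unfolding F_def using \<gamma> by (intro add_mono mult_left_mono powr_mono2) auto
    finally have "weight \<epsilon> z * energy_density \<epsilon> \<gamma> w' p z \<le> weight \<epsilon> z * F (fst z)"
      using \<epsilon> by (intro mult_left_mono) (auto simp: weight_def)
    then show "indicator Q_all z * (weight \<epsilon> z * energy_density \<epsilon> \<gamma> w' p z) \<le>
       F (fst z) * (indicator {0<..} (snd z) * (exp (- snd z / \<epsilon>) / \<epsilon>))"
      by (cases z) (auto simp: Q_all_def indicator_def weight_def mult.commute)
  qed
  also have "\<dots> < \<infinity>"
    using i F0 \<epsilon> by (subst nn_integral_eq_integral) auto
  finally show ?thesis .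
qed

end

lemma competitor_exists:
  fixes u0 :: "'a::euclidean_space \<Rightarrow> real"
  assumes "u0 \<in> H1_on UNIV" "u0 \<in> Lp_on \<gamma> UNIV" "\<epsilon> > 0" "\<gamma> \<ge> 1"
  shows "\<exists>w\<in>\<U>\<^sub>0 u0. energy \<epsilon> \<gamma> w < \<infinity>"
proof -
  obtain v0 g where "borel_version UNIV u0 v0" "sq_integrable (\<lambda>z. indicator UNIV z * v0 z)"
    "\<forall>b\<in>Basis. g b \<in> borel_measurable borel \<and> sq_integrable (\<lambda>z. indicator UNIV z * g b z) \<and> weak_partial UNIV b v0 (g b)"
    using H1_onD[OF open_UNIV assms(1)] by blast
  then interpret initial_datum u0 v0 g by unfold_locales auto
  show ?thesis using w_in_\<U>\<^sub>0 energy_w_finite assms by blast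
qed

text \<open>Supports in \<open>Q_all\<close> stay away from t = 0. Adding \<open>\<phi>\<close> to
  the approximating sequence therefore keeps its values at t = 0, and its distance to the shifted
  function is the old one.\<close>

lemma \<U>\<^sub>0_add_test:
  fixes u :: "'a::euclidean_space \<times> real \<Rightarrow> real"
  assumes u: "u \<in> \<U>\<^sub>0 u0" and \<phi>: "\<phi> \<in> test_functions Q_all"
  shows "(\<lambda>z. u z + \<phi> z) \<in> \<U>\<^sub>0 u0"
proof -
  note s\<phi> = test_functionsD(1)[OF \<phi>]
  have H1: "(\<lambda>z. u z + \<phi> z) \<in> H1_on (Q_cyl r)" if r: "r > 0" for r
  proof -
    have "u \<in> H1_on (Q_cyl r)" using u r by (auto simp: \<U>\<^sub>0_def \<U>_def)
    then obtain f' g where f': "borel_version (Q_cyl r) u f'" "sq_integrable (\<lambda>z. indicator (Q_cyl r) z * f' z)"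
      and g: "\<forall>b\<in>Basis. g b \<in> borel_measurable borel \<and> sq_integrable (\<lambda>z. indicator (Q_cyl r) z * g b z) \<and> weak_partial (Q_cyl r) b f' (g b)"
      using H1_onD[OF open_Q_cyl] by blast
    have sq: "sq_integrable (\<lambda>z. indicator (Q_cyl r) z * (a z + \<psi> z))"
      if a: "sq_integrable (\<lambda>z. indicator (Q_cyl r) z * a z)" and \<psi>: "sq_integrable \<psi>" for a \<psi> :: "'a \<times> real \<Rightarrow> real"
    proof -
      have "sq_integrable (\<lambda>z. indicator (Q_cyl r) z * \<psi> z)"
        by (rule sq_integrable_bounded_mult[OF \<psi>, where B=1]) (auto simp: indicator_def)
      from sq_integrable_add[OF a this] show ?thesis by (simp add: distrib_left)
    qed
    show ?thesis
    proof (rule H1_onI[OF open_Q_cyl borel_version_add[OF f'(1) borel_version_smooth[OF s\<phi>]] sq[OF f'(2) test_functions_sq_integrable[OF \<phi>]],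
          where g="\<lambda>b z. g b z + partial_deriv b \<phi> z"])
      fix b :: "'a \<times> real" assume b: "b \<in> Basis"
      note gb = g[rule_format, OF b]
      show "(\<lambda>z. g b z + partial_deriv b \<phi> z) \<in> borel_measurable borel"
        using borel_measurable_add[OF conjunct1[OF gb] smooth_borel[OF smooth_partial[OF s\<phi> b]]] .
      show "sq_integrable (\<lambda>z. indicator (Q_cyl r) z * (g b z + partial_deriv b \<phi> z))"
        using sq[OF _ sq_integrable_partial[OF \<phi> b]] gb by blast
      show "weak_partial (Q_cyl r) b (\<lambda>z. f' z + \<phi> z) (\<lambda>z. g b z + partial_deriv b \<phi> z)"
        using weak_partial_add[OF b _ weak_partial_smooth[OF s\<phi> b]] gb by blast
    qed
  qed
  have tr: "has_initial_trace r (\<lambda>z. u z + \<phi> z) u0" if r: "r > 0" for r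
  proof -
    have "has_initial_trace r u u0" using u r by (auto simp: \<U>\<^sub>0_def)
    then obtain \<psi> where \<psi>: "\<forall>k. smooth (\<psi> k)"
      "(\<lambda>k. H1_norm_sq (Q_cyl r) (\<lambda>z. \<psi> k z - u z)) \<longlonglongrightarrow> 0"
      "(\<lambda>k. \<integral>\<^sup>+x\<in>ball 0 r. ennreal ((\<psi> k (x, 0) - u0 x)\<^sup>2) \<partial>lebesgue) \<longlonglongrightarrow> 0"
      unfolding has_initial_trace_def by blast
    have z: "\<phi> (x, 0) = 0" for x
    proof (rule not_in_supp[of "(x, 0)" \<phi>])
      show "(x, 0) \<notin> supp \<phi>" using test_functionsD(3)[OF \<phi>] by (auto simp: Q_all_def)
    qed
    show ?thesis
      unfolding has_initial_trace_def
      by (intro conjI H1[OF r] exI[of _ "\<lambda>k z. \<psi> k z + \<phi> z"] allI smooth_add s\<phi>)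
        (use \<psi> z in \<open>simp_all\<close>)
  qed
  show ?thesis using H1 tr by (auto simp: \<U>\<^sub>0_def \<U>_def)
qed

section \<open>The first variation\<close>

text \<open>Convexity, with the subgradient taken at \<open>y\<close>. Used with \<open>y\<close>
  the perturbed value, it bounds the increase from above in spite of the kink at 0 for
  \<open>\<gamma> = 1\<close>, where \<open>f_reac 1 0 = 0\<close> is one of the
  subgradients.\<close>

lemma pos_part_powr_subgradient:
  assumes \<gamma>: "1 \<le> \<gamma>"
  shows "max y 0 powr \<gamma> - max x 0 powr \<gamma> \<le> f_reac \<gamma> y * (y - x)"
proof (cases "y > 0")
  case False
  then show ?thesis by (simp add: f_reac_def)
next
  case y: True
  have f: "f_reac \<gamma> y = \<gamma> * y powr (\<gamma> - 1)" using y by (simp add: f_reac_def)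
  show ?thesis
  proof (cases "x > 0")
    case False
    have "y powr \<gamma> = y powr (\<gamma> - 1) * y" using y by (simp add: powr_mult_base mult.commute)
    also have "\<dots> \<le> y powr (\<gamma> - 1) * (\<gamma> * (y - x))"
    proof (rule mult_left_mono)
      have "1 * y \<le> \<gamma> * (y - x)" using \<gamma> y False by (intro mult_mono) auto
      then show "y \<le> \<gamma> * (y - x)" by simp
    qed simp
    finally show ?thesis using y False f by (simp add: mult_ac)
  next
    case True
    have "x powr \<gamma> - y powr \<gamma> \<ge> (\<gamma> * y powr (\<gamma> - 1)) * (x - y)"
    proof (rule convex_on_imp_above_tangent[where A="{0<..}"])
      show "convex_on {0<..} (\<lambda>x. x powr \<gamma>)" by (rule powr_convex[OF \<gamma>])
      show "((\<lambda>x. x powr \<gamma>) has_field_derivative \<gamma> * y powr (\<gamma> - 1)) (at y within {0<..})"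
        using y by (rule has_field_derivative_at_within[OF has_real_derivative_powr])
    qed (use y True in \<open>auto simp: interior_open\<close>)
    then show ?thesis using y True f by (simp add: right_diff_distrib)
  qed
qed

text \<open>The exponent \<open>\<gamma> - 1\<close> is less than 1, so the growth is at most linear
  and local square integrability passes from \<open>U\<close> to the reaction term.\<close>

lemma f_reac_bound:
  assumes "1 \<le> \<gamma>" "\<gamma> < 2"
  shows "\<bar>f_reac \<gamma> s\<bar> \<le> \<gamma> * (1 + \<bar>s\<bar>)"
proof (cases "s > 0")
  case True
  have "s powr (\<gamma> - 1) \<le> 1 + s"
  proof (cases "s \<le> 1")
    case True
    then have "s powr (\<gamma> - 1) \<le> 1" using assms \<open>s > 0\<close> by (intro powr_le1) auto
    then show ?thesis using \<open>s > 0\<close> by linarith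
  next
    case False
    then have "s powr (\<gamma> - 1) \<le> s powr 1" using assms by (intro powr_mono) auto
    then show ?thesis using False by simp
  qed
  then show ?thesis using True assms by (simp add: f_reac_def abs_mult)
next
  case False
  then show ?thesis using assms by (simp add: f_reac_def)
qed

lemma f_reac_borel [measurable]: "f_reac \<gamma> \<in> borel_measurable borel"
  unfolding f_reac_def by measurable

text \<open>
  The right-sided limit of \<open>f\<^sub>\<gamma>\<close> differs from its value only at the jump at 0 in the case \<open>\<gamma> = 1\<close>;
  the factor \<open>e\<close> has the sign of the increment.
\<close>

lemma f_reac_tendsto:
  assumes \<gamma>: "1 \<le> \<gamma>" and c: "c > 0"
  shows "(\<lambda>k. f_reac \<gamma> (s + inverse (real (Suc k)) * (c * e)) * e) \<longlonglongrightarrow>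
    f_reac \<gamma> s * e + (if \<gamma> = 1 \<and> s = 0 then max e 0 else 0)"
proof -
  define d where "d = (\<lambda>k. inverse (real (Suc k)) * (c * e))"
  have "d \<longlonglongrightarrow> 0 * (c * e)" unfolding d_def by (intro tendsto_intros LIMSEQ_inverse_real_of_nat)
  then have lim: "(\<lambda>k. s + d k) \<longlonglongrightarrow> s" using tendsto_add[OF tendsto_const[of s]] by fastforce
  consider "s > 0" | "s < 0" | "s = 0" "e \<le> 0" | "s = 0" "e > 0" by linarith
  then have "(\<lambda>k. f_reac \<gamma> (s + d k) * e) \<longlonglongrightarrow> f_reac \<gamma> s * e + (if \<gamma> = 1 \<and> s = 0 then max e 0 else 0)"
  proof cases
    case 1
    have "(\<lambda>k. \<gamma> * (s + d k) powr (\<gamma> - 1) * e) \<longlonglongrightarrow> \<gamma> * s powr (\<gamma> - 1) * e"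
      using 1 by (intro tendsto_mult tendsto_powr lim tendsto_const) auto
    moreover have "\<forall>\<^sub>F k in sequentially. \<gamma> * (s + d k) powr (\<gamma> - 1) * e = f_reac \<gamma> (s + d k) * e"
      using order_tendstoD(1)[OF lim 1] by eventually_elim (simp add: f_reac_def)
    ultimately have "(\<lambda>k. f_reac \<gamma> (s + d k) * e) \<longlonglongrightarrow> \<gamma> * s powr (\<gamma> - 1) * e"
      by (rule Lim_transform_eventually)
    then show ?thesis using 1 by (simp add: f_reac_def)
  next
    case 2
    have "\<forall>\<^sub>F k in sequentially. f_reac \<gamma> (s + d k) * e = 0"
      using order_tendstoD(2)[OF lim 2] by eventually_elim (simp add: f_reac_def)
    then show ?thesis using 2 by (simp add: f_reac_def tendsto_eventually)
  next
    case 3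
    have "d k \<le> 0" for k unfolding d_def using 3 c by (intro mult_nonneg_nonpos) auto
    then have "\<not> 0 < d k" for k by (simp add: not_less)
    then have z: "f_reac \<gamma> (s + d k) * e = 0" for k using 3(1) by (simp add: f_reac_def)
    have r: "f_reac \<gamma> s * e + (if \<gamma> = 1 \<and> s = 0 then max e 0 else 0) = 0" using 3 by (simp add: f_reac_def)
    show ?thesis unfolding z r by simp
  next
    case 4
    have d: "d k > 0" for k unfolding d_def using 4 c by (intro mult_pos_pos) auto
    show ?thesis
    proof (cases "\<gamma> = 1")
      case True
      then have "f_reac \<gamma> (s + d k) * e = e" for k using 4 d[of k] by (simp add: f_reac_def)
      then show ?thesis using 4 True by (simp add: f_reac_def)
    next
      case False
      have "(\<lambda>k. d k powr (\<gamma> - 1)) \<longlonglongrightarrow> 0"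
        by (rule tendsto_zero_powrI[OF _ tendsto_const]) (use lim d 4 False \<gamma> in \<open>auto intro: always_eventually less_imp_le\<close>)
      then have "(\<lambda>k. \<gamma> * d k powr (\<gamma> - 1) * e) \<longlonglongrightarrow> \<gamma> * 0 * e" by (intro tendsto_intros)
      moreover have z: "f_reac \<gamma> (s + d k) * e = \<gamma> * d k powr (\<gamma> - 1) * e" for k using 4 d[of k] by (simp add: f_reac_def)
      moreover have r: "f_reac \<gamma> s * e + (if \<gamma> = 1 \<and> s = 0 then max e 0 else 0) = \<gamma> * 0 * e"
        using 4 False by (simp add: f_reac_def)
      ultimately show ?thesis unfolding z r by simp
    qed
  qed
  then show ?thesis by (simp only: d_def)
qed

text \<open>Compact subsets of \<open>Q_all\<close> are what supports of test functions provide. On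
  each of them the weight is bounded below, so finite energy controls the derivatives there.\<close>

definition sq_loc :: "('a::euclidean_space \<times> real \<Rightarrow> real) \<Rightarrow> bool" where
  "sq_loc f \<longleftrightarrow> f \<in> borel_measurable borel \<and>
    (\<forall>K. compact K \<and> K \<subseteq> Q_all \<longrightarrow> sq_integrable (\<lambda>z. indicator K z * f z))"

lemma sq_locD: "sq_loc f \<Longrightarrow> f \<in> borel_measurable borel"
  by (simp add: sq_loc_def)

lemma sq_loc_mult_test:
  assumes f: "sq_loc f" and \<phi>: "\<phi> \<in> test_functions Q_all"
  shows "sq_integrable (\<lambda>z. f z * \<phi> z)" "integrable lborel (\<lambda>z. f z * \<phi> z)"
proof -
  note D = test_functionsD[OF \<phi>]
  obtain B where B: "\<forall>z. \<bar>\<phi> z\<bar> \<le> B" using test_functions_bounded[OF \<phi>] by meson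
  obtain R where R: "\<forall>z. norm z > R \<longrightarrow> \<phi> z = 0" using test_functions_ball[OF \<phi>] by meson
  have "sq_integrable (\<lambda>z. \<phi> z * (indicator (supp \<phi>) z * f z))"
    by (rule sq_integrable_bounded_mult[OF _ smooth_borel[OF D(1)] B[rule_format]]) (use f D in \<open>auto simp: sq_loc_def\<close>)
  moreover have "\<phi> z * (indicator (supp \<phi>) z * f z) = f z * \<phi> z" for z
    using not_in_supp[of z \<phi>] by (cases "z \<in> supp \<phi>") auto
  ultimately show *: "sq_integrable (\<lambda>z. f z * \<phi> z)" by simp
  show "integrable lborel (\<lambda>z. f z * \<phi> z)"
  proof (rule sq_integrable_imp_integrable[OF *, of R])
    show "f z * \<phi> z = 0" if "norm z > R" for z using R[rule_format, OF that] by simp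
  qed
qed

lemma sq_loc_bound:
  assumes f: "sq_loc f" and [measurable]: "g \<in> borel_measurable borel" and le: "\<And>z. \<bar>g z\<bar> \<le> C * (1 + \<bar>f z\<bar>)" and C: "C \<ge> 0"
  shows "sq_loc g"
  unfolding sq_loc_def
proof (intro conjI allI impI)
  fix K :: "('a \<times> real) set" assume K: "compact K \<and> K \<subseteq> Q_all"
  have [measurable]: "K \<in> sets borel" using K compact_imp_closed borel_closed by blast
  note [measurable] = sq_locD[OF f]
  obtain R where R: "\<forall>z\<in>K. norm z \<le> R" using K compact_imp_bounded bounded_iff by blast
  have s1: "sq_integrable (indicator K)" by (rule sq_integrable_indicator[of _ R]) (use R in auto)
  have s2: "sq_integrable (\<lambda>z. indicator K z * f z)" using f K by (simp add: sq_loc_def)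
  have "sq_integrable (\<lambda>z. indicator K z * \<bar>f z\<bar>)"
    using s2 by (simp add: sq_integrable_def power_mult_distrib)
  then have s3: "sq_integrable (\<lambda>z. C * (indicator K z + indicator K z * \<bar>f z\<bar>))"
    by (intro sq_integrable_cmult sq_integrable_add s1)
  have "integrable lborel (\<lambda>z. (indicator K z * g z)\<^sup>2)"
  proof (rule Bochner_Integration.integrable_bound[OF sq_integrableD(2)[OF s3]])
    have "\<bar>indicator K z * g z\<bar> \<le> \<bar>C * (indicator K z + indicator K z * \<bar>f z\<bar>)\<bar>" for z
      using le[of z] C by (auto simp: indicator_def abs_mult)
    then have "(indicator K z * g z)\<^sup>2 \<le> (C * (indicator K z + indicator K z * \<bar>f z\<bar>))\<^sup>2" for z
      by (simp only: abs_le_square_iff)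
    then show "AE z in lborel. norm ((indicator K z * g z)\<^sup>2) \<le> norm ((C * (indicator K z + indicator K z * \<bar>f z\<bar>))\<^sup>2)"
      by simp
  qed measurable
  then show "sq_integrable (\<lambda>z. indicator K z * g z)" by (simp add: sq_integrable_def)
qed simp

lemma sq_loc_add: "sq_loc f \<Longrightarrow> sq_loc g \<Longrightarrow> sq_loc (\<lambda>z. f z + g z)"
  by (auto simp: sq_loc_def distrib_left intro: sq_integrable_add)

text \<open>\<open>U\<close> and \<open>p\<close> are Borel representatives of \<open>u\<close> and
  of its weak derivatives; the variation is computed with them, while minimality is used for
  \<open>u\<close> itself.\<close>

locale minimizer =
  fixes \<epsilon> \<gamma> :: real and u0 :: "'a::euclidean_space \<Rightarrow> real" and u U :: "'a \<times> real \<Rightarrow> real"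
    and p :: "'a \<times> real \<Rightarrow> 'a \<times> real \<Rightarrow> real"
  assumes \<gamma>: "1 \<le> \<gamma>" "\<gamma> < 2" and \<epsilon>: "0 < \<epsilon>"
    and min: "is_arg_min (energy \<epsilon> \<gamma>) (\<lambda>w. w \<in> \<U>\<^sub>0 u0) u"
    and finite_energy: "energy \<epsilon> \<gamma> u < \<infinity>"
    and U: "borel_version Q_all u U" and U_sq: "\<And>r. r > 0 \<Longrightarrow> sq_integrable (\<lambda>z. indicator (Q_cyl r) z * U z)"
    and p: "\<And>b. b \<in> Basis \<Longrightarrow> p b \<in> borel_measurable borel" "\<And>b. b \<in> Basis \<Longrightarrow> weak_partial Q_all b U (p b)"
begin

lemma U_borel [measurable]: "U \<in> borel_measurable borel" by (rule borel_versionD(1)[OF U])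

lemma p_time [measurable]: "p (0, 1) \<in> borel_measurable borel" by (rule p(1)[OF time_Basis])
lemma p_space: "i \<in> Basis \<Longrightarrow> p (i, 0) \<in> borel_measurable borel" by (rule p(1)[OF space_Basis])

definition E :: "'a \<times> real \<Rightarrow> real" where "E z = indicator Q_all z * (weight \<epsilon> z * energy_density \<epsilon> \<gamma> U p z)"

lemma E_borel [measurable]: "E \<in> borel_measurable borel"
proof -
  note [measurable] = p_space
  show ?thesis unfolding E_def[abs_def] weight_def energy_density_def by measurable
qed

lemma density_nonneg: "energy_density \<epsilon> \<gamma> w q z \<ge> 0"
  unfolding energy_density_def using \<epsilon> by (intro add_nonneg_nonneg mult_nonneg_nonneg sum_nonneg) auto

lemma weight_pos: "weight \<epsilon> z > 0" unfolding weight_def using \<epsilon> by simp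

lemma E_nonneg: "E z \<ge> 0"
  unfolding E_def by (intro mult_nonneg_nonneg density_nonneg less_imp_le[OF weight_pos]) auto

lemma energy_E: "energy \<epsilon> \<gamma> u = (\<integral>\<^sup>+z. ennreal (E z) \<partial>lborel)"
  unfolding E_def by (rule energy_eq[OF \<epsilon> U weak_deriv_version(1)[OF open_Q_all _ U p]])

lemma E_integrable: "integrable lborel E"
  using finite_energy E_nonneg unfolding energy_E by (intro integrableI_nonneg) auto

lemma p_sq_loc: assumes b: "b \<in> Basis" shows "sq_loc (p b)"
  unfolding sq_loc_def
proof (intro conjI allI impI p(1)[OF b])
  fix K :: "('a \<times> real) set" assume K: "compact K \<and> K \<subseteq> Q_all"
  have [measurable]: "K \<in> sets borel" using K compact_imp_closed borel_closed by blast
  note [measurable] = p(1)[OF b]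
  obtain R where R: "\<forall>z\<in>K. norm z \<le> R" using K compact_imp_bounded bounded_iff by blast
  \<comment> \<open>A lower bound for the coefficients of the squared derivatives in the density,
    times one for the weight on \<open>K\<close>, where time is at most \<open>R\<close>.\<close>
  define m where "m = min \<epsilon> 1 * (exp (- R / \<epsilon>) / \<epsilon>)"
  have m: "m > 0" unfolding m_def using \<epsilon> by simp
  have le: "(indicator K z * p b z)\<^sup>2 \<le> (1 / m) * E z" for z
  proof (cases "z \<in> K")
    case True
    then have "z \<in> Q_all" using K by blast
    have "\<bar>snd z\<bar> \<le> R" using R True norm_snd_le[of "snd z" "fst z"] by fastforce
    then have "exp (- R / \<epsilon>) / \<epsilon> \<le> weight \<epsilon> z"
      unfolding weight_def using \<epsilon> by (intro divide_right_mono) (auto simp: divide_right_mono)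
    moreover have "min \<epsilon> 1 * (p b z)\<^sup>2 \<le> energy_density \<epsilon> \<gamma> U p z"
    proof -
      have n: "0 \<le> \<epsilon> * (p (0, 1) z)\<^sup>2" "0 \<le> (\<Sum>i\<in>Basis. (p (i, 0) z)\<^sup>2)" "0 \<le> 2 * max (U z) 0 powr \<gamma>"
        using \<epsilon> by (auto intro: sum_nonneg)
      consider "b = (0, 1)" | i where "i \<in> Basis" "b = (i, 0)" using b by (rule Basis_space_time_cases)
      then show ?thesis
      proof cases
        case 1
        have "min \<epsilon> 1 * (p b z)\<^sup>2 \<le> \<epsilon> * (p (0, 1) z)\<^sup>2" unfolding 1 by (intro mult_right_mono) auto
        then show ?thesis unfolding energy_density_def using n by linarith
      next
        case 2
        have "min \<epsilon> 1 * (p b z)\<^sup>2 \<le> 1 * (p b z)\<^sup>2" by (intro mult_right_mono) auto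
        also have "1 * (p b z)\<^sup>2 \<le> (\<Sum>i\<in>Basis. (p (i, 0) z)\<^sup>2)"
          using member_le_sum[OF 2(1), of "\<lambda>i. (p (i, 0) z)\<^sup>2"] 2 by simp
        finally show ?thesis unfolding energy_density_def using n by linarith
      qed
    qed
    ultimately have "(exp (- R / \<epsilon>) / \<epsilon>) * (min \<epsilon> 1 * (p b z)\<^sup>2) \<le> weight \<epsilon> z * energy_density \<epsilon> \<gamma> U p z"
      using \<epsilon> weight_pos[of z] by (intro mult_mono) auto
    then have "m * (p b z)\<^sup>2 \<le> E z" using \<open>z \<in> Q_all\<close> by (simp add: m_def E_def mult_ac)
    then show ?thesis using True m by (simp add: pos_le_divide_eq mult.commute)
  next
    case False
    then show ?thesis using m E_nonneg[of z] by simp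
  qed
  have "integrable lborel (\<lambda>z. (indicator K z * p b z)\<^sup>2)"
  proof (rule Bochner_Integration.integrable_bound)
    show "integrable lborel (\<lambda>z. (1 / m) * E z)" by (rule integrable_mult_right[OF E_integrable])
    show "AE z in lborel. norm ((indicator K z * p b z)\<^sup>2) \<le> norm ((1 / m) * E z)"
    proof (rule AE_I2)
      fix z
      have "norm ((1 / m) * E z) = (1 / m) * E z" using m E_nonneg[of z] by simp
      then show "norm ((indicator K z * p b z)\<^sup>2) \<le> norm ((1 / m) * E z)" using le[of z] by simp
    qed
  qed measurable
  then show "sq_integrable (\<lambda>z. indicator K z * p b z)" by (simp add: sq_integrable_def)
qed

lemma U_sq_loc: "sq_loc U"
  unfolding sq_loc_def
proof (intro conjI allI impI U_borel)
  fix K :: "('a \<times> real) set" assume K: "compact K \<and> K \<subseteq> Q_all"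
  have [measurable]: "K \<in> sets borel" using K compact_imp_closed borel_closed by blast
  obtain R where R: "R > 0" "\<forall>z\<in>K. norm z \<le> R" using K compact_imp_bounded bounded_pos by blast
  \<comment> \<open>Radius \<open>R + 1\<close> serves space and time together, because
    \<open>R < (R + 1)\<^sup>2\<close>.\<close>
  have "K \<subseteq> Q_cyl (R + 1)"
  proof
    fix z assume z: "z \<in> K"
    then have "norm (fst z) \<le> R" "norm (snd z) \<le> R" "z \<in> Q_all"
      using R(2) K norm_fst_le[of "fst z" "snd z"] norm_snd_le[of "snd z" "fst z"] by (auto intro: order_trans)
    moreover have "R < (R + 1)\<^sup>2" using R(1) by (simp add: power2_eq_square algebra_simps add_pos_pos)
    ultimately show "z \<in> Q_cyl (R + 1)" by (cases z) (auto simp: Q_cyl_def Q_all_def)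
  qed
  then have "(\<lambda>z. indicator K z * (indicator (Q_cyl (R + 1)) z * U z)) = (\<lambda>z. indicator K z * U z)"
    by (intro ext) (auto simp: indicator_def)
  moreover have "sq_integrable (\<lambda>z. indicator K z * (indicator (Q_cyl (R + 1)) z * U z))"
    by (rule sq_integrable_bounded_mult[OF U_sq, where B=1]) (use R in \<open>auto simp: indicator_def\<close>)
  ultimately show "sq_integrable (\<lambda>z. indicator K z * U z)" by (simp only:)
qed

lemma f_reac_sq_loc: "sq_loc (\<lambda>z. f_reac \<gamma> (U z))"
  by (rule sq_loc_bound[OF U_sq_loc, of _ \<gamma>]) (use f_reac_bound[OF \<gamma>] \<gamma> in auto)

definition \<Lambda> :: "('a \<times> real \<Rightarrow> real) \<Rightarrow> real" where
  "\<Lambda> \<eta> = (\<integral>z. \<epsilon> * (p (0, 1) z * partial_deriv (0, 1) \<eta> z) + p (0, 1) z * \<eta> z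
     + (\<Sum>i\<in>Basis. p (i, 0) z * partial_deriv (i, 0) \<eta> z) + f_reac \<gamma> (U z) * \<eta> z \<partial>lborel)"

text \<open>The excess of the one-sided limit in \<open>f_reac_tendsto\<close> over
  \<open>f_reac \<gamma> (U z) * \<eta> z\<close>.\<close>

definition jump :: "('a \<times> real \<Rightarrow> real) \<Rightarrow> 'a \<times> real \<Rightarrow> real" where
  "jump \<eta> z = (if \<gamma> = 1 \<and> U z = 0 then max (\<eta> z) 0 else 0)"

text \<open>Compares \<open>u\<close> with \<open>u + \<delta> * \<phi>\<close>; \<open>X\<close>
  dominates the increase of the weighted density divided by \<open>\<delta>\<close>. It is a
  parameter so that it can be supplied in a form where the weight has cancelled and integrability is
  evident.\<close>

lemma variation_step:
  assumes \<phi>: "\<phi> \<in> test_functions Q_all" and \<delta>: "\<delta> > 0"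
    and X: "integrable lborel X"
    and X_eq: "\<And>z. z \<in> Q_all \<Longrightarrow> X z = weight \<epsilon> z * (2 * \<epsilon> * (p (0, 1) z * partial_deriv (0, 1) \<phi> z)
      + 2 * (\<Sum>i\<in>Basis. p (i, 0) z * partial_deriv (i, 0) \<phi> z) + 2 * (f_reac \<gamma> (U z + \<delta> * \<phi> z) * \<phi> z)
      + \<delta> * (\<epsilon> * (partial_deriv (0, 1) \<phi> z)\<^sup>2 + (\<Sum>i\<in>Basis. (partial_deriv (i, 0) \<phi> z)\<^sup>2)))"
    and X_out: "\<And>z. z \<notin> Q_all \<Longrightarrow> X z = 0"
  shows "0 \<le> (\<integral>z. X z \<partial>lborel)"
proof -
  note s\<phi> = test_functionsD(1)[OF \<phi>]
  define \<psi> where "\<psi> = (\<lambda>z. \<delta> * \<phi> z)"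
  have \<psi>: "\<psi> \<in> test_functions Q_all" unfolding \<psi>_def by (rule test_functions_cmult[OF \<phi>])
  note s\<psi> = test_functionsD(1)[OF \<psi>]
  have p\<psi>: "partial_deriv b \<psi> z = \<delta> * partial_deriv b \<phi> z" for b z
    unfolding \<psi>_def by (rule partial_deriv_cmult[OF smooth_differentiable[OF s\<phi>]])
  define q where "q = (\<lambda>b z. p b z + partial_deriv b \<psi> z)"
  have u: "u \<in> \<U>\<^sub>0 u0" using min by (simp add: is_arg_min_def)
  have "(\<lambda>z. u z + \<psi> z) \<in> \<U>\<^sub>0 u0" by (rule \<U>\<^sub>0_add_test[OF u \<psi>])
  then have le: "energy \<epsilon> \<gamma> u \<le> energy \<epsilon> \<gamma> (\<lambda>z. u z + \<psi> z)"
    using min unfolding is_arg_min_def by (meson not_le_imp_less)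
  note ver = borel_version_add[OF U borel_version_smooth[OF s\<psi>]]
  have qb: "q b \<in> borel_measurable borel" if "b \<in> Basis" for b
    unfolding q_def by (rule borel_measurable_add[OF p(1)[OF that] smooth_borel[OF smooth_partial[OF s\<psi> that]]])
  have qw: "weak_partial Q_all b (\<lambda>z. U z + \<psi> z) (q b)" if "b \<in> Basis" for b
    unfolding q_def by (rule weak_partial_add[OF that p(2)[OF that] weak_partial_smooth[OF s\<psi> that]])
  \<comment> \<open>The quadratic terms are expanded exactly; only the reaction term is estimated,
    by the subgradient inequality at the perturbed value.\<close>
  have pw: "indicator Q_all z * (weight \<epsilon> z * energy_density \<epsilon> \<gamma> (\<lambda>z. U z + \<psi> z) q z) \<le> E z + \<delta> * X z" for z
    proof (cases "z \<in> Q_all")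
      case True
      have "max (U z + \<psi> z) 0 powr \<gamma> - max (U z) 0 powr \<gamma> \<le> f_reac \<gamma> (U z + \<psi> z) * \<psi> z"
        using pos_part_powr_subgradient[OF \<gamma>(1), of "U z + \<psi> z" "U z"] by simp
      moreover have "(\<Sum>i\<in>Basis. (q (i, 0) z)\<^sup>2) = (\<Sum>i\<in>Basis. (p (i, 0) z)\<^sup>2) +
          2 * \<delta> * (\<Sum>i\<in>Basis. p (i, 0) z * partial_deriv (i, 0) \<phi> z) + \<delta>\<^sup>2 * (\<Sum>i\<in>Basis. (partial_deriv (i, 0) \<phi> z)\<^sup>2)"
        by (simp add: q_def p\<psi> power2_sum power_mult_distrib sum.distrib sum_distrib_left mult_ac)
      moreover have "(q (0, 1) z)\<^sup>2 = (p (0, 1) z)\<^sup>2 + 2 * \<delta> * (p (0, 1) z * partial_deriv (0, 1) \<phi> z) + \<delta>\<^sup>2 * (partial_deriv (0, 1) \<phi> z)\<^sup>2"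
        by (simp add: q_def p\<psi> power2_sum power_mult_distrib mult_ac)
      ultimately have "energy_density \<epsilon> \<gamma> (\<lambda>z. U z + \<psi> z) q z \<le> energy_density \<epsilon> \<gamma> U p z + \<delta> *
        (2 * \<epsilon> * (p (0, 1) z * partial_deriv (0, 1) \<phi> z)
      + 2 * (\<Sum>i\<in>Basis. p (i, 0) z * partial_deriv (i, 0) \<phi> z) + 2 * (f_reac \<gamma> (U z + \<delta> * \<phi> z) * \<phi> z)
      + \<delta> * (\<epsilon> * (partial_deriv (0, 1) \<phi> z)\<^sup>2 + (\<Sum>i\<in>Basis. (partial_deriv (i, 0) \<phi> z)\<^sup>2)))"
        unfolding energy_density_def by (simp add: \<psi>_def algebra_simps power2_eq_square)
      from mult_left_mono[OF this less_imp_le[OF weight_pos[of z]]] show ?thesis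
        using True by (simp add: E_def X_eq distrib_left mult.left_commute)
    next
      case False
      then show ?thesis by (simp add: E_def X_out)
    qed
  have "energy \<epsilon> \<gamma> (\<lambda>z. u z + \<psi> z) =
      (\<integral>\<^sup>+z. ennreal (indicator Q_all z * (weight \<epsilon> z * energy_density \<epsilon> \<gamma> (\<lambda>z. U z + \<psi> z) q z)) \<partial>lborel)"
    by (rule energy_eq[OF \<epsilon> ver weak_deriv_version(1)[OF open_Q_all _ ver qb qw]])
  also have "\<dots> \<le> (\<integral>\<^sup>+z. ennreal (E z + \<delta> * X z) \<partial>lborel)"
    by (intro nn_integral_mono ennreal_leI pw)
  finally have "(\<integral>\<^sup>+z. ennreal (E z) \<partial>lborel) \<le> (\<integral>\<^sup>+z. ennreal (E z + \<delta> * X z) \<partial>lborel)"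
    using le unfolding energy_E by (rule order_trans[rotated])
  moreover have nn: "0 \<le> E z + \<delta> * X z" for z
  proof -
    have "0 \<le> indicator Q_all z * (weight \<epsilon> z * energy_density \<epsilon> \<gamma> (\<lambda>z. U z + \<psi> z) q z)"
      by (intro mult_nonneg_nonneg density_nonneg less_imp_le[OF weight_pos]) auto
    also note pw
    finally show ?thesis .
  qed
  ultimately have "ennreal (\<integral>z. E z \<partial>lborel) \<le> ennreal (\<integral>z. E z + \<delta> * X z \<partial>lborel)"
    using E_integrable X E_nonneg by (subst (asm) (1 2) nn_integral_eq_integral) auto
  then have "(\<integral>z. E z \<partial>lborel) \<le> (\<integral>z. E z + \<delta> * X z \<partial>lborel)"
    by (subst (asm) ennreal_le_iff) (intro Bochner_Integration.integral_nonneg nn)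
  also have "\<dots> = (\<integral>z. E z \<partial>lborel) + \<delta> * (\<integral>z. X z \<partial>lborel)"
    using E_integrable X by simp
  finally have "0 \<le> \<delta> * (\<integral>z. X z \<partial>lborel)" by simp
  then show ?thesis using \<delta> by (simp add: zero_le_mult_iff)
qed

end

section \<open>The variational inequality and the equation\<close>

context minimizer
begin

lemma f_reac_shift_bound:
  assumes "\<bar>s\<bar> \<le> B"
  shows "\<bar>f_reac \<gamma> (x + s)\<bar> \<le> \<gamma> * (1 + B) * (1 + \<bar>x\<bar>)"
proof -
  have B: "0 \<le> B" using assms by linarith
  have "\<bar>f_reac \<gamma> (x + s)\<bar> \<le> \<gamma> * (1 + \<bar>x + s\<bar>)" by (rule f_reac_bound[OF \<gamma>])
  also have "\<dots> \<le> \<gamma> * ((1 + B) * (1 + \<bar>x\<bar>))"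
  proof (rule mult_left_mono)
    have "1 + \<bar>x + s\<bar> \<le> 1 + \<bar>x\<bar> + B" using assms by linarith
    also have "\<dots> \<le> (1 + B) * (1 + \<bar>x\<bar>)" using B by (simp add: algebra_simps)
    finally show "1 + \<bar>x + s\<bar> \<le> (1 + B) * (1 + \<bar>x\<bar>)" .
  qed (use \<gamma> in simp)
  finally show ?thesis by (simp add: mult.assoc)
qed

lemma space_sum_integrable:
  assumes \<eta>: "\<eta> \<in> test_functions Q_all"
  shows "integrable lborel (\<lambda>z. \<Sum>i\<in>Basis. p (i, 0) z * partial_deriv (i, 0) \<eta> z)"
  by (intro Bochner_Integration.integrable_sum sq_loc_mult_test(2)[OF p_sq_loc[OF space_Basis]
        test_functions_partial[OF \<eta> space_Basis]])

lemma time_integrable: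
  assumes \<eta>: "\<eta> \<in> test_functions Q_all"
  shows "integrable lborel (\<lambda>z. p (0, 1) z * partial_deriv (0, 1) \<eta> z)" "integrable lborel (\<lambda>z. p (0, 1) z * \<eta> z)"
    "integrable lborel (\<lambda>z. f_reac \<gamma> (U z) * \<eta> z)"
  by (rule sq_loc_mult_test(2)[OF p_sq_loc[OF time_Basis] test_functions_partial[OF \<eta> time_Basis]]
      sq_loc_mult_test(2)[OF p_sq_loc[OF time_Basis] \<eta>] sq_loc_mult_test(2)[OF f_reac_sq_loc \<eta>])+

lemma jump_integrable:
  assumes \<eta>: "\<eta> \<in> test_functions Q_all"
  shows "integrable lborel (jump \<eta>)"
proof (rule Bochner_Integration.integrable_bound)
  note [measurable] = smooth_borel[OF test_functionsD(1)[OF \<eta>]]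
  show "integrable lborel \<eta>" by (rule test_functions_integrable[OF \<eta>])
  show "jump \<eta> \<in> borel_measurable lborel" unfolding jump_def[abs_def] by measurable
  show "AE z in lborel. norm (jump \<eta> z) \<le> norm (\<eta> z)" by (auto simp: jump_def)
qed

lemma variation:
  assumes \<eta>: "\<eta> \<in> test_functions Q_all"
  shows "0 \<le> \<Lambda> \<eta> + (\<integral>z. jump \<eta> z \<partial>lborel)"
proof -
  note s\<eta> = test_functionsD(1)[OF \<eta>]
  note [measurable] = smooth_borel[OF s\<eta>]
  define \<phi> where "\<phi> = (\<lambda>z. exp (snd z / \<epsilon>) * \<eta> z)"
  have \<phi>: "\<phi> \<in> test_functions Q_all" unfolding \<phi>_def by (rule test_functions_mult[OF \<eta> smooth_exp_snd])
  note s\<phi> = test_functionsD(1)[OF \<phi>]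
  note [measurable] = smooth_borel[OF s\<phi>]
  \<comment> \<open>In the time direction the exponential adds \<open>\<eta> z / \<epsilon>\<close>.
    Together with the factor \<open>\<epsilon>\<close> in the energy, this produces the first order
    term of the equation.\<close>
  have p\<phi>: "partial_deriv b \<phi> z = exp (snd z / \<epsilon>) * (partial_deriv b \<eta> z + (snd b / \<epsilon>) * \<eta> z)" for b z
    unfolding \<phi>_def partial_deriv_mult[OF smooth_differentiable[OF smooth_exp_snd] smooth_differentiable[OF s\<eta>]]
      partial_deriv_exp_snd by (simp add: algebra_simps)
  have we: "weight \<epsilon> z * exp (snd z / \<epsilon>) = 1 / \<epsilon>" for z
    by (simp add: weight_def exp_minus)
  obtain B where B: "\<forall>z. \<bar>\<phi> z\<bar> \<le> B" using test_functions_bounded[OF \<phi>] by meson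
  define \<delta> where "\<delta> = (\<lambda>k. inverse (real (Suc k)))"
  have \<delta>: "\<delta> k > 0" "\<delta> k \<le> 1" for k by (auto simp: \<delta>_def inverse_le_1_iff)
  have \<delta>B: "\<bar>\<delta> k * \<phi> z\<bar> \<le> B" for k z
  proof -
    have "\<bar>\<delta> k\<bar> * \<bar>\<phi> z\<bar> \<le> 1 * B" using \<delta>[of k] B[rule_format, of z] by (intro mult_mono) auto
    then show ?thesis by (simp add: abs_mult)
  qed
  \<comment> \<open>After the weight has cancelled and up to the factor
    \<open>1 / \<epsilon>\<close>, \<open>A\<close> is linear in the derivatives of
    \<open>\<eta>\<close> and in \<open>\<eta>\<close>, \<open>F k\<close> is the reaction at the
    perturbed value, and \<open>W\<close> is the quadratic remainder, in which one factor
    \<open>\<phi>\<close> keeps its exponential.\<close>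
  define A where "A = (\<lambda>z. 2 * (\<epsilon> * (p (0, 1) z * partial_deriv (0, 1) \<eta> z) + p (0, 1) z * \<eta> z
      + (\<Sum>i\<in>Basis. p (i, 0) z * partial_deriv (i, 0) \<eta> z)))"
  define W where "W = (\<lambda>z. \<epsilon> * ((partial_deriv (0, 1) \<eta> z + \<eta> z / \<epsilon>) * partial_deriv (0, 1) \<phi> z)
      + (\<Sum>i\<in>Basis. partial_deriv (i, 0) \<eta> z * partial_deriv (i, 0) \<phi> z))"
  define F where "F = (\<lambda>k z. f_reac \<gamma> (U z + \<delta> k * \<phi> z) * \<eta> z)"
  have Ai: "integrable lborel A"
    unfolding A_def using space_sum_integrable[OF \<eta>] time_integrable[OF \<eta>]
    by (intro integrable_mult_right Bochner_Integration.integrable_add)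
  have Wi: "integrable lborel W"
  proof -
    have "integrable lborel (\<lambda>z. partial_deriv b \<eta> z * partial_deriv b \<phi> z)" "integrable lborel (\<lambda>z. \<eta> z * partial_deriv b \<phi> z)"
      if "b \<in> Basis" for b
      by (rule sq_integrable_mult test_functions_sq_integrable[OF \<eta>] sq_integrable_partial[OF \<eta> that] sq_integrable_partial[OF \<phi> that])+
    note i = this
    have "W = (\<lambda>z. \<epsilon> * (partial_deriv (0, 1) \<eta> z * partial_deriv (0, 1) \<phi> z) + \<eta> z * partial_deriv (0, 1) \<phi> z
        + (\<Sum>i\<in>Basis. partial_deriv (i, 0) \<eta> z * partial_deriv (i, 0) \<phi> z))"
      using \<epsilon> by (simp add: W_def fun_eq_iff field_simps)
    then show ?thesis
      using i[OF time_Basis] i(1)[OF space_Basis]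
      by (auto intro!: integrable_mult_right Bochner_Integration.integrable_add Bochner_Integration.integrable_sum)
  qed
  have Fi: "integrable lborel (F k)" for k
    unfolding F_def
  proof (rule sq_loc_mult_test(2)[OF sq_loc_bound[OF U_sq_loc, of _ "\<gamma> * (1 + B)"] \<eta>])
    show "\<bar>f_reac \<gamma> (U z + \<delta> k * \<phi> z)\<bar> \<le> \<gamma> * (1 + B) * (1 + \<bar>U z\<bar>)" for z by (rule f_reac_shift_bound[OF \<delta>B])
    show "0 \<le> \<gamma> * (1 + B)" using \<gamma> \<delta>B[of 0 0] by (intro mult_nonneg_nonneg) auto
  qed measurable
  have ge: "0 \<le> (\<integral>z. A z \<partial>lborel) + 2 * (\<integral>z. F k z \<partial>lborel) + \<delta> k * (\<integral>z. W z \<partial>lborel)" for k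
  proof -
    define X where "X = (\<lambda>z. (1 / \<epsilon>) * (A z + 2 * F k z + \<delta> k * W z))"
    have "0 \<le> (\<integral>z. X z \<partial>lborel)"
    proof (rule variation_step[OF \<phi> \<delta>(1)[of k]])
      show "integrable lborel X" unfolding X_def using Ai Wi Fi by simp
      fix z :: "'a \<times> real"
      show "X z = 0" if "z \<notin> Q_all"
      proof -
        have "z \<notin> supp \<eta>" using that test_functionsD(3)[OF \<eta>] by blast
        then have "\<eta> z = 0" "\<And>b. partial_deriv b \<eta> z = 0" using not_in_supp[of z \<eta>] partial_deriv_not_in_supp[of z \<eta>] by blast+
        then show ?thesis by (simp add: X_def A_def F_def W_def)
      qed
      let ?e = "exp (snd z / \<epsilon>)" and ?w = "weight \<epsilon> z"
      have wf: "?w * (?e * x) = x / \<epsilon>" for x using we[of z] by (simp flip: mult.assoc)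
      have t: "?w * (2 * \<epsilon> * (p (0, 1) z * partial_deriv (0, 1) \<phi> z)) = (1 / \<epsilon>) * (2 * (\<epsilon> * (p (0, 1) z * partial_deriv (0, 1) \<eta> z) + p (0, 1) z * \<eta> z))"
      proof -
        have "?w * (2 * \<epsilon> * (p (0, 1) z * partial_deriv (0, 1) \<phi> z)) = ?w * (?e * (2 * \<epsilon> * p (0, 1) z * (partial_deriv (0, 1) \<eta> z + \<eta> z / \<epsilon>)))"
          unfolding p\<phi> by (simp add: mult_ac)
        also have "\<dots> = (2 * \<epsilon> * p (0, 1) z * (partial_deriv (0, 1) \<eta> z + \<eta> z / \<epsilon>)) / \<epsilon>" by (rule wf)
        also have "\<dots> = (1 / \<epsilon>) * (2 * (\<epsilon> * (p (0, 1) z * partial_deriv (0, 1) \<eta> z) + p (0, 1) z * \<eta> z))"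
          using \<epsilon> by (simp add: field_simps)
        finally show ?thesis .
      qed
      have s: "?w * (2 * (\<Sum>i\<in>Basis. p (i, 0) z * partial_deriv (i, 0) \<phi> z)) = (1 / \<epsilon>) * (2 * (\<Sum>i\<in>Basis. p (i, 0) z * partial_deriv (i, 0) \<eta> z))"
      proof -
        have "?w * (2 * (\<Sum>i\<in>Basis. p (i, 0) z * partial_deriv (i, 0) \<phi> z)) = ?w * (?e * (2 * (\<Sum>i\<in>Basis. p (i, 0) z * partial_deriv (i, 0) \<eta> z)))"
          unfolding p\<phi> by (simp add: mult_ac sum_distrib_left)
        then show ?thesis unfolding wf by simp
      qed
      have f: "?w * (2 * (f_reac \<gamma> (U z + \<delta> k * \<phi> z) * \<phi> z)) = (1 / \<epsilon>) * (2 * F k z)"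
      proof -
        have "?w * (2 * (f_reac \<gamma> (U z + \<delta> k * \<phi> z) * \<phi> z)) = ?w * (?e * (2 * F k z))"
          unfolding F_def by (subst (2) \<phi>_def) (simp add: mult_ac)
        then show ?thesis unfolding wf by simp
      qed
      have q: "?w * (\<epsilon> * (partial_deriv (0, 1) \<phi> z)\<^sup>2 + (\<Sum>i\<in>Basis. (partial_deriv (i, 0) \<phi> z)\<^sup>2)) = (1 / \<epsilon>) * W z"
      proof -
        have "(\<epsilon> * (partial_deriv (0, 1) \<phi> z)\<^sup>2 + (\<Sum>i\<in>Basis. (partial_deriv (i, 0) \<phi> z)\<^sup>2)) = ?e * W z"
          unfolding W_def power2_eq_square by (simp add: p\<phi> distrib_left sum_distrib_left mult_ac)
        then show ?thesis by (simp add: wf)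
      qed
      show "X z = ?w * (2 * \<epsilon> * (p (0, 1) z * partial_deriv (0, 1) \<phi> z)
      + 2 * (\<Sum>i\<in>Basis. p (i, 0) z * partial_deriv (i, 0) \<phi> z) + 2 * (f_reac \<gamma> (U z + \<delta> k * \<phi> z) * \<phi> z)
      + \<delta> k * (\<epsilon> * (partial_deriv (0, 1) \<phi> z)\<^sup>2 + (\<Sum>i\<in>Basis. (partial_deriv (i, 0) \<phi> z)\<^sup>2)))"
        unfolding distrib_left[of ?w] t s f mult.left_commute[of ?w "\<delta> k"]
        unfolding distrib_left[of ?w, symmetric] q X_def A_def by (simp add: algebra_simps add_divide_distrib)
    qed
    also have "(\<integral>z. X z \<partial>lborel) = (1 / \<epsilon>) * ((\<integral>z. A z \<partial>lborel) + 2 * (\<integral>z. F k z \<partial>lborel) + \<delta> k * (\<integral>z. W z \<partial>lborel))"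
      unfolding X_def using Ai Wi Fi by simp
    finally show ?thesis using \<epsilon> by (simp add: zero_le_divide_iff)
  qed
  \<comment> \<open>The perturbations are bounded by \<open>B\<close> uniformly in \<open>k\<close>,
    so the linear growth of \<open>f_reac\<close> gives the majorant.\<close>
  have F_lim: "(\<lambda>k. \<integral>z. F k z \<partial>lborel) \<longlonglongrightarrow> (\<integral>z. f_reac \<gamma> (U z) * \<eta> z + jump \<eta> z \<partial>lborel)"
  proof (rule integral_dominated_convergence[where w="\<lambda>z. \<gamma> * (1 + B) * (\<bar>\<eta> z\<bar> + \<bar>U z * \<eta> z\<bar>)"])
    show "(\<lambda>z. f_reac \<gamma> (U z) * \<eta> z + jump \<eta> z) \<in> borel_measurable lborel"
      using time_integrable(3)[OF \<eta>] jump_integrable[OF \<eta>] by (intro borel_measurable_add borel_measurable_integrable)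
    show "F k \<in> borel_measurable lborel" for k by (rule borel_measurable_integrable[OF Fi])
    show "integrable lborel (\<lambda>z. \<gamma> * (1 + B) * (\<bar>\<eta> z\<bar> + \<bar>U z * \<eta> z\<bar>))"
      using test_functions_integrable[OF \<eta>] sq_loc_mult_test(2)[OF U_sq_loc \<eta>]
      by (intro integrable_mult_right Bochner_Integration.integrable_add integrable_abs)
    have "(\<lambda>k. F k z) \<longlonglongrightarrow> f_reac \<gamma> (U z) * \<eta> z + jump \<eta> z" for z
      unfolding F_def \<phi>_def \<delta>_def jump_def by (rule f_reac_tendsto[OF \<gamma>(1)]) simp
    then show "AE z in lborel. (\<lambda>k. F k z) \<longlonglongrightarrow> f_reac \<gamma> (U z) * \<eta> z + jump \<eta> z" by simp
    have "norm (F k z) \<le> \<gamma> * (1 + B) * (\<bar>\<eta> z\<bar> + \<bar>U z * \<eta> z\<bar>)" for k z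
    proof -
      have "norm (F k z) \<le> (\<gamma> * (1 + B) * (1 + \<bar>U z\<bar>)) * \<bar>\<eta> z\<bar>"
        unfolding F_def real_norm_def abs_mult by (rule mult_right_mono[OF f_reac_shift_bound[OF \<delta>B]]) simp
      then show ?thesis by (simp add: abs_mult algebra_simps)
    qed
    then show "AE z in lborel. norm (F k z) \<le> \<gamma> * (1 + B) * (\<bar>\<eta> z\<bar> + \<bar>U z * \<eta> z\<bar>)" for k by simp
  qed
  have "\<delta> \<longlonglongrightarrow> 0" unfolding \<delta>_def by (rule LIMSEQ_inverse_real_of_nat)
  then have "(\<lambda>k. (\<integral>z. A z \<partial>lborel) + 2 * (\<integral>z. F k z \<partial>lborel) + \<delta> k * (\<integral>z. W z \<partial>lborel)) \<longlonglongrightarrow>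
    (\<integral>z. A z \<partial>lborel) + 2 * (\<integral>z. f_reac \<gamma> (U z) * \<eta> z + jump \<eta> z \<partial>lborel) + 0 * (\<integral>z. W z \<partial>lborel)"
    by (intro tendsto_intros F_lim)
  then have "0 \<le> (\<integral>z. A z \<partial>lborel) + 2 * (\<integral>z. f_reac \<gamma> (U z) * \<eta> z + jump \<eta> z \<partial>lborel) + 0 * (\<integral>z. W z \<partial>lborel)"
    by (rule LIMSEQ_le_const) (use ge in blast)
  then show ?thesis
    unfolding A_def \<Lambda>_def using space_sum_integrable[OF \<eta>] time_integrable[OF \<eta>] jump_integrable[OF \<eta>] by simp
qed

lemma \<Lambda>_uminus:
  assumes \<eta>: "\<eta> \<in> test_functions Q_all"
  shows "\<Lambda> (\<lambda>z. - \<eta> z) = - \<Lambda> \<eta>"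
proof -
  have "partial_deriv b (\<lambda>z. - \<eta> z) z = - partial_deriv b \<eta> z" for b z
    using partial_deriv_cmult[OF smooth_differentiable[OF test_functionsD(1)[OF \<eta>]], of b "-1" z] by simp
  then have "\<Lambda> (\<lambda>z. - \<eta> z) = (\<integral>z. - (\<epsilon> * (p (0, 1) z * partial_deriv (0, 1) \<eta> z) + p (0, 1) z * \<eta> z
     + (\<Sum>i\<in>Basis. p (i, 0) z * partial_deriv (i, 0) \<eta> z) + f_reac \<gamma> (U z) * \<eta> z) \<partial>lborel)"
    unfolding \<Lambda>_def by (intro arg_cong[where f="integral\<^sup>L lborel"]) (simp add: fun_eq_iff sum_negf)
  then show ?thesis unfolding \<Lambda>_def by (simp only: Bochner_Integration.integral_minus)
qed

text \<open>The variational inequality for \<open>\<eta>\<close> and for \<open>- \<eta>\<close>;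
  the jump terms are the positive and the negative part of \<open>\<eta>\<close> on the zero set.
  For \<open>\<gamma> > 1\<close> the right-hand side is 0.\<close>

lemma \<Lambda>_bound:
  assumes \<eta>: "\<eta> \<in> test_functions Q_all"
  shows "\<bar>\<Lambda> \<eta>\<bar> \<le> (\<integral>z. (if \<gamma> = 1 \<and> U z = 0 then \<bar>\<eta> z\<bar> else 0) \<partial>lborel)"
proof -
  note [measurable] = smooth_borel[OF test_functionsD(1)[OF \<eta>]]
  have i: "integrable lborel (\<lambda>z. if \<gamma> = 1 \<and> U z = 0 then \<bar>\<eta> z\<bar> else 0)"
    by (rule Bochner_Integration.integrable_bound[OF test_functions_integrable[OF \<eta>]]) auto
  have "(\<integral>z. jump \<eta> z \<partial>lborel) \<le> (\<integral>z. (if \<gamma> = 1 \<and> U z = 0 then \<bar>\<eta> z\<bar> else 0) \<partial>lborel)"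
    by (rule integral_mono[OF jump_integrable[OF \<eta>] i]) (auto simp: jump_def)
  moreover have "(\<integral>z. jump (\<lambda>z. - \<eta> z) z \<partial>lborel) \<le> (\<integral>z. (if \<gamma> = 1 \<and> U z = 0 then \<bar>\<eta> z\<bar> else 0) \<partial>lborel)"
    by (rule integral_mono[OF jump_integrable[OF test_functions_uminus[OF \<eta>]] i]) (auto simp: jump_def)
  ultimately show ?thesis
    using variation[OF \<eta>] variation[OF test_functions_uminus[OF \<eta>]] unfolding \<Lambda>_uminus[OF \<eta>] by linarith
qed

text \<open>The diagonal of the elliptic operator with \<open>\<epsilon>\<close> in time and 1 in
  space; \<open>(0, 1)\<close> is the only basis vector whose first component is 0.\<close>

definition coeff :: "'a \<times> real \<Rightarrow> real" where "coeff b = (if fst b = 0 then \<epsilon> else 1)"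
definition lower :: "'a \<times> real \<Rightarrow> real" where "lower z = p (0, 1) z + f_reac \<gamma> (U z)"

lemma lower_sq_loc: "sq_loc lower"
  unfolding lower_def[abs_def] by (rule sq_loc_add[OF p_sq_loc[OF time_Basis] f_reac_sq_loc])

lemma \<Lambda>_eq:
  assumes \<eta>: "\<eta> \<in> test_functions Q_all"
  shows "\<Lambda> \<eta> = (\<Sum>b\<in>Basis. coeff b * (\<integral>z. p b z * partial_deriv b \<eta> z \<partial>lborel)) + (\<integral>z. lower z * \<eta> z \<partial>lborel)"
proof -
  have si: "integrable lborel (\<lambda>z. p (i, 0) z * partial_deriv (i, 0) \<eta> z)" if "i \<in> Basis" for i
    by (rule sq_loc_mult_test(2)[OF p_sq_loc[OF space_Basis[OF that]] test_functions_partial[OF \<eta> space_Basis[OF that]]])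
  have "\<Lambda> \<eta> = \<epsilon> * (\<integral>z. p (0, 1) z * partial_deriv (0, 1) \<eta> z \<partial>lborel) + (\<integral>z. p (0, 1) z * \<eta> z \<partial>lborel) +
     (\<Sum>i\<in>Basis. \<integral>z. p (i, 0) z * partial_deriv (i, 0) \<eta> z \<partial>lborel) + (\<integral>z. f_reac \<gamma> (U z) * \<eta> z \<partial>lborel)"
    unfolding \<Lambda>_def using space_sum_integrable[OF \<eta>] time_integrable[OF \<eta>] si by (simp add: Bochner_Integration.integral_sum)
  moreover have "(\<integral>z. lower z * \<eta> z \<partial>lborel) = (\<integral>z. p (0, 1) z * \<eta> z \<partial>lborel) + (\<integral>z. f_reac \<gamma> (U z) * \<eta> z \<partial>lborel)"
    unfolding lower_def distrib_right using time_integrable[OF \<eta>] by simp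
  moreover have "(\<Sum>i\<in>Basis. coeff (i, 0) * (\<integral>z. p (i, 0) z * partial_deriv (i, 0) \<eta> z \<partial>lborel)) =
     (\<Sum>i\<in>Basis. \<integral>z. p (i, 0) z * partial_deriv (i, 0) \<eta> z \<partial>lborel)"
    by (intro sum.cong refl) (simp add: coeff_def nonzero_Basis)
  ultimately show ?thesis unfolding sum_Basis_space_time by (simp add: coeff_def)
qed

text \<open>
  For \<open>\<gamma> = 1\<close> the variation only gives \<open>\<bar>\<Lambda> \<eta>\<bar> \<le> \<integral>\<^bsub>{u = 0}\<^esub> \<bar>\<eta>\<bar>\<close>. Localised by a cutoff \<open>\<zeta>\<close>,
  this says that an elliptic operator applied to \<open>\<zeta> u\<close> is square integrable.
\<close>

lemma \<Lambda>_eq_0: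
  assumes \<eta>: "\<eta> \<in> test_functions Q_all"
  shows "\<Lambda> \<eta> = 0"
proof (cases "\<gamma> = 1")
  case False
  then show ?thesis using \<Lambda>_bound[OF \<eta>] by simp
next
  case True
  \<comment> \<open>The cutoff is 1 on a neighbourhood of \<open>supp \<eta>\<close>, so its first
    and second derivatives vanish there and localisation leaves no extra term where
    \<open>\<eta>\<close> lives.\<close>
  obtain \<zeta> V where \<zeta>: "\<zeta> \<in> test_functions Q_all" and \<zeta>01: "\<forall>z. 0 \<le> \<zeta> z \<and> \<zeta> z \<le> 1"
    and V: "open V" "supp \<eta> \<subseteq> V" "\<forall>z\<in>V. \<zeta> z = 1"
    using smooth_cutoff[OF test_functionsD(2)[OF \<eta>] open_Q_all test_functionsD(3)[OF \<eta>]] by blast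
  note s\<zeta> = test_functionsD(1)[OF \<zeta>]
  note t\<zeta> = test_functions_partial[OF \<zeta>]
  note tt\<zeta> = test_functions_partial[OF t\<zeta>]
  note [measurable] = smooth_borel[OF s\<zeta>]
  have pV: "partial_deriv b \<zeta> z = 0" if "z \<in> V" for b z
    using partial_deriv_cong_open[OF V(1) that, of \<zeta> "\<lambda>x. 1" b] V(3) by simp
  have ppV: "partial_deriv b (partial_deriv b \<zeta>) z = 0" if "z \<in> V" for b z
    using partial_deriv_cong_open[OF V(1) that, of "partial_deriv b \<zeta>" "\<lambda>x. 0" b] pV by simp
  obtain R where R: "\<forall>z\<in>supp \<zeta>. norm z \<le> R"
    using compact_imp_bounded[OF test_functionsD(2)[OF \<zeta>]] bounded_iff by blast
  have out: "\<zeta> z = 0" "partial_deriv b \<zeta> z = 0" "partial_deriv b (partial_deriv b \<zeta>) z = 0"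
    if b: "b \<in> Basis" and z: "norm z > R" for b z
  proof -
    have "z \<notin> supp \<zeta>" using R z by (meson not_le)
    then show 1: "\<zeta> z = 0" "partial_deriv b \<zeta> z = 0" using not_in_supp[of z \<zeta>] partial_deriv_not_in_supp[of z \<zeta>] by blast+
    have "open {z::'a \<times> real. norm z > R}" by (intro open_Collect_less continuous_intros)
    moreover have "partial_deriv b \<zeta> y = 0" if "y \<in> {z. norm z > R}" for y
    proof -
      have "y \<notin> supp \<zeta>" using R that by (auto simp: not_le[symmetric])
      then show ?thesis by (rule partial_deriv_not_in_supp)
    qed
    ultimately have "partial_deriv b (partial_deriv b \<zeta>) z = partial_deriv b (\<lambda>z. 0) z"
      using z by (intro partial_deriv_cong_open) auto
    then show "partial_deriv b (partial_deriv b \<zeta>) z = 0" by simp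
  qed
  define v where "v = (\<lambda>z. \<zeta> z * U z)"
  define g where "g = (\<lambda>b z. \<zeta> z * p b z + partial_deriv b \<zeta> z * U z)"
  \<comment> \<open>The lower order terms multiplied by \<open>\<zeta>\<close>, together with the
    commutator of the second order operator with multiplication by \<open>\<zeta>\<close>.\<close>
  define h where "h = (\<lambda>z. - (lower z * \<zeta> z) - (\<Sum>b\<in>Basis. coeff b * (2 * (p b z * partial_deriv b \<zeta> z)
      + U z * partial_deriv b (partial_deriv b \<zeta>) z)))"
  define Z where "Z = {z \<in> supp \<zeta>. U z = 0}"
  have sqh: "sq_integrable h"
    unfolding h_def
    by (intro sq_integrable_diff sq_integrable_uminus sq_integrable_sum sq_integrable_cmult sq_integrable_add
        sq_loc_mult_test(1)[OF lower_sq_loc \<zeta>] sq_loc_mult_test(1)[OF p_sq_loc t\<zeta>] sq_loc_mult_test(1)[OF U_sq_loc tt\<zeta>]) auto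
  have weak: "(\<integral>z. v z * partial_deriv b \<phi> z \<partial>lborel) = - (\<integral>z. g b z * \<phi> z \<partial>lborel)"
    if "b \<in> Basis" "\<phi> \<in> test_functions UNIV" for b \<phi>
    using weak_partial_cutoff[OF p(2)[OF that(1)] that(1) \<zeta>] that(2) unfolding weak_partial_def v_def g_def by blast
  \<comment> \<open>With this \<open>h\<close> the residual of \<open>v\<close> at
    \<open>\<phi>\<close> is \<open>\<Lambda>\<close> at \<open>\<phi> * \<zeta>\<close>, which
    \<open>\<Lambda>_bound\<close> controls.\<close>
  have res: "(\<Sum>b\<in>Basis. coeff b * (\<integral>z. g b z * partial_deriv b \<phi> z \<partial>lborel)) - (\<integral>z. h z * \<phi> z \<partial>lborel)
      = \<Lambda> (\<lambda>z. \<phi> z * \<zeta> z)" if \<phi>: "\<phi> \<in> test_functions UNIV" for \<phi>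
  proof -
    note s\<phi> = test_functionsD(1)[OF \<phi>]
    have t0: "(\<lambda>z. \<phi> z * \<zeta> z) \<in> test_functions Q_all" by (rule test_functions_mult[OF \<zeta> s\<phi>])
    have main: "(\<integral>z. g b z * partial_deriv b \<phi> z \<partial>lborel) = (\<integral>z. p b z * partial_deriv b (\<lambda>z. \<phi> z * \<zeta> z) z \<partial>lborel)
        - (\<integral>z. (2 * (p b z * partial_deriv b \<zeta> z) + U z * partial_deriv b (partial_deriv b \<zeta>) z) * \<phi> z \<partial>lborel)"
      and int: "integrable lborel (\<lambda>z. (2 * (p b z * partial_deriv b \<zeta> z) + U z * partial_deriv b (partial_deriv b \<zeta>) z) * \<phi> z)"
      if b: "b \<in> Basis" for b
    proof -
      have t1: "(\<lambda>z. partial_deriv b \<phi> z * \<zeta> z) \<in> test_functions Q_all" by (rule test_functions_mult[OF \<zeta> smooth_partial[OF s\<phi> b]])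
      have t2: "(\<lambda>z. \<phi> z * partial_deriv b \<zeta> z) \<in> test_functions Q_all" by (rule test_functions_mult[OF t\<zeta>[OF b] s\<phi>])
      have t3: "(\<lambda>z. partial_deriv b \<phi> z * partial_deriv b \<zeta> z) \<in> test_functions Q_all"
        by (rule test_functions_mult[OF t\<zeta>[OF b] smooth_partial[OF s\<phi> b]])
      have t4: "(\<lambda>z. \<phi> z * partial_deriv b (partial_deriv b \<zeta>) z) \<in> test_functions Q_all"
        by (rule test_functions_mult[OF tt\<zeta>[OF b b] s\<phi>])
      note pl = p_sq_loc[OF b]
      note i = sq_loc_mult_test(2)[OF pl t1] sq_loc_mult_test(2)[OF pl t2] sq_loc_mult_test(2)[OF U_sq_loc t3] sq_loc_mult_test(2)[OF U_sq_loc t4]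
      have d0: "partial_deriv b (\<lambda>z. \<phi> z * \<zeta> z) z = partial_deriv b \<phi> z * \<zeta> z + \<phi> z * partial_deriv b \<zeta> z" for z
        by (rule partial_deriv_mult[OF smooth_differentiable[OF s\<phi>] smooth_differentiable[OF s\<zeta>]])
      have d2: "partial_deriv b (\<lambda>z. \<phi> z * partial_deriv b \<zeta> z) z = partial_deriv b \<phi> z * partial_deriv b \<zeta> z + \<phi> z * partial_deriv b (partial_deriv b \<zeta>) z" for z
        by (rule partial_deriv_mult[OF smooth_differentiable[OF s\<phi>] smooth_differentiable[OF smooth_partial[OF s\<zeta> b]]])
      \<comment> \<open>The weak derivative of \<open>U\<close> tested with \<open>\<phi>\<close>
        times a derivative of \<open>\<zeta>\<close>: it removes the derivative from
        \<open>\<phi>\<close> in the mixed term and yields the commutator in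
        \<open>h\<close>.\<close>
      have w2: "(\<integral>z. U z * (partial_deriv b \<phi> z * partial_deriv b \<zeta> z) \<partial>lborel) + (\<integral>z. U z * (\<phi> z * partial_deriv b (partial_deriv b \<zeta>) z) \<partial>lborel)
          = - (\<integral>z. p b z * (\<phi> z * partial_deriv b \<zeta> z) \<partial>lborel)"
      proof -
        have "(\<integral>z. U z * partial_deriv b (\<lambda>z. \<phi> z * partial_deriv b \<zeta> z) z \<partial>lborel) = - (\<integral>z. p b z * (\<phi> z * partial_deriv b \<zeta> z) \<partial>lborel)"
          using p(2)[OF b] t2 unfolding weak_partial_def by blast
        then show ?thesis unfolding d2 distrib_left using i(3,4) by simp
      qed
      have e1: "(\<integral>z. g b z * partial_deriv b \<phi> z \<partial>lborel) = (\<integral>z. p b z * (partial_deriv b \<phi> z * \<zeta> z) \<partial>lborel) + (\<integral>z. U z * (partial_deriv b \<phi> z * partial_deriv b \<zeta> z) \<partial>lborel)"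
        using Bochner_Integration.integral_add[OF i(1) i(3)] by (simp add: g_def algebra_simps)
      have e2: "(\<integral>z. p b z * partial_deriv b (\<lambda>z. \<phi> z * \<zeta> z) z \<partial>lborel) = (\<integral>z. p b z * (partial_deriv b \<phi> z * \<zeta> z) \<partial>lborel) + (\<integral>z. p b z * (\<phi> z * partial_deriv b \<zeta> z) \<partial>lborel)"
        unfolding d0 distrib_left using i(1,2) by simp
      have eq: "(\<lambda>z. (2 * (p b z * partial_deriv b \<zeta> z) + U z * partial_deriv b (partial_deriv b \<zeta>) z) * \<phi> z) =
         (\<lambda>z. 2 * (p b z * (\<phi> z * partial_deriv b \<zeta> z)) + U z * (\<phi> z * partial_deriv b (partial_deriv b \<zeta>) z))"
        by (simp add: fun_eq_iff algebra_simps)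
      show "integrable lborel (\<lambda>z. (2 * (p b z * partial_deriv b \<zeta> z) + U z * partial_deriv b (partial_deriv b \<zeta>) z) * \<phi> z)"
        unfolding eq using i(2,4) by (intro Bochner_Integration.integrable_add integrable_mult_right)
      have e3: "(\<integral>z. (2 * (p b z * partial_deriv b \<zeta> z) + U z * partial_deriv b (partial_deriv b \<zeta>) z) * \<phi> z \<partial>lborel) =
         2 * (\<integral>z. p b z * (\<phi> z * partial_deriv b \<zeta> z) \<partial>lborel) + (\<integral>z. U z * (\<phi> z * partial_deriv b (partial_deriv b \<zeta>) z) \<partial>lborel)"
        unfolding eq using i(2,4) by simp
      show "(\<integral>z. g b z * partial_deriv b \<phi> z \<partial>lborel) = (\<integral>z. p b z * partial_deriv b (\<lambda>z. \<phi> z * \<zeta> z) z \<partial>lborel)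
        - (\<integral>z. (2 * (p b z * partial_deriv b \<zeta> z) + U z * partial_deriv b (partial_deriv b \<zeta>) z) * \<phi> z \<partial>lborel)"
        unfolding e1 e2 e3 using w2 by linarith
    qed
    let ?q = "\<lambda>b z. (2 * (p b z * partial_deriv b \<zeta> z) + U z * partial_deriv b (partial_deriv b \<zeta>) z) * \<phi> z"
    have "(\<lambda>z. h z * \<phi> z) = (\<lambda>z. - (lower z * (\<phi> z * \<zeta> z)) - (\<Sum>b\<in>Basis. coeff b * ?q b z))"
    proof
      fix z
      have "(\<Sum>b\<in>Basis. coeff b * (2 * (p b z * partial_deriv b \<zeta> z) + U z * partial_deriv b (partial_deriv b \<zeta>) z)) * \<phi> z
          = (\<Sum>b\<in>Basis. coeff b * ?q b z)"
        by (simp add: sum_distrib_right mult.assoc)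
      moreover have "- (lower z * \<zeta> z) * \<phi> z = - (lower z * (\<phi> z * \<zeta> z))" by (simp add: mult_ac)
      ultimately show "h z * \<phi> z = - (lower z * (\<phi> z * \<zeta> z)) - (\<Sum>b\<in>Basis. coeff b * ?q b z)"
        by (simp only: h_def left_diff_distrib)
    qed
    then have hq: "(\<integral>z. h z * \<phi> z \<partial>lborel) = - (\<integral>z. lower z * (\<phi> z * \<zeta> z) \<partial>lborel) - (\<Sum>b\<in>Basis. coeff b * (\<integral>z. ?q b z \<partial>lborel))"
      using sq_loc_mult_test(2)[OF lower_sq_loc t0] int by (simp add: Bochner_Integration.integral_sum)
    have "(\<Sum>b\<in>Basis. coeff b * (\<integral>z. g b z * partial_deriv b \<phi> z \<partial>lborel)) =
        (\<Sum>b\<in>Basis. coeff b * (\<integral>z. p b z * partial_deriv b (\<lambda>z. \<phi> z * \<zeta> z) z \<partial>lborel)) - (\<Sum>b\<in>Basis. coeff b * (\<integral>z. ?q b z \<partial>lborel))"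
      unfolding sum_subtractf[symmetric] right_diff_distrib[symmetric] by (intro sum.cong refl arg_cong2[where f="(*)"] main)
    then show ?thesis unfolding \<Lambda>_eq[OF t0] hq by simp
  qed
  \<comment> \<open>The constant is 1 because \<open>f_reac 1\<close> jumps by 1 at 0 and
    \<open>\<zeta>\<close> is at most 1.\<close>
  interpret zr: zero_set_regularity v h g coeff Z R 1
  proof
    obtain b :: "'a \<times> real" where b: "b \<in> Basis" using nonempty_Basis by blast
    show "sq_integrable v" unfolding v_def using sq_loc_mult_test(1)[OF U_sq_loc \<zeta>] by (simp add: mult.commute)
    show "sq_integrable h" by (rule sqh)
    show "sq_integrable (g b)" if b: "b \<in> Basis" for b
      using sq_integrable_add[OF sq_loc_mult_test(1)[OF p_sq_loc[OF b] \<zeta>] sq_loc_mult_test(1)[OF U_sq_loc t\<zeta>[OF b]]]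
      by (simp add: g_def mult.commute)
    show "v x = 0" if "norm x > R" for x using out(1)[OF b that] by (simp add: v_def)
    show "h x = 0" if "norm x > R" for x using out[OF _ that] out(1)[OF b that] by (simp add: h_def)
    show "g b x = 0" if "b \<in> Basis" "norm x > R" for b x using out[OF that] by (simp add: g_def)
    show "(\<integral>z. v z * partial_deriv b \<phi> z \<partial>lborel) = - (\<integral>z. g b z * \<phi> z \<partial>lborel)"
      if "b \<in> Basis" "\<phi> \<in> test_functions UNIV" for b \<phi> by (rule weak[OF that])
    show "coeff b > 0" for b using \<epsilon> by (simp add: coeff_def)
    show "Z \<in> sets borel"
    proof -
      have "supp \<zeta> \<in> sets borel" by (rule borel_closed[OF closed_closure])
      moreover have "{z. U z = 0} \<in> sets borel" by measurable
      ultimately have "supp \<zeta> \<inter> {z. U z = 0} \<in> sets borel" by (rule sets.Int)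
      moreover have "Z = supp \<zeta> \<inter> {z. U z = 0}" by (auto simp: Z_def)
      ultimately show ?thesis by simp
    qed
    show "Z \<subseteq> cball 0 R" using R by (auto simp: Z_def)
    show "v x = 0" if "x \<in> Z" for x using that by (simp add: v_def Z_def)
    show "\<bar>(\<Sum>b\<in>Basis. coeff b * (\<integral>x. g b x * partial_deriv b \<phi> x \<partial>lborel)) - (\<integral>x. h x * \<phi> x \<partial>lborel)\<bar>
        \<le> 1 * (\<integral>x. indicator Z x * \<bar>\<phi> x\<bar> \<partial>lborel)" if \<phi>: "\<phi> \<in> test_functions UNIV" for \<phi>
    proof -
      note [measurable] = smooth_borel[OF test_functionsD(1)[OF \<phi>]]
      have t0: "(\<lambda>z. \<phi> z * \<zeta> z) \<in> test_functions Q_all" by (rule test_functions_mult[OF \<zeta> test_functionsD(1)[OF \<phi>]])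
      have "(\<integral>z. (if \<gamma> = 1 \<and> U z = 0 then \<bar>\<phi> z * \<zeta> z\<bar> else 0) \<partial>lborel) \<le> (\<integral>x. indicator Z x * \<bar>\<phi> x\<bar> \<partial>lborel)"
      proof (rule integral_mono)
        show "integrable lborel (\<lambda>z. if \<gamma> = 1 \<and> U z = 0 then \<bar>\<phi> z * \<zeta> z\<bar> else 0)"
          by (rule Bochner_Integration.integrable_bound[OF test_functions_integrable[OF t0]]) auto
        show "integrable lborel (\<lambda>x. indicator Z x * \<bar>\<phi> x\<bar>)"
          by (rule integrable_bounded_mult[where B=1])
            (use test_functions_integrable[OF \<phi>] \<open>Z \<in> sets borel\<close> in \<open>auto simp: indicator_def\<close>)
        fix z
        show "(if \<gamma> = 1 \<and> U z = 0 then \<bar>\<phi> z * \<zeta> z\<bar> else 0) \<le> indicator Z z * \<bar>\<phi> z\<bar>"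
        proof (cases "U z = 0 \<and> z \<in> supp \<zeta>")
          case True
          have "\<bar>\<phi> z\<bar> * \<bar>\<zeta> z\<bar> \<le> \<bar>\<phi> z\<bar> * 1" using \<zeta>01[rule_format, of z] by (intro mult_left_mono) auto
          then show ?thesis using True by (simp add: Z_def abs_mult)
        next
          case False
          then show ?thesis using not_in_supp[of z \<zeta>] by (cases "U z = 0") (auto simp: indicator_def)
        qed
      qed
      then show ?thesis unfolding res[OF \<phi>] using \<Lambda>_bound[OF t0] by linarith
    qed
  qed simp
  have \<eta>U: "\<eta> \<in> test_functions UNIV" by (rule test_functions_mono[OF subset_UNIV \<eta>])
  have "(\<lambda>z. \<eta> z * \<zeta> z) = \<eta>"
  proof
    fix z
    show "\<eta> z * \<zeta> z = \<eta> z"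
      using V not_in_supp[of z \<eta>] by (cases "z \<in> supp \<eta>") auto
  qed
  then have "\<Lambda> \<eta> = zr.M \<eta>" using res[OF \<eta>U] unfolding zr.M_def by simp
  also have "\<dots> = - (\<integral>x. indicator Z x * (h x * \<eta> x) \<partial>lborel)" by (rule zr.M_eq[OF \<eta>U])
  also have "(\<integral>x. indicator Z x * (h x * \<eta> x) \<partial>lborel) = (\<integral>x. 0 \<partial>(lborel :: ('a \<times> real) measure))"
  proof (rule integral_cong_AE)
    note [measurable] = sq_integrableD(1)[OF sqh] smooth_borel[OF test_functionsD(1)[OF \<eta>]] zr.Z
    show "(\<lambda>x. indicator Z x * (h x * \<eta> x)) \<in> borel_measurable lborel" by measurable
    \<comment> \<open>On \<open>Z\<close> within \<open>supp \<eta>\<close> the cutoff is locally 1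
      and \<open>U\<close> is 0, so \<open>h\<close> reduces to \<open>- p (0, 1) z\<close>. There
      \<open>p (0, 1)\<close> equals \<open>g (0, 1)\<close>, which vanishes almost everywhere on
      \<open>Z\<close>.\<close>
    show "AE x in lborel. indicator Z x * (h x * \<eta> x) = 0"
      using zr.g_zero_AE[OF time_Basis]
    proof eventually_elim
      case (elim z)
      show ?case
      proof (cases "z \<in> Z \<and> z \<in> supp \<eta>")
        case True
        then have z: "z \<in> V" "U z = 0" using V(2) by (auto simp: Z_def)
        then have "p (0, 1) z = 0" using elim True V(3) pV by (simp add: g_def)
        then show ?thesis using z pV ppV by (simp add: h_def lower_def f_reac_def)
      next
        case False
        then show ?thesis using not_in_supp[of z \<eta>] by (cases "z \<in> Z") auto
      qed
    qed
  qed simp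
  finally show ?thesis by simp
qed

end

lemma inner_sum_Basis:
  "(\<Sum>i\<in>Basis. f i *\<^sub>R i) \<bullet> (\<Sum>i\<in>Basis. g i *\<^sub>R (i :: 'a::euclidean_space)) = (\<Sum>i\<in>Basis. f i * g i)"
  by (simp add: inner_sum_left inner_sum_right inner_Basis if_distrib mult.commute cong: if_cong)

theorem lemma3p1:
  fixes u0 :: "real ^ 'n \<Rightarrow> real"
    and u :: "(real ^ 'n) \<times> real \<Rightarrow> real"
    and \<epsilon> \<gamma> :: real
  assumes "1 \<le> \<gamma>" and "\<gamma> < 2"
    and "u0 \<in> H1_on UNIV" and "u0 \<in> Lp_on \<gamma> UNIV"
    and "AE x in lebesgue. 0 \<le> u0 x"
    and "0 < \<epsilon>" and "\<epsilon> < 1"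
    and "is_arg_min (energy \<epsilon> \<gamma>) (\<lambda>w. w \<in> \<U>\<^sub>0 u0) u"
  shows "\<forall>\<eta>\<in>test_functions Q_all.
     integrable (lebesgue_on Q_all) (\<lambda>z. dt u z * dt_cl \<eta> z) \<and>
     integrable (lebesgue_on Q_all)
       (\<lambda>z. dt u z * \<eta> z + grad_x u z \<bullet> grad_x_cl \<eta> z + f_reac \<gamma> (u z) * \<eta> z) \<and>
     \<epsilon> * (\<integral>z. dt u z * dt_cl \<eta> z \<partial>(lebesgue_on Q_all)) +
     (\<integral>z. (dt u z * \<eta> z + grad_x u z \<bullet> grad_x_cl \<eta> z + f_reac \<gamma> (u z) * \<eta> z)
        \<partial>(lebesgue_on Q_all)) = 0"
proof
  fix \<eta> :: "(real ^ 'n) \<times> real \<Rightarrow> real" assume \<eta>: "\<eta> \<in> test_functions Q_all"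
  have u: "u \<in> \<U>\<^sub>0 u0" using assms(8) by (simp add: is_arg_min_def)
  then have "u \<in> \<U>" by (simp add: \<U>\<^sub>0_def)
  then obtain U where U: "borel_version Q_all u U" "\<forall>r>0. sq_integrable (\<lambda>z. indicator (Q_cyl r) z * U z)"
    "\<forall>b\<in>Basis. \<exists>g\<in>borel_measurable borel. weak_partial Q_all b U g"
    using \<U>_versions by blast
  obtain p where p: "\<forall>b\<in>Basis. p b \<in> borel_measurable borel \<and> weak_partial Q_all b U (p b)"
    using bchoice[OF U(3)[unfolded Bex_def]] by blast
  \<comment> \<open>Minimality by itself would be compatible with infinite energy; a competitor of
    finite energy excludes this.\<close>
  obtain w where "w \<in> \<U>\<^sub>0 u0" "energy \<epsilon> \<gamma> w < \<infinity>"
    using competitor_exists[OF assms(3,4,6,1)] by blast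
  then have "energy \<epsilon> \<gamma> u < \<infinity>"
    using assms(8) unfolding is_arg_min_def by (meson leI le_less_trans)
  then interpret minimizer \<epsilon> \<gamma> u0 u U p
    using assms U p by unfold_locales auto
  have ver: "borel_version Q_all (weak_deriv Q_all b u) (p b)" if "b \<in> Basis" for b
    by (rule weak_deriv_version(1)[OF open_Q_all that U(1)]) (use p that in auto)
  have out: "\<eta> z = 0" "partial_deriv b \<eta> z = 0" if "z \<notin> Q_all" for b z
  proof -
    have "z \<notin> supp \<eta>" using that test_functionsD(3)[OF \<eta>] by blast
    then show "\<eta> z = 0" "partial_deriv b \<eta> z = 0" using not_in_supp[of z \<eta>] partial_deriv_not_in_supp[of z \<eta>] by blast+
  qed
  have sm: "borel_version Q_all \<eta> \<eta>" "\<And>b. b \<in> Basis \<Longrightarrow> borel_version Q_all (partial_deriv b \<eta>) (partial_deriv b \<eta>)"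
    using borel_version_smooth smooth_partial test_functionsD(1)[OF \<eta>] by blast+
  let ?P = "\<lambda>z. p (0, 1) z * partial_deriv (0, 1) \<eta> z"
  let ?G = "\<lambda>z. p (0, 1) z * \<eta> z + (\<Sum>i\<in>Basis. p (i, 0) z * partial_deriv (i, 0) \<eta> z) + f_reac \<gamma> (U z) * \<eta> z"
  have v1: "borel_version Q_all (\<lambda>z. dt u z * dt_cl \<eta> z) ?P"
    unfolding dt_def dt_cl_def by (rule borel_version_mult[OF ver[OF time_Basis] sm(2)[OF time_Basis]])
  have "borel_version Q_all (\<lambda>z. \<Sum>i\<in>Basis. weak_deriv Q_all (i, 0) u z * partial_deriv (i, 0) \<eta> z)
      (\<lambda>z. \<Sum>i\<in>Basis. p (i, 0) z * partial_deriv (i, 0) \<eta> z)"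
  proof -
    have m: "(\<lambda>z. p (i, 0) z * partial_deriv (i, 0) \<eta> z) \<in> borel_measurable borel" if "i \<in> Basis" for i
      by (rule borel_versionD(1)[OF borel_version_mult[OF ver[OF space_Basis[OF that]] sm(2)[OF space_Basis[OF that]]]])
    have "AE z in lborel. \<forall>i\<in>Basis. z \<in> Q_all \<longrightarrow> weak_deriv Q_all (i, 0) u z = p (i, 0) z"
      using borel_versionD(2)[OF ver[OF space_Basis]] by (subst AE_finite_all) auto
    then have "AE z in lborel. z \<in> Q_all \<longrightarrow> (\<Sum>i\<in>Basis. weak_deriv Q_all (i, 0) u z * partial_deriv (i, 0) \<eta> z) =
       (\<Sum>i\<in>Basis. p (i, 0) z * partial_deriv (i, 0) \<eta> z)"
      by eventually_elim simp
    then show ?thesis using borel_measurable_sum[OF m] by (simp add: borel_version_def)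
  qed
  then have "borel_version Q_all (\<lambda>z. grad_x u z \<bullet> grad_x_cl \<eta> z) (\<lambda>z. \<Sum>i\<in>Basis. p (i, 0) z * partial_deriv (i, 0) \<eta> z)"
    unfolding grad_x_def grad_x_cl_def inner_sum_Basis .
  then have v2: "borel_version Q_all (\<lambda>z. dt u z * \<eta> z + grad_x u z \<bullet> grad_x_cl \<eta> z + f_reac \<gamma> (u z) * \<eta> z) ?G"
    unfolding dt_def by (intro borel_version_add borel_version_mult ver[OF time_Basis] sm(1) borel_version_comp[OF U(1)] f_reac_borel)
  have P0: "?P z = 0" and G0: "?G z = 0" if "z \<notin> Q_all" for z
    using out[OF that] by simp_all
  have P: "integral\<^sup>L (lebesgue_on Q_all) (\<lambda>z. dt u z * dt_cl \<eta> z) = (\<integral>z. ?P z \<partial>lborel)"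
    "integrable (lebesgue_on Q_all) (\<lambda>z. dt u z * dt_cl \<eta> z) \<longleftrightarrow> integrable lborel ?P"
    by (rule lebesgue_on_version_supported[OF v1 borel_Q_all], rule P0, assumption)+
  have G: "integral\<^sup>L (lebesgue_on Q_all) (\<lambda>z. dt u z * \<eta> z + grad_x u z \<bullet> grad_x_cl \<eta> z + f_reac \<gamma> (u z) * \<eta> z)
      = (\<integral>z. ?G z \<partial>lborel)"
    "integrable (lebesgue_on Q_all) (\<lambda>z. dt u z * \<eta> z + grad_x u z \<bullet> grad_x_cl \<eta> z + f_reac \<gamma> (u z) * \<eta> z)
      \<longleftrightarrow> integrable lborel ?G"
    by (rule lebesgue_on_version_supported[OF v2 borel_Q_all], rule G0, assumption)+
  have iP: "integrable lborel ?P" by (rule time_integrable(1)[OF \<eta>])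
  have iG: "integrable lborel ?G"
    by (intro Bochner_Integration.integrable_add time_integrable[OF \<eta>] space_sum_integrable[OF \<eta>])
  have "\<Lambda> \<eta> = \<epsilon> * (\<integral>z. ?P z \<partial>lborel) + (\<integral>z. ?G z \<partial>lborel)"
  proof -
    have "\<Lambda> \<eta> = (\<integral>z. \<epsilon> * ?P z + ?G z \<partial>lborel)" unfolding \<Lambda>_def by (simp add: add.assoc)
    also have "\<dots> = (\<integral>z. \<epsilon> * ?P z \<partial>lborel) + (\<integral>z. ?G z \<partial>lborel)"
      by (rule Bochner_Integration.integral_add[OF integrable_mult_right[OF iP] iG])
    finally show ?thesis by simp
  qed
  then show "integrable (lebesgue_on Q_all) (\<lambda>z. dt u z * dt_cl \<eta> z) \<and>
     integrable (lebesgue_on Q_all)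
       (\<lambda>z. dt u z * \<eta> z + grad_x u z \<bullet> grad_x_cl \<eta> z + f_reac \<gamma> (u z) * \<eta> z) \<and>
     \<epsilon> * (\<integral>z. dt u z * dt_cl \<eta> z \<partial>(lebesgue_on Q_all)) +
     (\<integral>z. (dt u z * \<eta> z + grad_x u z \<bullet> grad_x_cl \<eta> z + f_reac \<gamma> (u z) * \<eta> z)
        \<partial>(lebesgue_on Q_all)) = 0"
    unfolding P(1) G(1) P(2) G(2) using iP iG \<Lambda>_eq_0[OF \<eta>] by simp
qed

end
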